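(* Let $G$ be a graph with canonical decomposition $G=(G_k,A_k,B_k)\circ \dots \circ (G_1,A_1,B_1) \circ G_0$. Then $G$ is a hereditary unigraph if and only if both of the following hold: each split canonical component of $G$ (among $G_0,\dots,G_k$) with more than one vertex is a top-expanded spider or a bottom-expanded spider; and $G_0$ or $\overline{G_0}$ is either split or isomorphic to one of $C_5$, $rK_2$ for some $r \geq 2$, or $K_{1,r}+sK_2$ for some $r \geq 2$ and $s \geq 1$.
   Context: All graphs are finite, with no loops or multiple edges. $\overline{G}$ is the complement of $G$, $G+H$ is the disjoint union, $mG$ is the disjoint union of $m$ copies of $G$, $K_n$, $C_n$, $K_{m,n}$ are the complete graph, cycle and complete bipartite graph. A unigraph is a graph that is, up to isomorphism, the unique graph having its degree sequence. A hereditary unigraph is a graph all of whose induced subgraphs (including itself) are unigraphs. Canonical decomposition: A graph is split if its vertex set can be partitioned into an independent set and a clique (either may be empty). A splitted graph is a triple $(G,A,B)$ where $G$ is a split graph and $A,B$ is a partition of $V(G)$ into an independent set $A$ and a clique $B$. Isomorphism of splitted graphs $(G,A,B)\cong(G',A',B')$ means a graph isomorphism $V(G)\to V(G')$ carrying $A$ to $A'$. For a splitted graph $(G,A,B)$ and a graph $H$ on disjoint vertex sets, the composition $(G,A,B)\circ H$ is the graph formed by adding to $G+H$ all edges $uv$ with $u\in B$ and $v\in V(H)$. The composition of two splitted graphs is a splitted graph (take unions of the independent sets and of the cliques), and $\circ$ is associative. A graph is decomposable if it can be written as $(G,A,B)\circ H$ with $G$ and $H$ both having at least one vertex; otherwise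 it is indecomposable. By a theorem of Tyshkevich every graph $G$ has an expression $G=(G_k,A_k,B_k)\circ\dots\circ(G_1,A_1,B_1)\circ G_0$ with all $G_i$ indecomposable (and $k=0$ if $G$ is indecomposable), unique up to isomorphism of the splitted graphs $(G_i,A_i,B_i)$, $i\ge1$, and of $G_0$; this is the canonical decomposition, and $G_0,\dots,G_k$ are the canonical components of $G$. Spiders: A headless (prime) spider is a graph whose vertex set admits a partition into an independent set $A$ (the feet) and a clique $B$ (the body vertices) with $|A|=|B|\ge 2$, such that there is a bijection $f:A\to B$ for which either (a) each $v\in A$ is adjacent only to $f(v)$, or (b) each $v\in A$ is adjacent to all vertices of $B$ except $f(v)$. To substitute a (nonempty) graph $H$ for a vertex $v$ of $J$ is to take the disjoint union of $H$ and $J-v$ and add all edges $uw$ with $u\in V(H)$ and $w\in N_J(v)$. A top-expanded spider is a graph obtained by substituting complete graphs for body vertices in a headless spider; a bottom-expanded spider is a graph obtained by substituting edgeless graphs for feet in a headless spider (in both cases no actual change, i.e. substituting single vertices, is allowed). *)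

theory Defs
  imports "HOL-Library.Multiset" "HOL-Library.Ramsey"
begin

text \<open>
  Edges are two-element sets of vertices, as in \<^theory>\<open>HOL-Library.Ramsey\<close>, whose
  \<^const>\<open>clique\<close>, \<^const>\<open>indep\<close> and \<open>[V]\<^bsup>2\<^esup>\<close> (the two-element subsets of \<open>V\<close>) are used
  throughout. The graph without vertices is admitted.
\<close>

datatype 'a graph = Graph (verts: "'a set") (edges: "'a set set")

definition simple_graph :: "'a graph \<Rightarrow> bool" where
  "simple_graph G \<longleftrightarrow> finite (verts G) \<and> edges G \<subseteq> [verts G]\<^bsup>2\<^esup>"

definition neighbours :: "'a graph \<Rightarrow> 'a \<Rightarrow> 'a set" where
  "neighbours G v = {u \<in> verts G. {u, v} \<in> edges G}"

definition induced :: "'a graph \<Rightarrow> 'a set \<Rightarrow> 'a graph" where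
  "induced G S = Graph S {e \<in> edges G. e \<subseteq> S}"

definition complement :: "'a graph \<Rightarrow> 'a graph" where
  "complement G = Graph (verts G) ([verts G]\<^bsup>2\<^esup> - edges G)"

definition graph_iso :: "'a graph \<Rightarrow> 'b graph \<Rightarrow> bool" (infix "\<simeq>" 50) where
  "G \<simeq> H \<longleftrightarrow> (\<exists>f. bij_betw f (verts G) (verts H) \<and>
     (\<forall>u\<in>verts G. \<forall>v\<in>verts G. {u, v} \<in> edges G \<longleftrightarrow> {f u, f v} \<in> edges H))"


subsection \<open>Particular graphs\<close>

definition complete_graph :: "nat \<Rightarrow> nat graph" where
  "complete_graph n = Graph {..<n} ([{..<n}]\<^bsup>2\<^esup>)"

text \<open>A cycle only for \<open>n \<ge> 3\<close>.\<close>

definition cycle_graph :: "nat \<Rightarrow> nat graph" where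
  "cycle_graph n = Graph {..<n} {{i, (i + 1) mod n} |i. i < n}"

definition complete_bipartite :: "nat \<Rightarrow> nat \<Rightarrow> (nat + nat) graph" where
  "complete_bipartite m n =
     Graph ({..<m} <+> {..<n}) {{Inl i, Inr j} |i j. i < m \<and> j < n}"

definition disjoint_union :: "'a graph \<Rightarrow> 'b graph \<Rightarrow> ('a + 'b) graph" where
  "disjoint_union G H =
     Graph (verts G <+> verts H) ((`) Inl ` edges G \<union> (`) Inr ` edges H)"

definition copies :: "nat \<Rightarrow> 'a graph \<Rightarrow> (nat \<times> 'a) graph" where
  "copies m G = Graph ({..<m} \<times> verts G) {Pair i ` e |i e. i < m \<and> e \<in> edges G}"


subsection \<open>Unigraphs\<close>

text \<open>The degree sequence is recorded as a multiset, i.e. irrespective of order.\<close>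

definition degree_sequence :: "'a graph \<Rightarrow> nat multiset" where
  "degree_sequence G = image_mset (\<lambda>v. card (neighbours G v)) (mset_set (verts G))"

text \<open>
  Comparing only with graphs on the same vertex type is no restriction: a graph with the
  same degree sequence has equally many vertices, hence a copy on the vertex set of \<open>G\<close>.
\<close>

definition unigraph :: "'a graph \<Rightarrow> bool" where
  "unigraph G \<longleftrightarrow> simple_graph G \<and>
     (\<forall>H :: 'a graph. simple_graph H \<and> degree_sequence H = degree_sequence G \<longrightarrow> H \<simeq> G)"

definition hereditary_unigraph :: "'a graph \<Rightarrow> bool" where
  "hereditary_unigraph G \<longleftrightarrow> simple_graph G \<and> (\<forall>S \<subseteq> verts G. unigraph (induced G S))"


subsection \<open>Canonical decomposition\<close>

definition splitted :: "'a graph \<Rightarrow> 'a set \<Rightarrow> 'a set \<Rightarrow> bool" where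
  "splitted G A B \<longleftrightarrow> simple_graph G \<and> A \<union> B = verts G \<and> A \<inter> B = {} \<and>
     indep A (edges G) \<and> clique B (edges G)"

definition split_graph :: "'a graph \<Rightarrow> bool" where
  "split_graph G \<longleftrightarrow> (\<exists>A B. splitted G A B)"

text \<open>Meaningful for operands with disjoint vertex sets.\<close>

fun compose :: "'a graph \<times> 'a set \<times> 'a set \<Rightarrow> 'a graph \<Rightarrow> 'a graph" where
  "compose (G, A, B) H =
     Graph (verts G \<union> verts H)
       (edges G \<union> edges H \<union> {{u, v} |u v. u \<in> B \<and> v \<in> verts H})"

definition decomposable :: "'a graph \<Rightarrow> bool" where
  "decomposable G \<longleftrightarrow> (\<exists>G' A B H. splitted G' A B \<and> simple_graph H \<and>
     verts G' \<inter> verts H = {} \<and> verts G' \<noteq> {} \<and> verts H \<noteq> {} \<and>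
     G = compose (G', A, B) H)"

text \<open>
  The list \<open>[(G\<^sub>k, A\<^sub>k, B\<^sub>k), \<dots>, (G\<^sub>1, A\<^sub>1, B\<^sub>1)]\<close> and the graph \<open>G\<^sub>0\<close> form a canonical decomposition
  of \<open>G\<close>. The components are taken as actual subgraphs of \<open>G\<close> with pairwise disjoint vertex
  sets. They have to be nonempty, except that the graph without vertices is its own only
  component: an empty graph is vacuously indecomposable and could otherwise be inserted
  anywhere, which would destroy uniqueness.
\<close>

definition canonical_decomposition ::
  "'a graph \<Rightarrow> ('a graph \<times> 'a set \<times> 'a set) list \<Rightarrow> 'a graph \<Rightarrow> bool" where
  "canonical_decomposition G Cs G0 \<longleftrightarrow>
     (\<forall>(H, A, B) \<in> set Cs. splitted H A B \<and> \<not> decomposable H \<and> verts H \<noteq> {}) \<and>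
     simple_graph G0 \<and> \<not> decomposable G0 \<and> (Cs \<noteq> [] \<longrightarrow> verts G0 \<noteq> {}) \<and>
     sorted_wrt disjnt (map (\<lambda>(H, A, B). verts H) Cs @ [verts G0]) \<and>
     G = foldr compose Cs G0"

definition canonical_components ::
  "('a graph \<times> 'a set \<times> 'a set) list \<Rightarrow> 'a graph \<Rightarrow> 'a graph set" where
  "canonical_components Cs G0 = insert G0 (fst ` set Cs)"


subsection \<open>Spiders\<close>

definition headless_spider :: "'a graph \<Rightarrow> 'a set \<Rightarrow> 'a set \<Rightarrow> bool" where
  "headless_spider J A B \<longleftrightarrow> splitted J A B \<and> card A = card B \<and> card A \<ge> 2 \<and>
     (\<exists>f. bij_betw f A B \<and>
        ((\<forall>v\<in>A. neighbours J v = {f v}) \<or> (\<forall>v\<in>A. neighbours J v = B - {f v})))"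

text \<open>Meaningful if the vertices of \<open>H\<close> are not among those of \<open>J - v\<close>.\<close>

definition substitute :: "'a graph \<Rightarrow> 'a \<Rightarrow> 'a graph \<Rightarrow> 'a graph" where
  "substitute J v H =
     Graph ((verts J - {v}) \<union> verts H)
       ({e \<in> edges J. v \<notin> e} \<union> edges H \<union> {{u, w} |u w. u \<in> verts H \<and> w \<in> neighbours J v})"

text \<open>
  \<open>expansion P S J G\<close>: the graph \<open>G\<close> arises from \<open>J\<close> by substituting nonempty graphs with property
  \<open>P\<close> for some of the vertices in \<open>S\<close>, one after the other. Each vertex is used at most once,
  and the new vertices are not substituted for again.
\<close>

inductive expansion ::
  "('a graph \<Rightarrow> bool) \<Rightarrow> 'a set \<Rightarrow> 'a graph \<Rightarrow> 'a graph \<Rightarrow> bool" for P where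
  none: "expansion P S J J"
| step: "expansion P S J G" if
    "v \<in> S" "simple_graph H" "verts H \<noteq> {}" "P H" "verts H \<inter> (verts J - {v}) = {}"
    "expansion P (S - {v}) (substitute J v H) G"

definition complete :: "'a graph \<Rightarrow> bool" where
  "complete G \<longleftrightarrow> edges G = [verts G]\<^bsup>2\<^esup>"

definition edgeless :: "'a graph \<Rightarrow> bool" where
  "edgeless G \<longleftrightarrow> edges G = {}"

definition top_expanded_spider :: "'a graph \<Rightarrow> bool" where
  "top_expanded_spider G \<longleftrightarrow> (\<exists>J A B. headless_spider J A B \<and> expansion complete B J G)"

definition bottom_expanded_spider :: "'a graph \<Rightarrow> bool" where
  "bottom_expanded_spider G \<longleftrightarrow> (\<exists>J A B. headless_spider J A B \<and> expansion edgeless A J G)"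

end

theory Submission
  imports Defs "HOL-Combinatorics.Permutations"
begin

text \<open>
  The building blocks of a hereditary unigraph are disjoint unions of stars. In an expanded spider
  the relation between the feet and the body vertices is a union of at least two stars, all with
  their centres on the same side, or the complement of such a relation: the side on which vertices
  are substituted consists of the leaves. The exceptional graphs other than \<open>C\<^sub>5\<close> are, up to complement, one star together
  with a matching. A union of stars is determined by its degrees if all centres lie on the same side
  of a split graph, or if at most one of the stars has more than one edge.

  \<^emph>\<open>Sufficiency.\<close> The degrees of a composition \<open>(T, A, B) \<circ> K\<close> force every graph with the same
  degrees to be a composition with the same sets \<open>A\<close> and \<open>B\<close>, because the degree sum over \<open>B\<close>
  minus that over \<open>A\<close> is extremal (\<open>decomposition_determined_by_degrees\<close>). The degrees inside
  \<open>K\<close> and between \<open>A\<close> and \<open>B\<close> are then determined as well. If the relation between \<open>A\<close> and \<open>B\<close>, or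
  its complement, is a partial function from one side to the other, these degrees determine it up to
  a permutation of one side, so that the composition is a unigraph whenever \<open>K\<close> is one
  (\<open>unigraph_composition\<close>). This condition is inherited by induced subgraphs and holds for expanded
  spiders; as an indecomposable graph with more than one vertex has at most one splitting, it holds
  for the splitting that is given in the canonical decomposition. It remains to treat \<open>G\<^sub>0\<close>: a star
  with a matching is found again from the degrees, as is \<open>C\<^sub>5\<close>, and the proper induced subgraphs
  of \<open>C\<^sub>5\<close> lie in the spider \<open>P\<^sub>4\<close>.

  \<^emph>\<open>Necessity.\<close> The canonical components are induced subgraphs, hence hereditary unigraphs. A few
  graphs on five or six vertices share their degrees with a different graph, so they are forbidden
  as induced subgraphs. Both structure theorems follow the same pattern: a maximal
  induced subgraph of the desired shape is chosen, the forbidden subgraphs make every other vertex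
  see all or none of it, apart from vertices that would enlarge it, and then the graph is
  decomposable unless nothing else is left. For a split graph the desired shape is a union of stars
  as above (\<open>indecomposable_untangled_starlike\<close>). A graph that is not split contains \<open>2K\<^sub>2\<close>, its
  complement \<open>C\<^sub>4\<close> or \<open>C\<^sub>5\<close> (\<open>nonsplit_obstruction\<close>), and the shape is a star with a matching around
  \<open>2K\<^sub>2\<close>, its complement around \<open>C\<^sub>4\<close>, or \<open>C\<^sub>5\<close> itself (\<open>indecomposable_nonsplit_structure\<close>).
\<close>


section \<open>Graphs as adjacency relations\<close>

definition adj :: "'a graph \<Rightarrow> 'a \<Rightarrow> 'a \<Rightarrow> bool" where
  "adj G u v \<longleftrightarrow> {u, v} \<in> edges G"

definition deg :: "'a graph \<Rightarrow> 'a \<Rightarrow> nat" where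
  "deg G v = card {u \<in> verts G. adj G v u}"

definition graph_of :: "'a set \<Rightarrow> ('a \<Rightarrow> 'a \<Rightarrow> bool) \<Rightarrow> 'a graph" where
  "graph_of V r = Graph V {{u, v} |u v. u \<in> V \<and> v \<in> V \<and> u \<noteq> v \<and> r u v}"

lemma adj_commute: "adj G u v \<longleftrightarrow> adj G v u"
  by (simp add: adj_def insert_commute)

lemma adjD:
  assumes "simple_graph G" "adj G u v"
  shows "u \<in> verts G" "v \<in> verts G" "u \<noteq> v"
proof -
  have "{u, v} \<in> [verts G]\<^bsup>2\<^esup>" using assms unfolding simple_graph_def adj_def by blast
  then show "u \<in> verts G" "v \<in> verts G" "u \<noteq> v" by simp_all
qed

lemma simple_graph_finite: "simple_graph G \<Longrightarrow> finite (verts G)"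
  by (simp add: simple_graph_def)

lemma card_neighbours: "card (neighbours G v) = deg G v"
  unfolding neighbours_def deg_def adj_def by (simp add: insert_commute)

lemma graph_eqI:
  assumes G: "simple_graph G" and H: "simple_graph H" and V: "verts G = verts H"
    and adj: "\<And>u v. u \<in> verts G \<Longrightarrow> v \<in> verts G \<Longrightarrow> u \<noteq> v \<Longrightarrow> adj G u v \<longleftrightarrow> adj H u v"
  shows "G = H"
proof -
  have "e \<in> edges G \<longleftrightarrow> e \<in> edges H" for e
  proof (cases "e \<in> [verts G]\<^bsup>2\<^esup>")
    case True
    then show ?thesis using adj by (auto elim!: nsets2_E simp: adj_def)
  next
    case False
    then show ?thesis using G H V unfolding simple_graph_def by auto
  qed
  then show ?thesis using V by (simp add: graph.expand set_eq_iff)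
qed

lemma verts_graph_of [simp]: "verts (graph_of V r) = V"
  by (simp add: graph_of_def)

lemma simple_graph_of: "finite V \<Longrightarrow> simple_graph (graph_of V r)"
  unfolding simple_graph_def graph_of_def by auto

lemma adj_graph_of:
  assumes "symp r"
  shows "adj (graph_of V r) u v \<longleftrightarrow> u \<in> V \<and> v \<in> V \<and> u \<noteq> v \<and> r u v"
  using assms unfolding adj_def graph_of_def by (auto simp: doubleton_eq_iff dest: sympD)

lemma verts_induced [simp]: "verts (induced G S) = S"
  by (simp add: induced_def)

lemma adj_induced [simp]: "adj (induced G S) u v \<longleftrightarrow> u \<in> S \<and> v \<in> S \<and> adj G u v"
  by (auto simp: induced_def adj_def)

lemma simple_induced: "simple_graph G \<Longrightarrow> S \<subseteq> verts G \<Longrightarrow> simple_graph (induced G S)"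
  unfolding simple_graph_def induced_def
  by (auto intro: finite_subset simp: nsets_def)

lemma induced_induced: "T \<subseteq> S \<Longrightarrow> induced (induced G S) T = induced G T"
  by (auto simp: induced_def)

lemma induced_verts: "simple_graph G \<Longrightarrow> induced G (verts G) = G"
  by (rule graph_eqI) (auto simp: simple_induced)

lemma verts_complement [simp]: "verts (complement G) = verts G"
  by (simp add: complement_def)

lemma adj_complement [simp]:
  "adj (complement G) u v \<longleftrightarrow> u \<in> verts G \<and> v \<in> verts G \<and> u \<noteq> v \<and> \<not> adj G u v"
  by (auto simp: complement_def adj_def)

lemma simple_complement: "simple_graph G \<Longrightarrow> simple_graph (complement G)"
  by (auto simp: simple_graph_def complement_def)

lemma complement_complement: "simple_graph G \<Longrightarrow> complement (complement G) = G"
  by (rule graph_eqI) (auto simp: simple_complement)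

lemma induced_complement:
  "simple_graph G \<Longrightarrow> S \<subseteq> verts G \<Longrightarrow> induced (complement G) S = complement (induced G S)"
  by (rule graph_eqI) (auto simp: simple_complement simple_induced)

lemma deg_induced: "v \<in> S \<Longrightarrow> deg (induced G S) v = card {u \<in> S. adj G v u}"
  by (auto simp: deg_def intro: arg_cong[where f = card])

lemma deg_complement:
  assumes "simple_graph G" "v \<in> verts G"
  shows "deg (complement G) v = card (verts G) - 1 - deg G v"
proof -
  have "{u \<in> verts G. adj (complement G) v u} = (verts G - {v}) - {u \<in> verts G. adj G v u}"
    using assms by auto
  moreover have "{u \<in> verts G. adj G v u} \<subseteq> verts G - {v}"
    using adjD(3)[OF assms(1)] by auto
  ultimately show ?thesis
    using assms simple_graph_finite[OF assms(1)]
    by (simp add: deg_def card_Diff_subset finite_subset)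
qed

subsection \<open>Isomorphism\<close>

lemma graph_iso_adj:
  "G \<simeq> H \<longleftrightarrow> (\<exists>f. bij_betw f (verts G) (verts H) \<and>
     (\<forall>u\<in>verts G. \<forall>v\<in>verts G. adj G u v \<longleftrightarrow> adj H (f u) (f v)))"
  by (simp add: graph_iso_def adj_def)

lemma graph_iso_sym:
  assumes "G \<simeq> H"
  shows "H \<simeq> G"
proof -
  obtain f where f: "bij_betw f (verts G) (verts H)"
    and adj: "\<And>u v. u \<in> verts G \<Longrightarrow> v \<in> verts G \<Longrightarrow> adj G u v \<longleftrightarrow> adj H (f u) (f v)"
    using assms unfolding graph_iso_adj by blast
  let ?g = "inv_into (verts G) f"
  have g: "bij_betw ?g (verts H) (verts G)" by (rule bij_betw_inv_into[OF f])
  have "adj H u v \<longleftrightarrow> adj G (?g u) (?g v)" if "u \<in> verts H" "v \<in> verts H" for u v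
    using adj[of "?g u" "?g v"] that bij_betw_inv_into_right[OF f] bij_betwE[OF g] by auto
  then show ?thesis using g unfolding graph_iso_adj by blast
qed

lemma graph_iso_trans:
  assumes "G \<simeq> H" "H \<simeq> K"
  shows "G \<simeq> K"
proof -
  obtain f g where f: "bij_betw f (verts G) (verts H)" and g: "bij_betw g (verts H) (verts K)"
    and adj: "\<And>u v. u \<in> verts G \<Longrightarrow> v \<in> verts G \<Longrightarrow> adj G u v \<longleftrightarrow> adj H (f u) (f v)"
      "\<And>u v. u \<in> verts H \<Longrightarrow> v \<in> verts H \<Longrightarrow> adj H u v \<longleftrightarrow> adj K (g u) (g v)"
    using assms unfolding graph_iso_adj by blast
  show ?thesis unfolding graph_iso_adj
    using bij_betw_trans[OF f g] adj bij_betwE[OF f] by (intro exI[of _ "g \<circ> f"]) auto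
qed

lemma graph_iso_complement: "G \<simeq> H \<Longrightarrow> complement G \<simeq> complement H"
  unfolding graph_iso_adj
  by (elim exE, rule exI) (auto simp: bij_betw_def inj_on_eq_iff)

lemma graph_iso_deg:
  assumes f: "bij_betw f (verts G) (verts H)" and v: "v \<in> verts G"
    and adj: "\<And>u v. u \<in> verts G \<Longrightarrow> v \<in> verts G \<Longrightarrow> adj G u v \<longleftrightarrow> adj H (f u) (f v)"
  shows "deg H (f v) = deg G v"
proof -
  have "bij_betw f {u \<in> verts G. adj G v u} {w \<in> verts H. adj H (f v) w}"
    unfolding bij_betw_def
  proof
    show "inj_on f {u \<in> verts G. adj G v u}"
      using f by (auto simp: bij_betw_def inj_on_def)
    show "f ` {u \<in> verts G. adj G v u} = {w \<in> verts H. adj H (f v) w}"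
    proof (intro set_eqI iffI)
      fix w assume "w \<in> {w \<in> verts H. adj H (f v) w}"
      moreover from this obtain u where u: "u \<in> verts G" "w = f u"
        using f by (auto simp: bij_betw_def)
      ultimately show "w \<in> f ` {u \<in> verts G. adj G v u}"
        using adj[OF v u(1)] by simp
    next
      fix w assume "w \<in> f ` {u \<in> verts G. adj G v u}"
      then obtain u where u: "u \<in> verts G" "w = f u" "adj G v u" by blast
      then have "adj H (f v) (f u)" using adj[OF v u(1)] by simp
      then show "w \<in> {w \<in> verts H. adj H (f v) w}" using u bij_betwE[OF f] by simp
    qed
  qed
  then show ?thesis unfolding deg_def by (simp add: bij_betw_same_card)
qed


section \<open>Unigraphs and hereditary unigraphs\<close>

lemma matching_values_bij:
  assumes "finite X" "finite Y" "image_mset f (mset_set X) = image_mset g (mset_set Y)"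
  obtains h where "bij_betw h X Y" "\<And>x. x \<in> X \<Longrightarrow> g (h x) = f x"
proof -
  have "card X = card Y"
    using arg_cong[OF assms(3), of size] by simp
  then obtain k where k: "bij_betw k X Y"
    using finite_same_card_bij assms by blast
  have "image_mset f (mset_set X) = image_mset (g \<circ> k) (mset_set X)"
    using assms(3) k by (metis bij_betw_def image_mset_mset_set multiset.map_comp)
  then obtain p where p: "p permutes X" "\<forall>x\<in>X. f x = (g \<circ> k) (p x)"
    using image_mset_eq_implies_permutes[OF \<open>finite X\<close>] by metis
  then have "bij_betw (k \<circ> p) X Y"
    using bij_betw_trans[OF permutes_imp_bij k] by blast
  then show thesis using p by (intro that[of "k \<circ> p"]) auto
qed

text \<open>
  A graph with the same degree sequence can be transported along a bijection that preserves
  degrees, so that only graphs with the same degree function have to be considered.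
\<close>

lemma unigraph_iff_same_degrees:
  "unigraph G \<longleftrightarrow> simple_graph G \<and>
     (\<forall>H. simple_graph H \<and> verts H = verts G \<and> (\<forall>v\<in>verts G. deg H v = deg G v) \<longrightarrow> H \<simeq> G)"
    (is "_ \<longleftrightarrow> _ \<and> ?same")
proof
  assume u: "unigraph G"
  have "degree_sequence H = degree_sequence G"
    if "simple_graph H" "verts H = verts G" "\<forall>v\<in>verts G. deg H v = deg G v" for H
    using that unfolding degree_sequence_def card_neighbours
    by (metis (mono_tags, lifting) finite_set_mset_mset_set image_mset_cong simple_graph_finite)
  then show "simple_graph G \<and> ?same"
    using u unfolding unigraph_def by blast
next
  assume G: "simple_graph G \<and> ?same"
  show "unigraph G"
    unfolding unigraph_def
  proof (intro conjI allI impI; (elim conjE)?)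
    show "simple_graph G" using G by simp
    fix H :: "'a graph"
    assume H: "simple_graph H" and ds: "degree_sequence H = degree_sequence G"
    obtain f where f: "bij_betw f (verts H) (verts G)"
      and deg: "\<And>v. v \<in> verts H \<Longrightarrow> deg G (f v) = deg H v"
      using matching_values_bij[OF _ _ ds[unfolded degree_sequence_def card_neighbours]]
        G H simple_graph_finite by metis
    let ?g = "inv_into (verts H) f"
    define K where "K = graph_of (verts G) (\<lambda>u v. adj H (?g u) (?g v))"
    have gf: "?g (f v) = v" if "v \<in> verts H" for v
      using bij_betw_inv_into_left[OF f that] .
    have adjK: "adj K u v \<longleftrightarrow> u \<in> verts G \<and> v \<in> verts G \<and> u \<noteq> v \<and> adj H (?g u) (?g v)" for u v
      unfolding K_def by (rule adj_graph_of) (auto simp: symp_def adj_commute)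
    have K: "simple_graph K" "verts K = verts G"
      using G by (auto simp: K_def simple_graph_of simple_graph_finite)
    have HK: "adj H u v \<longleftrightarrow> adj K (f u) (f v)" if "u \<in> verts H" "v \<in> verts H" for u v
      using that gf[of u] gf[of v] adjD(3)[OF H, of u v] bij_betwE[OF f] by (metis adjK)
    have "deg K v = deg G v" if "v \<in> verts G" for v
    proof -
      obtain u where "u \<in> verts H" "v = f u"
        using \<open>v \<in> verts G\<close> f by (metis bij_betw_imp_surj_on imageE)
      moreover have "deg K (f u) = deg H u"
        by (rule graph_iso_deg) (use f K HK \<open>u \<in> verts H\<close> in metis)+
      ultimately show ?thesis using deg by metis
    qed
    then have "K \<simeq> G" using G K by blast
    moreover have "H \<simeq> K"
      unfolding graph_iso_adj using f HK K(2) by metis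
    ultimately show "H \<simeq> G" by (rule graph_iso_trans[rotated])
  qed
qed

lemma unigraph_complement:
  assumes "unigraph G"
  shows "unigraph (complement G)"
proof -
  have G: "simple_graph G" using assms by (simp add: unigraph_def)
  have "H \<simeq> complement G"
    if H: "simple_graph H" "verts H = verts G" and deg: "\<forall>v\<in>verts G. deg H v = deg (complement G) v" for H
  proof -
    have "deg (complement H) v = deg G v" if "v \<in> verts G" for v
      using that deg deg_complement[OF H(1), of v] deg_complement[OF simple_complement[OF G], of v]
      by (simp add: H(2) complement_complement[OF G])
    moreover have "verts (complement H) = verts G" using H(2) by simp
    ultimately have "complement H \<simeq> G"
      using assms simple_complement[OF H(1)] unfolding unigraph_iff_same_degrees by blast
    then show ?thesis
      using graph_iso_complement[of "complement H" G] by (simp add: complement_complement[OF H(1)])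
  qed
  then show ?thesis
    using simple_complement[OF G] unfolding unigraph_iff_same_degrees verts_complement by blast
qed

lemma hereditary_unigraph_simple: "hereditary_unigraph G \<Longrightarrow> simple_graph G"
  by (simp add: hereditary_unigraph_def)

lemma hereditary_unigraph_complement:
  "hereditary_unigraph G \<Longrightarrow> hereditary_unigraph (complement G)"
  unfolding hereditary_unigraph_def
  by (auto simp: simple_complement induced_complement unigraph_complement)

lemma hereditary_unigraph_induced:
  "hereditary_unigraph G \<Longrightarrow> S \<subseteq> verts G \<Longrightarrow> hereditary_unigraph (induced G S)"
  unfolding hereditary_unigraph_def
  by (auto simp: simple_induced induced_induced)


section \<open>Splittings and decompositions\<close>

text \<open>
  \<open>decomposes G A B Q\<close> expresses \<open>G = (G[A \<union> B], A, B) \<circ> G[Q]\<close> by adjacencies inside \<open>G\<close>. All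
  three parts may be empty; a splitting of \<open>G\<close> is the case \<open>Q = {}\<close>.
\<close>

definition decomposes :: "'a graph \<Rightarrow> 'a set \<Rightarrow> 'a set \<Rightarrow> 'a set \<Rightarrow> bool" where
  "decomposes G A B Q \<longleftrightarrow> verts G = A \<union> B \<union> Q \<and> A \<inter> B = {} \<and> A \<inter> Q = {} \<and> B \<inter> Q = {} \<and>
     (\<forall>u\<in>A. \<forall>v\<in>A. \<not> adj G u v) \<and> (\<forall>u\<in>B. \<forall>v\<in>B. u \<noteq> v \<longrightarrow> adj G u v) \<and>
     (\<forall>u\<in>A. \<forall>v\<in>Q. \<not> adj G u v) \<and> (\<forall>u\<in>B. \<forall>v\<in>Q. adj G u v)"

lemma decomposesD:
  assumes "decomposes G A B Q"
  shows "u \<in> A \<Longrightarrow> v \<in> A \<Longrightarrow> \<not> adj G u v" "u \<in> B \<Longrightarrow> v \<in> B \<Longrightarrow> u \<noteq> v \<Longrightarrow> adj G u v"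
    "u \<in> A \<Longrightarrow> v \<in> Q \<Longrightarrow> \<not> adj G u v" "u \<in> B \<Longrightarrow> v \<in> Q \<Longrightarrow> adj G u v"
    "u \<in> Q \<Longrightarrow> v \<in> A \<Longrightarrow> \<not> adj G u v" "u \<in> Q \<Longrightarrow> v \<in> B \<Longrightarrow> adj G u v"
  using assms adj_commute[of G u v] by (simp_all add: decomposes_def)

lemma splitted_iff: "splitted G A B \<longleftrightarrow> simple_graph G \<and> decomposes G A B {}"
proof (cases "simple_graph G")
  case True
  have "indep A (edges G) \<longleftrightarrow> (\<forall>u\<in>A. \<forall>v\<in>A. \<not> adj G u v)"
    using adjD(3)[OF True] unfolding indep_def adj_def by metis
  then show ?thesis
    using True by (auto simp: splitted_def decomposes_def clique_def adj_def)
qed (auto simp: splitted_def)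

lemma decomposes_complement:
  "simple_graph G \<Longrightarrow> decomposes G A B Q \<Longrightarrow> decomposes (complement G) B A Q"
  unfolding decomposes_def by auto

lemma decomposes_induced:
  "decomposes G A B Q \<Longrightarrow> S \<subseteq> verts G \<Longrightarrow> decomposes (induced G S) (A \<inter> S) (B \<inter> S) (Q \<inter> S)"
  unfolding decomposes_def by auto

lemma verts_compose [simp]: "verts (compose (T, A, B) K) = verts T \<union> verts K"
  by simp

lemma adj_compose:
  "adj (compose (T, A, B) K) u v \<longleftrightarrow> adj T u v \<or> adj K u v \<or>
     u \<in> B \<and> v \<in> verts K \<or> v \<in> B \<and> u \<in> verts K"
  by (auto simp: adj_def doubleton_eq_iff)

declare compose.simps [simp del]

lemma compose_props:
  assumes T: "splitted T A B" and K: "simple_graph K" and disj: "verts T \<inter> verts K = {}"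
  shows simple_compose: "simple_graph (compose (T, A, B) K)"
    and induced_compose_left: "induced (compose (T, A, B) K) (verts T) = T"
    and induced_compose_right: "induced (compose (T, A, B) K) (verts K) = K"
    and decomposes_compose: "decomposes (compose (T, A, B) K) A B (verts K)"
proof -
  have sT: "simple_graph T" and dT: "decomposes T A B {}" using T by (auto simp: splitted_iff)
  then have V: "verts T = A \<union> B" "A \<inter> B = {}" by (auto simp: decomposes_def)
  show s: "simple_graph (compose (T, A, B) K)"
  proof -
    have "{u, v} \<in> [verts T \<union> verts K]\<^bsup>2\<^esup>" if "u \<in> B" "v \<in> verts K" for u v
      using that V disj by auto
    moreover have "[verts T]\<^bsup>2\<^esup> \<subseteq> [verts T \<union> verts K]\<^bsup>2\<^esup>" "[verts K]\<^bsup>2\<^esup> \<subseteq> [verts T \<union> verts K]\<^bsup>2\<^esup>"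
      by (rule nsets_mono; blast)+
    ultimately show ?thesis
      using sT K unfolding simple_graph_def compose.simps graph.sel by blast
  qed
  show "induced (compose (T, A, B) K) (verts T) = T"
    by (rule graph_eqI)
      (use s sT K disj in \<open>auto intro: simple_induced simp: adj_compose dest: adjD\<close>)
  show "induced (compose (T, A, B) K) (verts K) = K"
    by (rule graph_eqI)
      (use s sT K disj V in \<open>auto intro: simple_induced simp: adj_compose dest: adjD\<close>)
  show "decomposes (compose (T, A, B) K) A B (verts K)"
  proof -
    have no_adj: "\<not> adj T u v" if "v \<in> verts K" for u v
      using adjD(2)[OF sT] disj that by blast
    have no_adj': "\<not> adj K u v" if "u \<in> A \<union> B" for u v
      using adjD(1)[OF K] disj that V by blast
    have "u \<notin> B" "u \<notin> verts K" if "u \<in> A" for u using that disj V by auto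
    moreover have "u \<notin> verts K" if "u \<in> B" for u using that disj V by auto
    moreover have "\<forall>u\<in>A. \<forall>v\<in>A. \<not> adj T u v" "\<forall>u\<in>B. \<forall>v\<in>B. u \<noteq> v \<longrightarrow> adj T u v"
      using dT by (simp_all add: decomposes_def)
    ultimately show ?thesis
      unfolding decomposes_def adj_compose verts_compose V(1) by (auto simp: no_adj no_adj')
  qed
qed

text \<open>
  Whether \<open>G\<close> is decomposable becomes a question about partitions of its vertex set; this makes the
  symmetry under complementation visible, which exchanges \<open>A\<close> and \<open>B\<close>.
\<close>

lemma decomposable_iff:
  assumes G: "simple_graph G"
  shows "decomposable G \<longleftrightarrow> (\<exists>A B Q. decomposes G A B Q \<and> A \<union> B \<noteq> {} \<and> Q \<noteq> {})"
proof
  assume "decomposable G"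
  then show "\<exists>A B Q. decomposes G A B Q \<and> A \<union> B \<noteq> {} \<and> Q \<noteq> {}"
    unfolding decomposable_def using decomposes_compose unfolding splitted_def by metis
next
  assume "\<exists>A B Q. decomposes G A B Q \<and> A \<union> B \<noteq> {} \<and> Q \<noteq> {}"
  then obtain A B Q where d: "decomposes G A B Q" and ne: "A \<union> B \<noteq> {}" "Q \<noteq> {}" by blast
  let ?T = "induced G (A \<union> B)" and ?K = "induced G Q"
  have sub: "A \<union> B \<subseteq> verts G" "Q \<subseteq> verts G" using d by (auto simp: decomposes_def)
  have T: "splitted ?T A B"
    using d simple_induced[OF G sub(1)] by (auto simp: splitted_iff decomposes_def)
  have K: "simple_graph ?K" using simple_induced[OF G sub(2)] .
  have disj: "verts ?T \<inter> verts ?K = {}" using d by (auto simp: decomposes_def)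
  have "G = compose (?T, A, B) ?K"
  proof (rule graph_eqI)
    show "simple_graph (compose (?T, A, B) ?K)" using simple_compose[OF T K disj] .
    fix u v assume "u \<in> verts G" "v \<in> verts G"
    then show "adj G u v \<longleftrightarrow> adj (compose (?T, A, B) ?K) u v"
      using d adj_commute[of G] unfolding adj_compose decomposes_def by auto
  qed (use G d in \<open>auto simp: decomposes_def\<close>)
  then show "decomposable G"
    unfolding decomposable_def using T K disj ne
    by (intro exI[of _ ?T] exI[of _ A] exI[of _ B] exI[of _ ?K]) simp
qed

lemma indecomposable_complement:
  assumes "simple_graph G" "\<not> decomposable G"
  shows "\<not> decomposable (complement G)"
proof
  assume "decomposable (complement G)"
  then obtain A B Q where "decomposes (complement G) A B Q" "A \<union> B \<noteq> {}" "Q \<noteq> {}"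
    using decomposable_iff[OF simple_complement[OF assms(1)]] by blast
  then have "decomposes G B A Q"
    using decomposes_complement[OF simple_complement[OF assms(1)]]
    by (metis complement_complement assms(1))
  then show False
    using assms \<open>A \<union> B \<noteq> {}\<close> \<open>Q \<noteq> {}\<close> decomposable_iff[OF assms(1)] by (metis Un_commute)
qed

lemma split_graph_iff: "simple_graph G \<Longrightarrow> split_graph G \<longleftrightarrow> (\<exists>A B. decomposes G A B {})"
  by (simp add: split_graph_def splitted_iff)

lemma split_graph_complement:
  assumes "simple_graph G" "split_graph G"
  shows "split_graph (complement G)"
proof -
  obtain A B where "decomposes G A B {}" using assms by (auto simp: split_graph_iff)
  from decomposes_complement[OF assms(1) this] show ?thesis
    using simple_complement[OF assms(1)] by (auto simp: split_graph_iff)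
qed


section \<open>Bipartite relations without entangled switches\<close>

text \<open>
  Stars with centres \<open>A\<close> and leaves \<open>B\<close>, where \<open>p\<close> sends a leaf to its centre. In \<open>starlike\<close> the
  four cases are the relations of the top-expanded and of the bottom-expanded spiders of either
  kind.
\<close>

definition stars :: "('a \<Rightarrow> 'b \<Rightarrow> bool) \<Rightarrow> 'a set \<Rightarrow> 'b set \<Rightarrow> bool" where
  "stars R A B \<longleftrightarrow> 2 \<le> card A \<and> (\<exists>p. p ` B = A \<and> (\<forall>a\<in>A. \<forall>b\<in>B. R a b \<longleftrightarrow> p b = a))"

definition starlike :: "('a \<Rightarrow> 'b \<Rightarrow> bool) \<Rightarrow> 'a set \<Rightarrow> 'b set \<Rightarrow> bool" where
  "starlike R A B \<longleftrightarrow> stars R A B \<or> stars (\<lambda>a b. \<not> R a b) A B \<or>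
     stars (\<lambda>b a. R a b) B A \<or> stars (\<lambda>b a. \<not> R a b) B A"

text \<open>
  In a switch, the pairs \<open>(a1, b1)\<close> and \<open>(a2, b2)\<close> of the relation are replaced by \<open>(a1, b2)\<close>
  and \<open>(a2, b1)\<close>. It is entangled if both pairs of like vertices are told apart by some
  third vertex: then, on these six vertices, the exchange yields a relation that is not isomorphic.
\<close>

definition switches_untangled :: "('a \<Rightarrow> 'b \<Rightarrow> bool) \<Rightarrow> 'a set \<Rightarrow> 'b set \<Rightarrow> bool" where
  "switches_untangled R A B \<longleftrightarrow>
     (\<forall>a1\<in>A. \<forall>a2\<in>A. \<forall>a3\<in>A. \<forall>b1\<in>B. \<forall>b2\<in>B. \<forall>b3\<in>B.
        a3 \<noteq> a1 \<and> a3 \<noteq> a2 \<and> b3 \<noteq> b1 \<and> b3 \<noteq> b2 \<and> R a1 b1 \<and> R a2 b2 \<and> \<not> R a1 b2 \<and> \<not> R a2 b1 \<longrightarrow>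
        (R a3 b1 \<longleftrightarrow> R a3 b2) \<or> (R a1 b3 \<longleftrightarrow> R a2 b3))"

text \<open>
  What indecomposability of a split graph with independent side \<open>A\<close> and clique \<open>B\<close> means for
  the relation between the sides: \<open>(A', B')\<close> would be the first factor of a composition, and the rest
  the second one.
\<close>

definition relation_indecomposable :: "('a \<Rightarrow> 'b \<Rightarrow> bool) \<Rightarrow> 'a set \<Rightarrow> 'b set \<Rightarrow> bool" where
  "relation_indecomposable R A B \<longleftrightarrow>
     (\<forall>A' B'. A' \<subseteq> A \<and> B' \<subseteq> B \<and> (\<forall>b\<in>B'. \<forall>a\<in>A - A'. R a b) \<and> (\<forall>a\<in>A'. \<forall>b\<in>B - B'. \<not> R a b) \<longrightarrow>
        A' = {} \<and> B' = {} \<or> A' = A \<and> B' = B)"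

lemma switches_untangledD:
  assumes "switches_untangled R A B" "R a1 b1" "R a2 b2" "\<not> R a1 b2" "\<not> R a2 b1"
    and "a1 \<in> A" "a2 \<in> A" "a3 \<in> A" "b1 \<in> B" "b2 \<in> B" "b3 \<in> B"
    and "a3 \<noteq> a1" "a3 \<noteq> a2" "b3 \<noteq> b1" "b3 \<noteq> b2" "R a3 b1 \<noteq> R a3 b2"
  shows "R a1 b3 \<longleftrightarrow> R a2 b3"
  using assms unfolding switches_untangled_def by blast

lemma relation_indecomposableD:
  assumes "relation_indecomposable R A B" "A' \<subseteq> A" "B' \<subseteq> B"
    and "\<And>a b. b \<in> B' \<Longrightarrow> a \<in> A \<Longrightarrow> a \<notin> A' \<Longrightarrow> R a b"
    and "\<And>a b. a \<in> A' \<Longrightarrow> b \<in> B \<Longrightarrow> b \<notin> B' \<Longrightarrow> \<not> R a b"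
  shows "A' = {} \<and> B' = {} \<or> A' = A \<and> B' = B"
proof -
  have "(\<forall>b\<in>B'. \<forall>a\<in>A - A'. R a b) \<and> (\<forall>a\<in>A'. \<forall>b\<in>B - B'. \<not> R a b)"
    using assms(4,5) by auto
  then show ?thesis
    using assms(1-3) unfolding relation_indecomposable_def by blast
qed

lemma starlike_negate: "starlike (\<lambda>a b. \<not> R a b) A B \<longleftrightarrow> starlike R A B"
  unfolding starlike_def by auto

lemma starlike_transpose: "starlike (\<lambda>b a. R a b) B A \<longleftrightarrow> starlike R A B"
  unfolding starlike_def by auto

lemma switches_untangled_negate:
  assumes "switches_untangled R A B"
  shows "switches_untangled (\<lambda>a b. \<not> R a b) A B"
  unfolding switches_untangled_def
proof (intro ballI impI, elim conjE, rule disjCI)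
  fix a1 a2 a3 b1 b2 b3
  assume "a1 \<in> A" "a2 \<in> A" "a3 \<in> A" "b1 \<in> B" "b2 \<in> B" "b3 \<in> B"
    "a3 \<noteq> a1" "a3 \<noteq> a2" "b3 \<noteq> b1" "b3 \<noteq> b2" "\<not> R a1 b1" "\<not> R a2 b2" "\<not> \<not> R a1 b2" "\<not> \<not> R a2 b1"
    "\<not> ((\<not> R a1 b3) = (\<not> R a2 b3))"
  then show "(\<not> R a3 b1) = (\<not> R a3 b2)"
    using switches_untangledD[OF assms, of a1 b2 a2 b1 a3 b3] by auto
qed

lemma switches_untangled_transpose:
  assumes "switches_untangled R A B"
  shows "switches_untangled (\<lambda>b a. R a b) B A"
  unfolding switches_untangled_def
proof (intro ballI impI, elim conjE, rule disjCI)
  fix a1 a2 a3 b1 b2 b3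
  assume "a1 \<in> A" "a2 \<in> A" "a3 \<in> A" "b1 \<in> B" "b2 \<in> B" "b3 \<in> B"
    "a3 \<noteq> a1" "a3 \<noteq> a2" "b3 \<noteq> b1" "b3 \<noteq> b2" "R a1 b1" "R a2 b2" "\<not> R a2 b1" "\<not> R a1 b2"
    "R a3 b1 \<noteq> R a3 b2"
  then show "R a1 b3 = R a2 b3"
    using switches_untangledD[OF assms, of a1 b1 a2 b2 a3 b3] by auto
qed

lemma relation_indecomposable_negate:
  assumes "relation_indecomposable R A B"
  shows "relation_indecomposable (\<lambda>a b. \<not> R a b) A B"
  unfolding relation_indecomposable_def
proof (intro allI impI; elim conjE)
  fix A' B' assume "A' \<subseteq> A" "B' \<subseteq> B"
    and "\<forall>b\<in>B'. \<forall>a\<in>A - A'. \<not> R a b" "\<forall>a\<in>A'. \<forall>b\<in>B - B'. \<not> \<not> R a b"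
  moreover from this have "A - A' = {} \<and> B - B' = {} \<or> A - A' = A \<and> B - B' = B"
    by (intro relation_indecomposableD[OF assms]) auto
  ultimately show "A' = {} \<and> B' = {} \<or> A' = A \<and> B' = B" by blast
qed

lemma relation_indecomposable_transpose:
  assumes "relation_indecomposable R A B"
  shows "relation_indecomposable (\<lambda>b a. R a b) B A"
  unfolding relation_indecomposable_def
proof (intro allI impI; elim conjE)
  fix A' B' assume "B' \<subseteq> B" "A' \<subseteq> A"
    and "\<forall>b\<in>A'. \<forall>a\<in>B - B'. R b a" "\<forall>a\<in>B'. \<forall>b\<in>A - A'. \<not> R b a"
  moreover from this have "A - A' = {} \<and> B - B' = {} \<or> A - A' = A \<and> B - B' = B"
    by (intro relation_indecomposableD[OF assms]) auto
  ultimately show "B' = {} \<and> A' = {} \<or> B' = B \<and> A' = A" by blast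
qed

lemma starsI:
  assumes "2 \<le> card A" "p ` B = A" "\<And>a b. a \<in> A \<Longrightarrow> b \<in> B \<Longrightarrow> R a b \<longleftrightarrow> p b = a"
  shows "stars R A B"
  using assms unfolding stars_def by blast

lemma image_fun_upd_insert: "b \<notin> Y \<Longrightarrow> (p(b := a)) ` insert b Y = insert a (p ` Y)"
  by auto

text \<open>
  If a vertex on the side of the centres separated two leaves, the absence of entangled switches
  would make all stars single edges and would attach the vertex to exactly one of them. It would thus
  be a further leaf for the reversed orientation.
\<close>

lemma center_side_uniform:
  assumes S: "switches_untangled R A B" and XY: "X \<subseteq> A" "Y \<subseteq> B" "stars R X Y"
    and a: "a \<in> A" "a \<notin> X" and max: "\<not> starlike R (insert a X) Y"
    and b: "b \<in> Y" "R a b" and b': "b' \<in> Y"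
  shows "R a b'"
proof (rule ccontr)
  assume nb': "\<not> R a b'"
  obtain p where card: "2 \<le> card X" and p: "p ` Y = X"
    and R: "\<And>x y. x \<in> X \<Longrightarrow> y \<in> Y \<Longrightarrow> R x y \<longleftrightarrow> p y = x"
    using XY(3) unfolding stars_def by blast
  have pX: "p y \<in> X" if "y \<in> Y" for y using p that by blast
  have single: "y = u \<or> y = v"
    if "u \<in> Y" "v \<in> Y" "y \<in> Y" "R a u" "\<not> R a v" "p u \<noteq> p v" "p y = p u \<or> p y = p v" for u v y
  proof (rule ccontr)
    assume "\<not> (y = u \<or> y = v)"
    then have "R (p u) y \<longleftrightarrow> R (p v) y"
      using that XY a R pX[of u] pX[of v]
      by (intro switches_untangledD[OF S, of "p u" u "p v" v a y]) auto
    then show False using that R pX[of u] pX[of v] by auto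
  qed
  \<comment> \<open>The leaves of one star are seen alike: otherwise one of them could be paired with a leaf
    of another star, and \<open>single\<close> excludes the other one.\<close>
  have same_star: "R a u \<longleftrightarrow> R a v" if uv: "u \<in> Y" "v \<in> Y" "p u = p v" for u v
  proof -
    have False if u: "u \<in> Y" "v \<in> Y" "p u = p v" "R a u" "\<not> R a v" for u v
    proof -
      have "\<not> X \<subseteq> {p u}" using card card_mono[of "{p u}" X] by auto
      then obtain w where w: "w \<in> Y" "p w \<noteq> p u" using p by auto
      show False
      proof (cases "R a w")
        case True
        then show ?thesis using single[of w v u] u w by auto
      next
        case False
        then show ?thesis using single[of u w v] u w by auto
      qed
    qed
    from this[of u v] this[of v u] show ?thesis using uv by metis
  qed
  have pb: "p b \<noteq> p b'" using same_star[of b b'] b b' nb' by auto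
  have inj: "inj_on p Y"
  proof (rule inj_onI, rule ccontr)
    fix u v assume uv: "u \<in> Y" "v \<in> Y" "p u = p v" "u \<noteq> v"
    show False
    proof (cases "R a u")
      case True
      then have "R a v" using same_star uv by blast
      have "p u \<noteq> p b'" using same_star[of u b'] True nb' uv b' by auto
      then show False using single[of u b' v] uv b' True nb' \<open>R a v\<close> by auto
    next
      case False
      then have "\<not> R a v" using same_star uv by blast
      have "p b \<noteq> p u" using same_star[of u b] False uv b by auto
      then show False using single[of b u v] uv b False \<open>\<not> R a v\<close> by auto
    qed
  qed
  show False
  proof (cases "\<exists>b1\<in>Y. R a b1 \<and> b1 \<noteq> b")
    case True
    then obtain b1 where b1: "b1 \<in> Y" "R a b1" "b1 \<noteq> b" by blast
    have "p b1 \<noteq> p b'" using inj b1 b' nb' by (metis inj_onD)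
    have "R a b1 \<longleftrightarrow> R (p b') b1"
      using b b1 b' nb' a XY pX[of b] pX[of b'] pb
      by (intro switches_untangledD[OF S, of a b "p b'" b' "p b" b1]) (auto simp: R)
    then show False using b1 b' R pX[of b'] \<open>p b1 \<noteq> p b'\<close> by auto
  next
    case False
    define q where "q = (\<lambda>x. if x = a then b else inv_into Y p x)"
    have bij: "bij_betw p Y X" using inj p by (simp add: bij_betw_def)
    have "stars (\<lambda>y x. R x y) Y (insert a X)"
    proof (rule starsI[of _ q])
      show "2 \<le> card Y" using card bij_betw_same_card[OF bij] by simp
      have "q ` X = Y"
      proof -
        have "q ` X = inv_into Y p ` X"
          by (rule image_cong) (use a(2) in \<open>auto simp: q_def\<close>)
        then show ?thesis using bij_betw_imp_surj_on[OF bij_betw_inv_into[OF bij]] by simp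
      qed
      moreover have "q a = b" by (simp add: q_def)
      ultimately show "q ` insert a X = Y" by (simp only: image_insert insert_absorb[OF b(1)])
      fix y x assume "y \<in> Y" "x \<in> insert a X"
      then show "R x y \<longleftrightarrow> q x = y"
      proof (cases "x = a")
        case True
        moreover have "R a y \<longleftrightarrow> y = b" using False b \<open>y \<in> Y\<close> by blast
        ultimately show ?thesis by (auto simp: q_def)
      next
        case neq: False
        then have "x \<in> X" using \<open>x \<in> insert a X\<close> by simp
        have "inv_into Y p x = y \<longleftrightarrow> p y = x"
          using inj p \<open>x \<in> X\<close> \<open>y \<in> Y\<close> by (metis f_inv_into_f inv_into_f_f)
        then show ?thesis using R[OF \<open>x \<in> X\<close> \<open>y \<in> Y\<close>] neq by (simp add: q_def)
      qed
    qed
    then show False using max by (simp add: starlike_def)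
  qed
qed

text \<open>
  A vertex on the side of the leaves which sees some centres but not all is one more leaf if it sees
  a single one; if it sees two, it forms an entangled switch with these, with a third centre that it
  does not see, and with their leaves.
\<close>

lemma leaf_side_uniform:
  assumes S: "switches_untangled R A B" and XY: "X \<subseteq> A" "Y \<subseteq> B" "stars R X Y"
    and b: "b \<in> B" "b \<notin> Y" and max: "\<not> starlike R X (insert b Y)"
    and a: "a \<in> X" "R a b" and a': "a' \<in> X"
  shows "R a' b"
proof (rule ccontr)
  assume na': "\<not> R a' b"
  obtain p where card: "2 \<le> card X" and p: "p ` Y = X"
    and R: "\<And>x y. x \<in> X \<Longrightarrow> y \<in> Y \<Longrightarrow> R x y \<longleftrightarrow> p y = x"
    using XY(3) unfolding stars_def by blast
  show False
  proof (cases "\<exists>c\<in>X. R c b \<and> c \<noteq> a")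
    case True
    then obtain c where c: "c \<in> X" "R c b" "c \<noteq> a" by blast
    obtain y y' where y: "y \<in> Y" "p y = a" "y' \<in> Y" "p y' = a'" using p a a' by blast
    have "R a y \<longleftrightarrow> R a' y"
      using a a' na' c y b XY
      by (intro switches_untangledD[OF S, of a b a' y' c y]) (auto simp: R)
    then show False using y a a' na' R by auto
  next
    case False
    have "stars R X (insert b Y)"
    proof (rule starsI[of _ "p(b := a)"])
      show "2 \<le> card X" by fact
      show "(p(b := a)) ` insert b Y = X"
        using a(1) by (simp only: image_fun_upd_insert[OF b(2)] p insert_absorb)
      fix x y assume xy: "x \<in> X" "y \<in> insert b Y"
      show "R x y \<longleftrightarrow> (p(b := a)) y = x"
      proof (cases "y = b")
        case True
        have "R x b \<longleftrightarrow> a = x" using False a(2) xy(1) by blast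
        then show ?thesis using True by simp
      next
        case neq: False
        then show ?thesis using R[of x y] xy by simp
      qed
    qed
    then show False using max by (simp add: starlike_def)
  qed
qed

text \<open>
  By the uniformity of the remaining vertices, a maximal disjoint union of stars is a canonical
  component: two remaining vertices which violate this would yield one more star, or one more
  star of the complementary relation.
\<close>

lemma maximal_stars_exhaust:
  assumes S: "switches_untangled R A B" and I: "relation_indecomposable R A B"
    and XY: "X \<subseteq> A" "Y \<subseteq> B" "stars R X Y"
    and max: "\<And>X' Y'. X \<subseteq> X' \<Longrightarrow> X' \<subseteq> A \<Longrightarrow> Y \<subseteq> Y' \<Longrightarrow> Y' \<subseteq> B \<Longrightarrow> starlike R X' Y' \<Longrightarrow>
      X' = X \<and> Y' = Y"
  shows "X = A \<and> Y = B"
proof -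
  obtain p where card: "2 \<le> card X" and p: "p ` Y = X"
    and R: "\<And>x y. x \<in> X \<Longrightarrow> y \<in> Y \<Longrightarrow> R x y \<longleftrightarrow> p y = x"
    using XY(3) unfolding stars_def by blast
  have pX: "p y \<in> X" if "y \<in> Y" for y using p that by blast
  have leaf: "\<exists>y\<in>Y. p y = x" if "x \<in> X" for x using p that by blast
  have finX: "finite X" using card by (metis card.infinite not_numeral_le_zero)
  have "X \<noteq> {}" using card by auto
  then have "Y \<noteq> {}" using p by auto
  have uniA: "R a y'" if "a \<in> A - X" "y \<in> Y" "R a y" "y' \<in> Y" for a y y'
  proof (rule center_side_uniform[OF S XY, where b = y])
    show "\<not> starlike R (insert a X) Y"
      using max[of "insert a X" Y, OF _ _ order_refl XY(2)] that(1) XY(1) by blast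
  qed (use that in auto)
  have uniB: "R x' b" if "b \<in> B - Y" "x \<in> X" "R x b" "x' \<in> X" for b x x'
  proof (rule leaf_side_uniform[OF S XY, where a = x])
    show "\<not> starlike R X (insert b Y)"
      using max[of X "insert b Y", OF order_refl XY(1)] that(1) XY(2) by blast
  qed (use that in auto)
  define A0 where "A0 = {a \<in> A - X. \<forall>y\<in>Y. \<not> R a y}"
  define B1 where "B1 = {b \<in> B - Y. \<forall>x\<in>X. R x b}"
  have A1: "R a y" if h: "a \<in> A - X" "a \<notin> A0" "y \<in> Y" for a y
  proof -
    obtain y' where "y' \<in> Y" "R a y'" using h(1,2) by (auto simp: A0_def)
    then show ?thesis using uniA[OF h(1) _ _ h(3)] by blast
  qed
  have B0: "\<not> R x b" if h: "b \<in> B - Y" "b \<notin> B1" "x \<in> X" for x b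
  proof -
    obtain x' where "x' \<in> X" "\<not> R x' b" using h(1,2) by (auto simp: B1_def)
    then show ?thesis using uniB[OF h(1,3)] by blast
  qed
  \<comment> \<open>An edge outside of everything would be one more star.\<close>
  have A0B0: "\<not> R a b" if ab: "a \<in> A0" "b \<in> B - Y" "b \<notin> B1" for a b
  proof
    assume "R a b"
    have aX: "a \<in> A" "a \<notin> X" "\<And>y. y \<in> Y \<Longrightarrow> \<not> R a y" using ab by (auto simp: A0_def)
    have "stars R (insert a X) (insert b Y)"
    proof (rule starsI[of _ "p(b := a)"])
      show "2 \<le> card (insert a X)" using card by (simp add: card_insert_if finX)
      show "(p(b := a)) ` insert b Y = insert a X" proof -
        have "b \<notin> Y" using ab(2) by simp
        then show ?thesis by (subst image_fun_upd_insert) (assumption, simp only: p)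
      qed
      fix x y assume xy: "x \<in> insert a X" "y \<in> insert b Y"
      show "R x y \<longleftrightarrow> (p(b := a)) y = x"
      proof (cases "y = b")
        case True
        then show ?thesis using xy(1) \<open>R a b\<close> B0[OF ab(2,3), of x] aX(2) by auto
      next
        case neq: False
        then show ?thesis using xy R[of x y] aX(2) aX(3)[of y] pX[of y] by auto
      qed
    qed
    then show False
      using max[of "insert a X" "insert b Y"] XY ab aX by (auto simp: starlike_def)
  qed
  \<comment> \<open>Dually for a missing edge; two stars are also the complement of two stars, which explains
    the special role of \<open>card X = 2\<close>, where \<open>q\<close> sends a leaf to the centre that it does not see.\<close>
  have A1B1: "R a b" if ab: "a \<in> A - X" "a \<notin> A0" "b \<in> B1" for a b
  proof (rule ccontr)
    assume "\<not> R a b"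
    have bY: "b \<in> B" "b \<notin> Y" "\<And>x. x \<in> X \<Longrightarrow> R x b" using ab by (auto simp: B1_def)
    show False
    proof (cases "card X = 2")
      case True
      then obtain c1 c2 where c: "X = {c1, c2}" "c1 \<noteq> c2" by (auto simp: card_2_iff)
      define q where "q = (\<lambda>y. if y = b then a else if p y = c1 then c2 else c1)"
      have "stars (\<lambda>x y. \<not> R x y) (insert a X) (insert b Y)"
      proof (rule starsI[of _ q])
        show "2 \<le> card (insert a X)" using card by (simp add: card_insert_if finX)
        obtain y1 y2 where "y1 \<in> Y" "y2 \<in> Y" "p y1 = c1" "p y2 = c2"
          using leaf[of c1] leaf[of c2] c(1) by auto
        then have "q y1 = c2" "q y2 = c1" using c bY by (auto simp: q_def)
        moreover have "q b = a" by (simp add: q_def)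
        moreover have "q ` insert b Y \<subseteq> insert a X" using c by (auto simp: q_def)
        ultimately show "q ` insert b Y = insert a X"
          using imageI[of b "insert b Y" q] imageI[of y1 "insert b Y" q] imageI[of y2 "insert b Y" q]
            c \<open>y1 \<in> Y\<close> \<open>y2 \<in> Y\<close> by auto
        fix x y assume xy: "x \<in> insert a X" "y \<in> insert b Y"
        show "(\<not> R x y) \<longleftrightarrow> q y = x"
        proof (cases "x = a \<or> y = b")
          case True
          moreover have "a \<notin> X" "\<And>y. y \<in> Y \<Longrightarrow> R a y" using ab A1[OF ab(1,2)] by auto
          ultimately show ?thesis using xy \<open>\<not> R a b\<close> bY(2,3) c(1) by (auto simp: q_def)
        next
          case False
          then have "x \<in> X" "y \<in> Y" using xy by auto
          then show ?thesis using R[of x y] pX[of y] False c by (auto simp: q_def)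
        qed
      qed
      then show False
        using max[of "insert a X" "insert b Y"] XY ab bY by (auto simp: starlike_def)
    next
      case False
      then have "3 \<le> card X" using card by simp
      then obtain C where "C \<subseteq> X" "card C = 3" using obtain_subset_with_card_n by metis
      then obtain c1 c2 c3 where c: "c1 \<in> X" "c2 \<in> X" "c3 \<in> X" "c1 \<noteq> c2" "c1 \<noteq> c3" "c2 \<noteq> c3"
        by (auto simp: card_3_iff)
      obtain y1 y3 where y: "y1 \<in> Y" "y3 \<in> Y" "p y1 = c1" "p y3 = c3"
        using leaf[OF c(1)] leaf[OF c(3)] by blast
      have "R a y3 \<longleftrightarrow> R c2 y3"
        using c y ab bY XY \<open>\<not> R a b\<close> A1[of a]
        by (intro switches_untangledD[OF S, of a y1 c2 b c3 y3]) (auto simp: R)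
      then show False using A1[of a y3] R[of c2 y3] c y ab by auto
    qed
  qed
  \<comment> \<open>The graph is composed of \<open>(A0, B1)\<close>, \<open>(X, Y)\<close> and the rest, in this order.\<close>
  have "A0 = {} \<and> B1 = {} \<or> A0 = A \<and> B1 = B"
  proof (rule relation_indecomposableD[OF I])
    show "A0 \<subseteq> A" "B1 \<subseteq> B" by (auto simp: A0_def B1_def)
    show "R a b" if "b \<in> B1" "a \<in> A" "a \<notin> A0" for a b
      using A1B1[of a b] that by (auto simp: B1_def)
    show "\<not> R a b" if "a \<in> A0" "b \<in> B" "b \<notin> B1" for a b
      using A0B0[of a b] that by (auto simp: A0_def)
  qed
  then have "A0 = {}" "B1 = {}"
    using \<open>X \<noteq> {}\<close> XY(1) by (auto simp: A0_def)
  then have "X = {} \<and> Y = {} \<or> X = A \<and> Y = B"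
  proof (intro relation_indecomposableD[OF I] XY(1,2))
    show "R a b" if "b \<in> Y" "a \<in> A" "a \<notin> X" for a b
      using A1[of a b] that \<open>A0 = {}\<close> by simp
    show "\<not> R a b" if "a \<in> X" "b \<in> B" "b \<notin> Y" for a b
      using B0[of b a] that \<open>B1 = {}\<close> by simp
  qed
  then show ?thesis using \<open>X \<noteq> {}\<close> by simp
qed

text \<open>
  Without a switch the neighbourhoods form a chain, and then a vertex with the smallest
  neighbourhood can be split off.
\<close>

lemma indecomposable_has_switch:
  assumes fin: "finite A" "finite B" and I: "relation_indecomposable R A B"
    and card: "2 \<le> card A + card B"
  obtains a1 a2 b1 b2 where "a1 \<in> A" "a2 \<in> A" "b1 \<in> B" "b2 \<in> B"
    "R a1 b1" "R a2 b2" "\<not> R a1 b2" "\<not> R a2 b1"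
proof (rule ccontr)
  note switch = that
  assume "\<not> thesis"
  then have chain: "R a2 b1" if "a1 \<in> A" "a2 \<in> A" "b1 \<in> B" "b2 \<in> B" "R a1 b1" "\<not> R a1 b2" "R a2 b2"
    for a1 a2 b1 b2
    using switch[of a1 a2 b1 b2] that by blast
  define N where "N b = {a \<in> A. R a b}" for b
  show False
  proof (cases "B = {}")
    case True
    then have "2 \<le> card A" using card by simp
    then obtain a where "a \<in> A" by fastforce
    then have "{a} = A"
      using relation_indecomposableD[OF I, of "{a}" "{}"] True by auto
    then show False using \<open>2 \<le> card A\<close> by auto
  next
    case False
    define b where "b = arg_min_on (\<lambda>b. card (N b)) B"
    have b: "b \<in> B" and min: "\<And>y. y \<in> B \<Longrightarrow> card (N b) \<le> card (N y)"
      using arg_min_if_finite[OF fin(2) False, of "\<lambda>b. card (N b)"] unfolding b_def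
      by (auto simp: not_less)
    have sub: "N b \<subseteq> N y" if "y \<in> B" for y
    proof (rule ccontr)
      assume "\<not> N b \<subseteq> N y"
      then obtain a where a: "a \<in> A" "R a b" "\<not> R a y" by (auto simp: N_def)
      then have "N y \<subset> N b" using chain[of a _ b y] b that by (auto simp: N_def)
      then have "card (N y) < card (N b)" by (intro psubset_card_mono) (simp_all add: N_def fin)
      then show False using min[OF that] by simp
    qed
    have "A - N b = {} \<and> B - {b} = {} \<or> A - N b = A \<and> B - {b} = B"
    proof (rule relation_indecomposableD[OF I])
      fix x y assume "y \<in> B - {b}" "x \<in> A" "x \<notin> A - N b"
      then show "R x y" using sub[of y] by (auto simp: N_def)
    qed (auto simp: N_def)
    then have AB: "A = N b" "B = {b}" using b by (auto simp: N_def)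
    then have "A \<noteq> {}" using card by auto
    then obtain a where a: "a \<in> A" by blast
    have "A - {a} = {} \<and> B = {} \<or> A - {a} = A \<and> B = B"
      using AB a by (intro relation_indecomposableD[OF I]) (auto simp: N_def)
    then show False using a AB by blast
  qed
qed

text \<open>
  Maximality has to range over all four kinds of stars, since a union of stars may only be extendable
  to one of another kind. Negation and transposition carry each kind to the first one.
\<close>

theorem indecomposable_untangled_starlike:
  assumes fin: "finite A" "finite B" and S: "switches_untangled R A B"
    and I: "relation_indecomposable R A B" and card: "2 \<le> card A + card B"
  shows "starlike R A B"
proof -
  obtain a1 a2 b1 b2 where sw: "a1 \<in> A" "a2 \<in> A" "b1 \<in> B" "b2 \<in> B"
    "R a1 b1" "R a2 b2" "\<not> R a1 b2" "\<not> R a2 b1"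
    using indecomposable_has_switch[OF fin I card] .
  define P where "P = (\<lambda>(X, Y). X \<subseteq> A \<and> Y \<subseteq> B \<and> starlike R X Y)"
  define \<mu> where "\<mu> = (\<lambda>(X :: 'a set, Y :: 'b set). card X + card Y)"
  have "a1 \<noteq> a2" "b1 \<noteq> b2" using sw by auto
  then have "stars R {a1, a2} {b1, b2}"
    using sw by (intro starsI[of _ "\<lambda>b. if b = b1 then a1 else a2"]) auto
  then have "P ({a1, a2}, {b1, b2})" using sw by (auto simp: P_def starlike_def)
  moreover have "\<forall>XY. P XY \<longrightarrow> \<mu> XY < Suc (card A + card B)"
    using fin by (auto simp: P_def \<mu>_def less_Suc_eq_le intro!: add_mono card_mono)
  ultimately obtain XY where "P XY" "\<forall>XY'. P XY' \<longrightarrow> \<mu> XY' \<le> \<mu> XY"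
    using ex_has_greatest_nat[of P _ \<mu>] by blast
  then obtain X Y where P: "P (X, Y)" and top: "\<And>X' Y'. P (X', Y') \<Longrightarrow> \<mu> (X', Y') \<le> \<mu> (X, Y)"
    by (cases XY) auto
  have XY: "X \<subseteq> A" "Y \<subseteq> B" and st: "starlike R X Y" using P by (auto simp: P_def)
  have max: "X' = X \<and> Y' = Y"
    if "X \<subseteq> X'" "X' \<subseteq> A" "Y \<subseteq> Y'" "Y' \<subseteq> B" "starlike R X' Y'" for X' Y'
  proof -
    have "card X' + card Y' \<le> card X + card Y" using top[of X' Y'] that by (simp add: P_def \<mu>_def)
    moreover have f: "finite X'" "finite Y'"
      using finite_subset[OF that(2) fin(1)] finite_subset[OF that(4) fin(2)] .
    moreover have "card X \<le> card X'" "card Y \<le> card Y'" using that f by (auto intro: card_mono)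
    ultimately have "card X = card X'" "card Y = card Y'" by linarith+
    then show ?thesis
      using card_subset_eq[OF f(1) that(1)] card_subset_eq[OF f(2) that(3)] by simp
  qed
  let ?T = "\<lambda>b a. R a b"
  note Sn = switches_untangled_negate and In = relation_indecomposable_negate
  note St = switches_untangled_transpose[OF S] and It = relation_indecomposable_transpose[OF I]
  have "X = A \<and> Y = B"
    using st unfolding starlike_def
  proof (elim disjE)
    assume "stars R X Y"
    then show ?thesis using maximal_stars_exhaust[OF S I XY] max by blast
  next
    assume "stars (\<lambda>a b. \<not> R a b) X Y"
    then show ?thesis
      by (rule maximal_stars_exhaust[OF Sn[OF S] In[OF I] XY]) (use max in \<open>auto simp: starlike_negate\<close>)
  next
    assume "stars ?T Y X"
    then have "Y = B \<and> X = A"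
      by (rule maximal_stars_exhaust[OF St It XY(2,1)])
        (use max starlike_transpose[of R] in metis)
    then show ?thesis by simp
  next
    assume "stars (\<lambda>b a. \<not> R a b) Y X"
    then have "Y = B \<and> X = A"
      by (rule maximal_stars_exhaust[OF Sn[OF St] In[OF It] XY(2,1)])
        (use max starlike_transpose[of R] starlike_negate[of ?T] in metis)
    then show ?thesis by simp
  qed
  then show ?thesis using st by simp
qed


section \<open>Forbidden induced subgraphs\<close>

text \<open>
  All obstructions are recognised by one invariant: whether two vertices of given degrees are
  joined by an edge.
\<close>

definition degree_in :: "'a list \<Rightarrow> ('a \<Rightarrow> 'a \<Rightarrow> bool) \<Rightarrow> 'a \<Rightarrow> nat" where
  "degree_in vs E x = length (filter (E x) vs)"

definition edge_of_degrees :: "'a list \<Rightarrow> ('a \<Rightarrow> 'a \<Rightarrow> bool) \<Rightarrow> nat \<Rightarrow> nat \<Rightarrow> bool" where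
  "edge_of_degrees vs E p q \<longleftrightarrow>
     (\<exists>x\<in>set vs. \<exists>y\<in>set vs. E x y \<and> degree_in vs E x = p \<and> degree_in vs E y = q)"

lemma graph_iso_edge_degrees:
  assumes "G \<simeq> H" "\<exists>x\<in>verts G. \<exists>y\<in>verts G. adj G x y \<and> deg G x = p \<and> deg G y = q"
  shows "\<exists>x\<in>verts H. \<exists>y\<in>verts H. adj H x y \<and> deg H x = p \<and> deg H y = q"
proof -
  obtain f where f: "bij_betw f (verts G) (verts H)"
    and adj: "\<And>u v. u \<in> verts G \<Longrightarrow> v \<in> verts G \<Longrightarrow> adj G u v \<longleftrightarrow> adj H (f u) (f v)"
    using assms(1) unfolding graph_iso_adj by blast
  obtain x y where xy: "x \<in> verts G" "y \<in> verts G" "adj G x y" "deg G x = p" "deg G y = q"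
    using assms(2) by blast
  have "deg H (f x) = deg G x" "deg H (f y) = deg G y"
    using graph_iso_deg[OF f xy(1) adj] graph_iso_deg[OF f xy(2) adj] by blast+
  moreover have "f x \<in> verts H" "f y \<in> verts H" using f xy by (auto dest: bij_betwE)
  moreover have "adj H (f x) (f y)" using adj xy by blast
  ultimately show ?thesis using xy by metis
qed

text \<open>
  \<open>F\<close> is the edge set of a second graph on the listed vertices. If it has the same degrees as the
  induced subgraph, the two are isomorphic and agree in the invariant.
\<close>

lemma edge_degrees_determined:
  assumes G: "hereditary_unigraph G" and vs: "set vs \<subseteq> verts G" "distinct vs"
    and loopless: "\<forall>x\<in>set vs. {x} \<notin> F"
    and same: "\<forall>x\<in>set vs. degree_in vs (\<lambda>x y. {x, y} \<in> F) x = degree_in vs (adj G) x"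
  shows "edge_of_degrees vs (adj G) p q \<longleftrightarrow> edge_of_degrees vs (\<lambda>x y. {x, y} \<in> F) p q"
proof -
  let ?E = "\<lambda>x y. {x, y} \<in> F"
  let ?I = "induced G (set vs)" and ?H = "graph_of (set vs) ?E"
  have adjH: "adj ?H x y \<longleftrightarrow> x \<in> set vs \<and> y \<in> set vs \<and> {x, y} \<in> F" for x y
    using loopless by (subst adj_graph_of) (auto simp: symp_def insert_commute)
  have degI: "deg ?I x = degree_in vs (adj G) x" if "x \<in> set vs" for x
    using that vs(2) by (simp add: deg_induced degree_in_def distinct_length_filter Int_def conj_commute)
  have degH: "deg ?H x = degree_in vs ?E x" if "x \<in> set vs" for x
    using that vs(2)
    by (simp add: deg_def adjH degree_in_def distinct_length_filter Int_def conj_commute)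
  have I: "edge_of_degrees vs (adj G) p q \<longleftrightarrow>
      (\<exists>x\<in>verts ?I. \<exists>y\<in>verts ?I. adj ?I x y \<and> deg ?I x = p \<and> deg ?I y = q)"
    by (auto simp: edge_of_degrees_def degI)
  have H: "edge_of_degrees vs ?E p q \<longleftrightarrow>
      (\<exists>x\<in>verts ?H. \<exists>y\<in>verts ?H. adj ?H x y \<and> deg ?H x = p \<and> deg ?H y = q)"
    by (auto simp: edge_of_degrees_def degH adjH)
  have "unigraph ?I" using G vs(1) by (simp add: hereditary_unigraph_def)
  then have "?H \<simeq> ?I"
    using same degI degH simple_graph_of[of "set vs" ?E]
    unfolding unigraph_iff_same_degrees by simp
  then show ?thesis
    using graph_iso_edge_degrees[of ?H ?I p q] graph_iso_edge_degrees[of ?I ?H p q]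
      graph_iso_sym[of ?H ?I] unfolding I H by blast
qed

lemma edge_degrees_obstruction:
  assumes G: "hereditary_unigraph G" and vs: "set vs \<subseteq> verts G" "distinct vs"
    and loopless: "\<forall>x\<in>set vs. {x} \<notin> F"
    and degG: "map (degree_in vs (adj G)) vs = ds"
    and degF: "map (degree_in vs (\<lambda>x y. {x, y} \<in> F)) vs = ds"
    and differ: "(\<exists>(x, i)\<in>set (zip vs ds). i = p \<and> (\<exists>(y, j)\<in>set (zip vs ds). j = q \<and> adj G x y)) \<noteq>
      (\<exists>(x, i)\<in>set (zip vs ds). i = p \<and> (\<exists>(y, j)\<in>set (zip vs ds). j = q \<and> {x, y} \<in> F))"
  shows False
proof -
  have table: "edge_of_degrees vs E p q \<longleftrightarrow>
      (\<exists>(x, i)\<in>set (zip vs ds). i = p \<and> (\<exists>(y, j)\<in>set (zip vs ds). j = q \<and> E x y))"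
    if "map (degree_in vs E) vs = ds" for E
  proof -
    have "zip vs (map g vs) = map (\<lambda>x. (x, g x)) vs" for g :: "'a \<Rightarrow> nat"
      by (induction vs) auto
    then show ?thesis unfolding that[symmetric] edge_of_degrees_def by auto
  qed
  have "\<forall>x\<in>set vs. degree_in vs (\<lambda>x y. {x, y} \<in> F) x = degree_in vs (adj G) x"
    using degG degF by (metis map_eq_conv)
  from edge_degrees_determined[OF G vs loopless this, of p q] show False
    using differ table[OF degG] table[OF degF] by simp
qed

lemmas small_graph_simps = degree_in_def doubleton_eq_iff adj_commute

text \<open>
  Each of the forbidden graphs below is ruled out by a second graph with the same degrees, whose edges
  are \<open>F\<close>. The pairs are \<open>P\<^sub>5\<close> and \<open>K\<^sub>2 + K\<^sub>3\<close>; \<open>C\<^sub>4\<close> with a pendant vertex and its complement, a triangle with a tail;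
  \<open>K\<^sub>2 + P\<^sub>4\<close> and \<open>2P\<^sub>3\<close>; and \<open>K\<^sub>2 + C\<^sub>4\<close> and \<open>P\<^sub>6\<close>. Only one of each pair joins two vertices of degree
  1, or one of degree 1 to one of degree 3. The complements are forbidden as well, since the
  complement of a hereditary unigraph is a hereditary unigraph.
\<close>

context
  fixes G :: "'a graph"
  assumes G: "hereditary_unigraph G"
begin

lemma no_loop [simp]: "\<not> adj G x x"
  using adjD(3)[OF hereditary_unigraph_simple[OF G]] by blast

lemma no_P5:
  assumes "set [a, b, c, d, e] \<subseteq> verts G" "distinct [a, b, c, d, e]"
    and "adj G a b" "adj G b c" "adj G c d" "adj G d e"
    and "\<not> adj G a c" "\<not> adj G a d" "\<not> adj G a e" "\<not> adj G b d" "\<not> adj G b e" "\<not> adj G c e"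
  shows False
proof -
  have dist: "distinct [e, d, c, b, a]" using assms(2) by auto
  show False
    by (rule edge_degrees_obstruction[OF G assms(1,2), where p = 1 and q = 1 and ds = "[1, 2, 2, 2, 1]"
        and F = "{{a, e}, {b, c}, {c, d}, {b, d}}"])
      (use assms(2-) dist in \<open>simp_all add: small_graph_simps\<close>)
qed

lemma no_K2_K3:
  assumes "set [a, b, c, d, e] \<subseteq> verts G" "distinct [a, b, c, d, e]"
    and "adj G a b" "adj G c d" "adj G c e" "adj G d e"
    and "\<not> adj G a c" "\<not> adj G a d" "\<not> adj G a e" "\<not> adj G b c" "\<not> adj G b d" "\<not> adj G b e"
  shows False
proof -
  have dist: "distinct [e, d, c, b, a]" using assms(2) by auto
  show False
    by (rule edge_degrees_obstruction[OF G assms(1,2), where p = 1 and q = 1 and ds = "[1, 1, 2, 2, 2]"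
        and F = "{{a, c}, {c, d}, {d, e}, {e, b}}"])
      (use assms(2-) dist in \<open>simp_all add: small_graph_simps\<close>)
qed

lemma no_C4_pendant:
  assumes "set [a, b, c, d, e] \<subseteq> verts G" "distinct [a, b, c, d, e]"
    and "adj G a b" "adj G b c" "adj G c d" "adj G a d" "adj G a e"
    and "\<not> adj G a c" "\<not> adj G b d" "\<not> adj G b e" "\<not> adj G c e" "\<not> adj G d e"
  shows False
proof -
  have dist: "distinct [e, d, c, b, a]" using assms(2) by auto
  show False
    by (rule edge_degrees_obstruction[OF G assms(1,2), where p = 1 and q = 3 and ds = "[3, 2, 2, 2, 1]"
        and F = "{{a, b}, {a, c}, {a, d}, {b, d}, {c, e}}"])
      (use assms(2-) dist in \<open>simp_all add: small_graph_simps\<close>)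
qed

lemma no_triangle_tail:
  assumes "set [a, b, c, d, e] \<subseteq> verts G" "distinct [a, b, c, d, e]"
    and "adj G a b" "adj G a c" "adj G b c" "adj G c d" "adj G d e"
    and "\<not> adj G a d" "\<not> adj G a e" "\<not> adj G b d" "\<not> adj G b e" "\<not> adj G c e"
  shows False
proof -
  have dist: "distinct [e, d, c, b, a]" using assms(2) by auto
  show False
    by (rule edge_degrees_obstruction[OF G assms(1,2), where p = 1 and q = 3 and ds = "[2, 2, 3, 2, 1]"
        and F = "{{a, c}, {a, d}, {b, d}, {b, c}, {c, e}}"])
      (use assms(2-) dist in \<open>simp_all add: small_graph_simps\<close>)
qed

lemma no_K2_P4:
  assumes "set [a, b, c, d, e, f] \<subseteq> verts G" "distinct [a, b, c, d, e, f]"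
    and "adj G a b" "adj G c d" "adj G d e" "adj G e f"
    and "\<not> adj G a c" "\<not> adj G a d" "\<not> adj G a e" "\<not> adj G a f"
    and "\<not> adj G b c" "\<not> adj G b d" "\<not> adj G b e" "\<not> adj G b f"
    and "\<not> adj G c e" "\<not> adj G c f" "\<not> adj G d f"
  shows False
proof -
  have dist: "distinct [f, e, d, c, b, a]" using assms(2) by auto
  show False
    by (rule edge_degrees_obstruction[OF G assms(1,2), where p = 1 and q = 1 and ds = "[1, 1, 1, 2, 2, 1]"
        and F = "{{a, d}, {c, d}, {b, e}, {e, f}}"])
      (use assms(2-) dist in \<open>simp_all add: small_graph_simps\<close>)
qed

lemma no_P3_P3:
  assumes "set [a, b, c, d, e, f] \<subseteq> verts G" "distinct [a, b, c, d, e, f]"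
    and "adj G a b" "adj G b c" "adj G d e" "adj G e f"
    and "\<not> adj G a c" "\<not> adj G d f"
    and "\<not> adj G a d" "\<not> adj G a e" "\<not> adj G a f" "\<not> adj G b d" "\<not> adj G b e" "\<not> adj G b f"
    and "\<not> adj G c d" "\<not> adj G c e" "\<not> adj G c f"
  shows False
proof -
  have dist: "distinct [f, e, d, c, b, a]" using assms(2) by auto
  show False
    by (rule edge_degrees_obstruction[OF G assms(1,2), where p = 1 and q = 1 and ds = "[1, 2, 1, 1, 2, 1]"
        and F = "{{a, d}, {b, c}, {b, e}, {e, f}}"])
      (use assms(2-) dist in \<open>simp_all add: small_graph_simps\<close>)
qed

lemma no_K2_C4:
  assumes "set [a, b, c, d, e, f] \<subseteq> verts G" "distinct [a, b, c, d, e, f]"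
    and "adj G a b" "adj G c d" "adj G d e" "adj G e f" "adj G c f"
    and "\<not> adj G a c" "\<not> adj G a d" "\<not> adj G a e" "\<not> adj G a f"
    and "\<not> adj G b c" "\<not> adj G b d" "\<not> adj G b e" "\<not> adj G b f"
    and "\<not> adj G c e" "\<not> adj G d f"
  shows False
proof -
  have dist: "distinct [f, e, d, c, b, a]" using assms(2) by auto
  show False
    by (rule edge_degrees_obstruction[OF G assms(1,2), where p = 1 and q = 1 and ds = "[1, 1, 2, 2, 2, 2]"
        and F = "{{a, c}, {c, f}, {e, f}, {d, e}, {b, d}}"])
      (use assms(2-) dist in \<open>simp_all add: small_graph_simps\<close>)
qed

text \<open>
  The four entangled switches, up to the naming of the vertices, depending on whether \<open>c\<close>
  and \<open>f\<close> are adjacent and on the end of the switch to which \<open>f\<close> is attached.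
\<close>

lemma no_entangled_switch:
  assumes "set [a, b, c, d, e, f] \<subseteq> verts G" "distinct [a, b, c, d, e, f]"
    and "\<not> adj G a b" "\<not> adj G a c" "\<not> adj G b c" "adj G d e" "adj G d f" "adj G e f"
    and "adj G a d" "adj G b e" "\<not> adj G a e" "\<not> adj G b d"
    and "adj G c d" "\<not> adj G c e" "adj G a f \<noteq> adj G b f"
  shows False
proof -
  have dist: "distinct [f, e, d, c, b, a]" using assms(2) by auto
  have "adj G a f \<and> \<not> adj G b f \<or> \<not> adj G a f \<and> adj G b f" using assms by blast
  then show False
  proof (elim disjE conjE)
    assume f: "adj G a f" "\<not> adj G b f"
    show False
    proof (cases "adj G c f")
      case True
      show False
        by (rule edge_degrees_obstruction[OF G assms(1,2), where p = 1 and q = 3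
            and ds = "[2, 1, 2, 4, 3, 4]"
            and F = "{{d, e}, {d, f}, {e, f}, {a, e}, {b, d}, {c, d}, {a, f}, {c, f}}"])
          (use assms(2-14) dist f True in \<open>simp_all add: small_graph_simps\<close>)
    next
      case False
      show False
        by (rule edge_degrees_obstruction[OF G assms(1,2), where p = 1 and q = 3
            and ds = "[2, 1, 1, 4, 3, 3]"
            and F = "{{d, e}, {d, f}, {e, f}, {a, e}, {b, d}, {c, d}, {a, f}}"])
          (use assms(2-14) dist f False in \<open>simp_all add: small_graph_simps\<close>)
    qed
  next
    assume f: "\<not> adj G a f" "adj G b f"
    show False
    proof (cases "adj G c f")
      case True
      show False
        by (rule edge_degrees_obstruction[OF G assms(1,2), where p = 1 and q = 3
            and ds = "[1, 2, 2, 4, 3, 4]"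
            and F = "{{d, e}, {d, f}, {e, f}, {a, e}, {b, d}, {c, d}, {b, f}, {c, f}}"])
          (use assms(2-14) dist f True in \<open>simp_all add: small_graph_simps\<close>)
    next
      case False
      show False
        by (rule edge_degrees_obstruction[OF G assms(1,2), where p = 1 and q = 3
            and ds = "[1, 2, 1, 4, 3, 3]"
            and F = "{{d, e}, {d, f}, {e, f}, {a, e}, {b, d}, {c, d}, {b, f}}"])
          (use assms(2-14) dist f False in \<open>simp_all add: small_graph_simps\<close>)
    qed
  qed
qed

lemma splitting_switches_untangled:
  assumes "splitted G A B"
  shows "switches_untangled (adj G) A B"
  unfolding switches_untangled_def
proof (intro ballI impI, elim conjE, rule ccontr)
  fix a1 a2 a3 b1 b2 b3
  assume v: "a1 \<in> A" "a2 \<in> A" "a3 \<in> A" "b1 \<in> B" "b2 \<in> B" "b3 \<in> B"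
    and ne: "a3 \<noteq> a1" "a3 \<noteq> a2" "b3 \<noteq> b1" "b3 \<noteq> b2"
    and sw: "adj G a1 b1" "adj G a2 b2" "\<not> adj G a1 b2" "\<not> adj G a2 b1"
    and "\<not> (adj G a3 b1 = adj G a3 b2 \<or> adj G a1 b3 = adj G a2 b3)"
  then have c: "adj G a3 b1 \<noteq> adj G a3 b2" and f: "adj G a1 b3 \<noteq> adj G a2 b3" by auto
  have dec: "verts G = A \<union> B" "A \<inter> B = {}" "\<And>u v. u \<in> A \<Longrightarrow> v \<in> A \<Longrightarrow> \<not> adj G u v"
    "\<And>u v. u \<in> B \<Longrightarrow> v \<in> B \<Longrightarrow> u \<noteq> v \<Longrightarrow> adj G u v"
    using assms by (auto simp: splitted_iff decomposes_def)
  have "a1 \<noteq> a2" "b1 \<noteq> b2" using sw by auto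
  moreover have "x \<noteq> y" if "x \<in> A" "y \<in> B" for x y using that dec(2) by blast
  ultimately have dist: "distinct [a1, a2, a3, b1, b2, b3]" "distinct [a2, a1, a3, b2, b1, b3]"
    using v ne by auto
  have sub: "set [a1, a2, a3, b1, b2, b3] \<subseteq> verts G" "set [a2, a1, a3, b2, b1, b3] \<subseteq> verts G"
    using v dec(1) by auto
  show False
  proof (cases "adj G a3 b1")
    case True
    show False
      by (rule no_entangled_switch[OF sub(1) dist(1)]) (use v sw c f True dec(3,4) dist in simp_all)
  next
    case False
    show False
      by (rule no_entangled_switch[OF sub(2) dist(2)]) (use v sw c f False dec(3,4) dist in simp_all)
  qed
qed

end

lemma splitting_relation_indecomposable:
  assumes s: "splitted G A B" and indec: "\<not> decomposable G"
  shows "relation_indecomposable (adj G) A B"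
  unfolding relation_indecomposable_def
proof (intro allI impI; elim conjE)
  fix A' B'
  assume sub: "A' \<subseteq> A" "B' \<subseteq> B" and adj: "\<forall>b\<in>B'. \<forall>a\<in>A - A'. adj G a b"
    and nadj: "\<forall>a\<in>A'. \<forall>b\<in>B - B'. \<not> adj G a b"
  have G: "simple_graph G" and V: "verts G = A \<union> B" "A \<inter> B = {}"
    and ind: "\<And>u v. u \<in> A \<Longrightarrow> v \<in> A \<Longrightarrow> \<not> adj G u v"
    and clique: "\<And>u v. u \<in> B \<Longrightarrow> v \<in> B \<Longrightarrow> u \<noteq> v \<Longrightarrow> adj G u v"
    using s by (auto simp: splitted_iff decomposes_def)
  have "decomposes G A' B' ((A - A') \<union> (B - B'))"
    unfolding decomposes_def
  proof (intro conjI ballI impI)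
    fix u v assume "u \<in> B'" "v \<in> (A - A') \<union> (B - B')"
    then show "adj G u v"
      using adj sub clique[of u v] adj_commute[of G u v] by blast
  next
    fix u v assume "u \<in> A'" "v \<in> (A - A') \<union> (B - B')"
    then show "\<not> adj G u v" using nadj sub ind[of u v] by blast
  next
    show "\<not> adj G u v" if "u \<in> A'" "v \<in> A'" for u v using that sub ind by blast
    show "adj G u v" if "u \<in> B'" "v \<in> B'" "u \<noteq> v" for u v using that sub clique by blast
  qed (use V sub in blast)+
  then have "A' \<union> B' = {} \<or> (A - A') \<union> (B - B') = {}"
    using indec decomposable_iff[OF G] by blast
  then show "A' = {} \<and> B' = {} \<or> A' = A \<and> B' = B" using sub by blast
qed

lemma indecomposable_split_starlike:
  assumes "hereditary_unigraph G" "\<not> decomposable G" "splitted G A B" "1 < card (verts G)"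
  shows "starlike (adj G) A B"
proof (rule indecomposable_untangled_starlike)
  have "verts G = A \<union> B" "A \<inter> B = {}" using assms(3) by (auto simp: splitted_iff decomposes_def)
  moreover from this show "finite A" "finite B"
    using simple_graph_finite[OF hereditary_unigraph_simple[OF assms(1)]] by auto
  ultimately show "2 \<le> card A + card B" using assms(4) by (simp add: card_Un_disjoint)
qed (use assms splitting_switches_untangled splitting_relation_indecomposable in auto)


section \<open>Particular graphs up to isomorphism\<close>

lemma adj_copies_K2:
  "adj (copies n (complete_graph 2)) (i, a) (j, b) \<longleftrightarrow> i < n \<and> j = i \<and> a < 2 \<and> b < 2 \<and> a \<noteq> b"
proof -
  have "adj (copies n (complete_graph 2)) (i, a) (j, b) \<longleftrightarrow>
      (\<exists>k e. {(i, a), (j, b)} = Pair k ` e \<and> k < n \<and> e \<in> [{..<2::nat}]\<^bsup>2\<^esup>)"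
    by (simp add: adj_def copies_def complete_graph_def)
  also have "\<dots> \<longleftrightarrow> i < n \<and> j = i \<and> {a, b} \<in> [{..<2::nat}]\<^bsup>2\<^esup>"
  proof
    assume "\<exists>k e. {(i, a), (j, b)} = Pair k ` e \<and> k < n \<and> e \<in> [{..<2::nat}]\<^bsup>2\<^esup>"
    then obtain k e where e: "{(i, a), (j, b)} = Pair k ` e" "k < n" "e \<in> [{..<2::nat}]\<^bsup>2\<^esup>" by blast
    have "fst ` {(i, a), (j, b)} \<subseteq> {k}" "snd ` {(i, a), (j, b)} = e"
      unfolding e(1) by (auto simp: image_image)
    then show "i < n \<and> j = i \<and> {a, b} \<in> [{..<2::nat}]\<^bsup>2\<^esup>" using e(2,3) by auto
  next
    assume "i < n \<and> j = i \<and> {a, b} \<in> [{..<2::nat}]\<^bsup>2\<^esup>"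
    then show "\<exists>k e. {(i, a), (j, b)} = Pair k ` e \<and> k < n \<and> e \<in> [{..<2::nat}]\<^bsup>2\<^esup>"
      by (intro exI[of _ i] exI[of _ "{a, b}"] conjI) auto
  qed
  finally show ?thesis unfolding doubleton_in_nsets_2 lessThan_iff by blast
qed

lemma verts_copies_K2: "verts (copies n (complete_graph 2)) = {..<n} \<times> {..<2}"
  by (simp add: copies_def complete_graph_def)

lemma adj_disjoint_union:
  "adj (disjoint_union G H) (Inl u) (Inl v) \<longleftrightarrow> adj G u v"
  "adj (disjoint_union G H) (Inr x) (Inr y) \<longleftrightarrow> adj H x y"
  "\<not> adj (disjoint_union G H) (Inl u) (Inr y)" "\<not> adj (disjoint_union G H) (Inr x) (Inl v)"
proof -
  have E: "adj (disjoint_union G H) p q \<longleftrightarrow>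
      (\<exists>e\<in>edges G. {p, q} = Inl ` e) \<or> (\<exists>e\<in>edges H. {p, q} = Inr ` e)" for p q
    by (simp add: adj_def disjoint_union_def image_iff)
  have l: "{Inl u, Inl v} = Inl ` e \<longleftrightarrow> {u, v} = e" for e
    using inj_image_eq_iff[OF inj_Inl, of "{u, v}" e] by simp
  have r: "{Inr x, Inr y} = Inr ` e \<longleftrightarrow> {x, y} = e" for e
    using inj_image_eq_iff[OF inj_Inr, of "{x, y}" e] by simp
  have nl: "{Inl w, q} \<noteq> Inr ` e" "{q, Inl w} \<noteq> Inr ` e" for w q e
    by (metis Inl_Inr_False imageE insertI1, metis Inl_Inr_False imageE insertCI)
  have nr: "{Inr w, q} \<noteq> Inl ` e" "{q, Inr w} \<noteq> Inl ` e" for w q e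
    by (metis Inr_Inl_False imageE insertI1, metis Inr_Inl_False imageE insertCI)
  show "adj (disjoint_union G H) (Inl u) (Inl v) \<longleftrightarrow> adj G u v"
    unfolding E l by (simp add: nl adj_def)
  show "adj (disjoint_union G H) (Inr x) (Inr y) \<longleftrightarrow> adj H x y"
    unfolding E r by (simp add: nr adj_def)
  show "\<not> adj (disjoint_union G H) (Inl u) (Inr y)" "\<not> adj (disjoint_union G H) (Inr x) (Inl v)"
    by (simp_all add: E nl nr)
qed

lemma verts_disjoint_union: "verts (disjoint_union G H) = verts G <+> verts H"
  by (simp add: disjoint_union_def)

lemma adj_complete_bipartite:
  "adj (complete_bipartite m n) (Inl i) (Inr j) \<longleftrightarrow> i < m \<and> j < n"
  "adj (complete_bipartite m n) (Inr j) (Inl i) \<longleftrightarrow> i < m \<and> j < n"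
  "\<not> adj (complete_bipartite m n) (Inl i) (Inl i')" "\<not> adj (complete_bipartite m n) (Inr j) (Inr j')"
  by (auto simp: adj_def complete_bipartite_def doubleton_eq_iff)

lemma verts_complete_bipartite: "verts (complete_bipartite m n) = {..<m} <+> {..<n}"
  by (simp add: complete_bipartite_def)

lemma adj_cycle_graph:
  "adj (cycle_graph n) i j \<longleftrightarrow> i < n \<and> j = (i + 1) mod n \<or> j < n \<and> i = (j + 1) mod n"
  by (auto simp: adj_def cycle_graph_def doubleton_eq_iff)

lemma verts_cycle_graph: "verts (cycle_graph n) = {..<n}"
  by (simp add: cycle_graph_def)

text \<open>
  An isomorphism to a graph on fixed vertices also serves to compare two graphs whose vertex sets
  have nothing to do with each other; the number of copies is read off from the number of vertices.
\<close>

lemma perfect_matching_iso: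
  assumes "simple_graph G" "\<And>v. v \<in> verts G \<Longrightarrow> \<exists>!u. adj G v u"
  shows "\<exists>n. G \<simeq> copies n (complete_graph 2) \<and> card (verts G) = 2 * n"
  using assms
proof (induction "card (verts G)" arbitrary: G rule: less_induct)
  case less
  note G = less.prems(1) and fin = simple_graph_finite[OF less.prems(1)]
  show ?case
  proof (cases "verts G = {}")
    case True
    then have "G \<simeq> copies 0 (complete_graph 2)"
      unfolding graph_iso_adj verts_copies_K2 by (auto simp: bij_betw_def)
    then show ?thesis using True by auto
  next
    case False
    then obtain v where v: "v \<in> verts G" by blast
    then obtain u where vu: "adj G v u" "\<And>w. adj G v w \<Longrightarrow> w = u" using less.prems(2) by metis
    then have u: "u \<in> verts G" "u \<noteq> v" using adjD[OF G] by blast+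
    then have uv: "adj G u v" "\<And>w. adj G u w \<Longrightarrow> w = v"
      using less.prems(2)[of u] vu(1) adj_commute[of G u v] by blast+
    let ?W = "verts G - {u, v}"
    let ?H = "induced G ?W"
    have H: "simple_graph ?H" by (rule simple_induced[OF G]) simp
    have two: "card (verts G) = card ?W + 2"
      using u v fin card_Diff_subset[of "{u, v}" "verts G"] card_mono[of "verts G" "{u, v}"] by simp
    have "\<exists>!x. adj ?H w x" if "w \<in> verts ?H" for w
    proof -
      have w: "w \<in> verts G" "w \<noteq> u" "w \<noteq> v" using that by auto
      then obtain x where x: "adj G w x" "\<And>y. adj G w y \<Longrightarrow> y = x" using less.prems(2) by metis
      then have "x \<in> verts G" using adjD[OF G] by blast
      moreover have "x \<noteq> u" "x \<noteq> v"
        using x(1) adj_commute[of G w] vu(2) uv(2) w by blast+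
      ultimately have "adj ?H w x" using x(1) w by simp
      then show ?thesis by (rule ex1I[of _ x]) (simp add: x(2))
    qed
    note matched = this
    have "\<exists>n. ?H \<simeq> copies n (complete_graph 2) \<and> card (verts ?H) = 2 * n"
      by (rule less.hyps[OF _ H matched]) (use two in simp_all)
    then obtain n where iso: "?H \<simeq> copies n (complete_graph 2)" and card: "card ?W = 2 * n" by auto
    obtain f where f: "bij_betw f ?W ({..<n} \<times> {..<2})" and
      adj': "\<forall>x\<in>?W. \<forall>y\<in>?W. adj ?H x y \<longleftrightarrow> adj (copies n (complete_graph 2)) (f x) (f y)"
      using iso unfolding graph_iso_adj verts_copies_K2 verts_induced by blast
    have adj: "adj G x y \<longleftrightarrow> adj (copies n (complete_graph 2)) (f x) (f y)"
      if "x \<in> ?W" "y \<in> ?W" for x y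
      using adj'[THEN bspec, OF that(1), THEN bspec, OF that(2)] that by simp
    define g where "g = (\<lambda>x. if x = u then (n, 0) else if x = v then (n, 1) else f x)"
    have g: "bij_betw g (verts G) ({..<Suc n} \<times> {..<2})"
    proof -
      have "bij_betw g ?W ({..<n} \<times> {..<2})"
        by (rule bij_betw_cong[THEN iffD1, OF _ f]) (simp add: g_def)
      moreover have "bij_betw g {u, v} ({n} \<times> {..<2})"
      proof -
        have "{n} \<times> {..<2} = {(n, 0), (n, 1::nat)}" by auto
        then show ?thesis using u by (simp add: bij_betw_def g_def insert_commute)
      qed
      ultimately have "bij_betw g (?W \<union> {u, v}) ({..<n} \<times> {..<2} \<union> {n} \<times> {..<2})"
        by (rule bij_betw_combine) auto
      moreover have "?W \<union> {u, v} = verts G" using u v by auto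
      moreover have "{..<n} \<times> {..<2} \<union> {n} \<times> {..<2} = {..<Suc n} \<times> {..<2::nat}" by auto
      ultimately show ?thesis by simp
    qed
    have "adj G x y \<longleftrightarrow> adj (copies (Suc n) (complete_graph 2)) (g x) (g y)"
      if xy: "x \<in> verts G" "y \<in> verts G" for x y
    proof (cases "x \<in> {u, v} \<or> y \<in> {u, v}")
      case True
      have out: "fst (g w) \<noteq> n" if "w \<in> verts G" "w \<noteq> u" "w \<noteq> v" for w
      proof -
        have "f w \<in> {..<n} \<times> {..<2}" using that bij_betwE[OF f] by blast
        then show ?thesis using that by (cases "f w") (simp add: g_def)
      qed
      have "adj G x y \<longleftrightarrow> x = u \<and> y = v \<or> x = v \<and> y = u"
        using True vu uv adj_commute[of G x y] by blast
      moreover have "adj (copies (Suc n) (complete_graph 2)) (g x) (g y) \<longleftrightarrow>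
          x = u \<and> y = v \<or> x = v \<and> y = u"
        using True u out[OF xy(1)] out[OF xy(2)]
        by (cases "g x"; cases "g y") (auto simp: adj_copies_K2 g_def split: if_splits)
      ultimately show ?thesis by simp
    next
      case False
      then have "x \<in> ?W" "y \<in> ?W" using xy by auto
      moreover from this have "f x \<in> {..<n} \<times> {..<2}" using bij_betwE[OF f] by blast
      ultimately show ?thesis
        using adj[of x y] False by (cases "f x"; cases "f y") (auto simp: adj_copies_K2 g_def)
    qed
    then have "G \<simeq> copies (Suc n) (complete_graph 2)"
      unfolding graph_iso_adj verts_copies_K2 using g by blast
    then show ?thesis using card two by (intro exI[of _ "Suc n"]) simp
  qed
qed

text \<open>
  The neighbours of \<open>c\<close> see only \<open>c\<close>, so that the remaining vertices are matched among themselves.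
\<close>

lemma star_and_matching_iso:
  assumes G: "simple_graph G" and c: "c \<in> verts G"
    and matched: "\<And>v. v \<in> verts G \<Longrightarrow> v \<noteq> c \<Longrightarrow> \<exists>!u. adj G v u"
  shows "\<exists>s. G \<simeq> disjoint_union (complete_bipartite 1 (deg G c)) (copies s (complete_graph 2)) \<and>
    card (verts G) = 1 + deg G c + 2 * s"
proof -
  note fin = simple_graph_finite[OF G]
  define N where "N = {u \<in> verts G. adj G c u}"
  define M where "M = verts G - {c} - N"
  have N: "finite N" "card N = deg G c" using fin by (auto simp: N_def deg_def)
  have cN: "c \<notin> N" using adjD(3)[OF G] by (auto simp: N_def)
  have leaf: "u = c" if "v \<in> N" "adj G v u" for u v
  proof -
    have "adj G c v" using that by (simp add: N_def)
    then have "v \<in> verts G" "v \<noteq> c" "adj G v c"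
      using adjD[OF G] adj_commute[of G c v] by blast+
    then show ?thesis using matched that(2) by blast
  qed
  have MN: "\<not> adj G v u" if "v \<in> M" "u \<in> N" for u v
    using leaf[of u v] that adj_commute[of G u v] by (auto simp: M_def)
  have Mc: "\<not> adj G v c" if "v \<in> M" for v
    using that adj_commute[of G v c] by (auto simp: M_def N_def)
  have I: "simple_graph (induced G M)" by (rule simple_induced[OF G]) (auto simp: M_def)
  have "\<exists>!u. adj (induced G M) v u" if "v \<in> verts (induced G M)" for v
  proof -
    have v: "v \<in> M" using that by simp
    then obtain u where u: "adj G v u" "\<And>w. adj G v w \<Longrightarrow> w = u"
      using matched[of v] by (auto simp: M_def)
    have "u \<notin> N" using MN[OF v, of u] u(1) by blast
    moreover have "u \<noteq> c" using Mc[OF v] u(1) by blast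
    ultimately have "u \<in> M" using adjD(2)[OF G u(1)] by (simp add: M_def)
    then have "adj (induced G M) v u" using u(1) v by simp
    then show ?thesis by (rule ex1I[of _ u]) (simp add: u(2))
  qed
  from perfect_matching_iso[OF I this] obtain s
    where iso: "induced G M \<simeq> copies s (complete_graph 2)" and card: "card M = 2 * s" by auto
  obtain g where g: "bij_betw g M ({..<s} \<times> {..<2})" and adj':
    "\<forall>x\<in>M. \<forall>y\<in>M. adj (induced G M) x y \<longleftrightarrow> adj (copies s (complete_graph 2)) (g x) (g y)"
    using iso unfolding graph_iso_adj verts_copies_K2 verts_induced by blast
  have adj: "adj G x y \<longleftrightarrow> adj (copies s (complete_graph 2)) (g x) (g y)"
    if "x \<in> M" "y \<in> M" for x y
    using adj'[THEN bspec, OF that(1), THEN bspec, OF that(2)] that by simp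
  obtain h where h: "bij_betw h N {..<deg G c}"
    using ex_bij_betw_finite_nat[OF N(1)] by (auto simp: N(2) atLeast0LessThan)
  define f where "f = (\<lambda>v. if v = c then Inl (Inl (0::nat)) else if v \<in> N then Inl (Inr (h v)) else Inr (g v))"
  let ?H = "disjoint_union (complete_bipartite 1 (deg G c)) (copies s (complete_graph 2))"
  have V: "verts G = insert c (N \<union> M)" using c by (auto simp: M_def N_def)
  have MNc: "N \<inter> M = {}" "c \<notin> M" by (auto simp: M_def)
  have "bij_betw f (verts G) (verts ?H)"
  proof -
    have "bij_betw f {c} {Inl (Inl 0)}" by (simp add: f_def bij_betw_def)
    moreover have "bij_betw f N ((\<lambda>i. Inl (Inr i)) ` {..<deg G c})"
    proof (rule bij_betw_cong[THEN iffD1])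
      show "bij_betw ((\<lambda>i. Inl (Inr i)) \<circ> h) N ((\<lambda>i. Inl (Inr i)) ` {..<deg G c})"
        by (rule bij_betw_trans[OF h]) (auto simp: bij_betw_def inj_on_def)
    qed (use cN in \<open>auto simp: f_def\<close>)
    ultimately have "bij_betw f ({c} \<union> N) ({Inl (Inl 0)} \<union> (\<lambda>i. Inl (Inr i)) ` {..<deg G c})"
      by (rule bij_betw_combine) auto
    moreover have "bij_betw f M (Inr ` ({..<s} \<times> {..<2}))"
    proof (rule bij_betw_cong[THEN iffD1])
      show "bij_betw (Inr \<circ> g) M (Inr ` ({..<s} \<times> {..<2}))"
        by (rule bij_betw_trans[OF g]) (auto simp: bij_betw_def)
    qed (use MNc in \<open>auto simp: f_def\<close>)
    ultimately have "bij_betw f ({c} \<union> N \<union> M)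
        ({Inl (Inl 0)} \<union> (\<lambda>i. Inl (Inr i)) ` {..<deg G c} \<union> Inr ` ({..<s} \<times> {..<2}))"
      by (rule bij_betw_combine) auto
    moreover have "{c} \<union> N \<union> M = verts G" using V by auto
    moreover have "{Inl (Inl 0)} \<union> (\<lambda>i. Inl (Inr i)) ` {..<deg G c} \<union> Inr ` ({..<s} \<times> {..<2}) = verts ?H"
      by (auto simp: verts_disjoint_union verts_complete_bipartite verts_copies_K2 Plus_def)
    ultimately show ?thesis by simp
  qed
  moreover have "adj G x y \<longleftrightarrow> adj ?H (f x) (f y)" if xy: "x \<in> verts G" "y \<in> verts G" for x y
  proof -
    have hN: "h v < deg G c" if "v \<in> N" for v using bij_betwE[OF h] that by auto
    have NN: "\<not> adj G u v" if "u \<in> N" "v \<in> N" for u v using leaf[of u v] that cN by blast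
    have NM: "\<not> adj G u v" if "u \<in> N" "v \<in> M" for u v using MN[OF that(2,1)] adj_commute[of G u v] by blast
    have cM: "\<not> adj G c v" if "v \<in> M" for v using Mc[OF that] adj_commute[of G c v] by blast
    have Nc: "adj G v c" "adj G c v" if "v \<in> N" for v
      using that adj_commute[of G c v] unfolding N_def by blast+
    have "\<not> adj G c c" using adjD(3)[OF G] by blast
    moreover have "x = c \<or> x \<in> N \<or> x \<in> M" "y = c \<or> y \<in> N \<or> y \<in> M" using xy V by auto
    moreover have "v \<noteq> c" if "v \<in> N" for v using that cN by blast
    moreover have "v \<noteq> c" "v \<notin> N" if "v \<in> M" for v using that MNc by auto
    ultimately show ?thesis
      by (elim disjE)
        (simp_all add: f_def adj_disjoint_union adj_complete_bipartite hN NN NM MN cM Mc Nc adj)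
  qed
  ultimately have "G \<simeq> ?H" unfolding graph_iso_adj by blast
  moreover have "card (verts G) = 1 + deg G c + 2 * s"
  proof -
    have "finite M" using fin by (simp add: M_def)
    then show ?thesis unfolding V using N card MNc cN by (simp add: card_Un_disjoint)
  qed
  ultimately show ?thesis by blast
qed


definition induces_C5 :: "'a graph \<Rightarrow> 'a \<Rightarrow> 'a \<Rightarrow> 'a \<Rightarrow> 'a \<Rightarrow> 'a \<Rightarrow> bool" where
  "induces_C5 G a b c d e \<longleftrightarrow> {a, b, c, d, e} \<subseteq> verts G \<and> distinct [a, b, c, d, e] \<and>
     adj G a b \<and> adj G b c \<and> adj G c d \<and> adj G d e \<and> adj G a e \<and>
     \<not> adj G a c \<and> \<not> adj G a d \<and> \<not> adj G b d \<and> \<not> adj G b e \<and> \<not> adj G c e"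

lemma induces_C5_rotate: "induces_C5 G a b c d e \<Longrightarrow> induces_C5 G b c d e a"
  unfolding induces_C5_def
  using adj_commute[of G e a] adj_commute[of G b a] adj_commute[of G c a] adj_commute[of G d a] by simp blast

lemma induces_C5_complement: "induces_C5 G a b c d e \<Longrightarrow> induces_C5 (complement G) a c e b d"
  unfolding induces_C5_def
  using adj_commute[of G e b] adj_commute[of G c b] adj_commute[of G e d] by simp blast

lemma induces_C5_iso:
  assumes G: "simple_graph G" and C: "induces_C5 G a b c d e" and V: "verts G = {a, b, c, d, e}"
  shows "G \<simeq> cycle_graph 5"
proof -
  define f :: "'a \<Rightarrow> nat" where
    "f x = (if x = a then 0 else if x = b then 1 else if x = c then 2 else if x = d then 3 else 4)" for x
  have dist: "distinct [a, b, c, d, e]" "distinct [e, d, c, b, a]" using C by (auto simp: induces_C5_def)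
  then have f: "f a = 0" "f b = 1" "f c = 2" "f d = 3" "f e = 4" by (simp_all add: f_def)
  have "{..<5::nat} = {0, 1, 2, 3, 4}" by auto
  then have "bij_betw f (verts G) (verts (cycle_graph 5))"
    using f dist by (simp add: V verts_cycle_graph bij_betw_def)
  moreover have "\<forall>x\<in>verts G. \<forall>y\<in>verts G. adj G x y \<longleftrightarrow> adj (cycle_graph 5) (f x) (f y)"
  proof -
    have "\<not> adj G x x" for x using adjD(3)[OF G] by blast
    moreover have "adj G a b" "adj G b c" "adj G c d" "adj G d e" "adj G a e"
      "\<not> adj G a c" "\<not> adj G a d" "\<not> adj G b d" "\<not> adj G b e" "\<not> adj G c e"
      using C by (simp_all add: induces_C5_def)
    moreover from this have "adj G b a" "adj G c b" "adj G d c" "adj G e d" "adj G e a"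
      "\<not> adj G c a" "\<not> adj G d a" "\<not> adj G d b" "\<not> adj G e b" "\<not> adj G e c"
      by (simp_all add: adj_commute)
    ultimately show ?thesis by (simp add: V f adj_cycle_graph)
  qed
  ultimately show ?thesis unfolding graph_iso_adj by blast
qed


section \<open>Hereditary unigraphs that are indecomposable and not split\<close>

definition induces_2K2 :: "'a graph \<Rightarrow> 'a \<Rightarrow> 'a \<Rightarrow> 'a \<Rightarrow> 'a \<Rightarrow> bool" where
  "induces_2K2 G a b c d \<longleftrightarrow> {a, b, c, d} \<subseteq> verts G \<and> distinct [a, b, c, d] \<and>
     adj G a b \<and> adj G c d \<and> \<not> adj G a c \<and> \<not> adj G a d \<and> \<not> adj G b c \<and> \<not> adj G b d"

text \<open>
  The theorem of Foldes and Hammer; \<open>C\<^sub>4\<close> appears as the complement of \<open>2K\<^sub>2\<close>. A maximum clique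
  with the largest sum of degrees leaves an independent set: if \<open>xy\<close> is an edge outside of it,
  suitably oriented, then \<open>y\<close> has a single non-neighbour \<open>z\<close> in the clique. Replacing \<open>z\<close> by \<open>y\<close>
  cannot increase the sum, which gives a neighbour of \<open>z\<close> that is not one of \<open>y\<close>, and this vertex
  completes one of the three graphs.
\<close>

lemma nonsplit_obstruction:
  assumes G: "simple_graph G" and nonsplit: "\<not> split_graph G"
  shows "(\<exists>a b c d. induces_2K2 G a b c d) \<or> (\<exists>a b c d. induces_2K2 (complement G) a b c d) \<or>
    (\<exists>a b c d e. induces_C5 G a b c d e)"
proof (rule ccontr)
  assume contra: "\<not> ?thesis"
  note irrefl = adjD(3)[OF G] and fin = simple_graph_finite[OF G]
  have no2K2: False
    if "{a, b, c, d} \<subseteq> verts G" "distinct [a, b, c, d]" "adj G a b" "adj G c d"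
      "\<not> adj G a c" "\<not> adj G a d" "\<not> adj G b c" "\<not> adj G b d" for a b c d
    using contra that unfolding induces_2K2_def by blast
  have noC4: False
    if "{a, b, c, d} \<subseteq> verts G" "distinct [a, c, b, d]" "adj G a b" "adj G b c" "adj G c d" "adj G d a"
      "\<not> adj G a c" "\<not> adj G b d" for a b c d
  proof -
    have "induces_2K2 (complement G) a c b d"
      using that adj_commute[of G d a] adj_commute[of G c b] unfolding induces_2K2_def by auto
    then show False using contra by blast
  qed
  define cl where "cl K \<longleftrightarrow> K \<subseteq> verts G \<and> (\<forall>u\<in>K. \<forall>v\<in>K. u \<noteq> v \<longrightarrow> adj G u v)" for K
  have "\<exists>K. cl K \<and> (\<forall>L. cl L \<longrightarrow> card L \<le> card K)"
    using fin by (intro ex_has_greatest_nat[of cl "{}" _ "Suc (card (verts G))"])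
      (auto simp: cl_def less_Suc_eq_le card_mono)
  then obtain K0 where K0: "cl K0" "\<And>L. cl L \<Longrightarrow> card L \<le> card K0" by blast
  have sum_le: "sum (deg G) L < Suc (sum (deg G) (verts G))" if "cl L" for L
    using that fin by (auto simp: cl_def less_Suc_eq_le intro: sum_mono2)
  have "\<exists>K. (cl K \<and> card K = card K0) \<and>
      (\<forall>L. cl L \<and> card L = card K0 \<longrightarrow> sum (deg G) L \<le> sum (deg G) K)"
    by (rule ex_has_greatest_nat[of _ K0]) (use K0 sum_le in auto)
  then obtain K where "cl K" "card K = card K0"
    and top: "\<And>L. cl L \<Longrightarrow> card L = card K0 \<Longrightarrow> sum (deg G) L \<le> sum (deg G) K" by blast
  then have K: "K \<subseteq> verts G" "\<And>u v. u \<in> K \<Longrightarrow> v \<in> K \<Longrightarrow> u \<noteq> v \<Longrightarrow> adj G u v"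
    by (auto simp: cl_def)
  have finK: "finite K" using K(1) fin by (rule finite_subset)
  have "\<exists>x\<in>verts G - K. \<exists>y\<in>verts G - K. adj G x y"
  proof (rule ccontr)
    assume "\<not> ?thesis"
    then have "decomposes G (verts G - K) K {}"
      using K unfolding decomposes_def by (intro conjI) blast+
    then show False using nonsplit split_graph_iff[OF G] by blast
  qed
  then obtain x0 y0 where xy0: "x0 \<in> verts G - K" "y0 \<in> verts G - K" "adj G x0 y0" by blast
  have nonnbr: "\<exists>u\<in>K. \<not> adj G v u" if v: "v \<in> verts G - K" for v
  proof (rule ccontr)
    assume "\<not> ?thesis"
    then have vK: "adj G v u \<and> adj G u v" if "u \<in> K" for u
      using that adj_commute[of G v u] by blast
    then have "cl (insert v K)" using K v unfolding cl_def by blast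
    then show False
      using K0(2)[of "insert v K"] \<open>card K = card K0\<close> v finK by (simp add: card_insert_if)
  qed
  \<comment> \<open>Without an induced \<open>C\<^sub>4\<close> the non-neighbours in the clique of two adjacent vertices are nested.\<close>
  have "\<exists>x y. x \<in> verts G - K \<and> y \<in> verts G - K \<and> adj G x y \<and> (\<forall>u\<in>K. \<not> adj G y u \<longrightarrow> \<not> adj G x u)"
  proof (rule ccontr)
    assume "\<not> ?thesis"
    then obtain u v where uv: "u \<in> K" "v \<in> K" "\<not> adj G y0 u" "adj G x0 u" "\<not> adj G x0 v" "adj G y0 v"
      using xy0 adj_commute[of G x0 y0] by blast
    then have vu: "adj G v u" and ux: "adj G u x0"
      using K(2)[of v u] adj_commute[of G u x0] by blast+
    have "distinct [x0, v, y0, u]" using irrefl[OF xy0(3)] irrefl[OF vu] uv xy0 by auto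
    moreover have "{x0, y0, v, u} \<subseteq> verts G" using uv xy0 K(1) by auto
    ultimately show False using noC4[OF _ _ xy0(3) uv(6) vu ux uv(5,3)] by blast
  qed
  then obtain x y where x: "x \<in> verts G" "x \<notin> K" and y: "y \<in> verts G" "y \<notin> K" and xy: "adj G x y"
    and nested: "\<And>u. u \<in> K \<Longrightarrow> \<not> adj G y u \<Longrightarrow> \<not> adj G x u" by blast
  have "x \<noteq> y" using irrefl xy by blast
  obtain z where z: "z \<in> K" "\<not> adj G y z" using nonnbr y by blast
  have xz: "\<not> adj G x z" using nested z by blast
  have yw: "adj G y w" if w: "w \<in> K" "w \<noteq> z" for w
  proof (rule ccontr)
    assume yw: "\<not> adj G y w"
    have "distinct [x, y, z, w]" using w z x y \<open>x \<noteq> y\<close> by auto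
    moreover have "{x, y, z, w} \<subseteq> verts G" using w z x y K(1) by auto
    ultimately show False
      using no2K2[OF _ _ xy K(2)[OF z(1) w(1)] xz nested[OF w(1) yw] z(2) yw] w(2) by blast
  qed
  have "\<exists>w\<in>K. w \<noteq> z \<and> \<not> adj G x w"
  proof (rule ccontr)
    assume no: "\<not> ?thesis"
    let ?L = "insert x (insert y (K - {z}))"
    have "cl ?L"
      unfolding cl_def
    proof (intro conjI ballI impI)
      show "?L \<subseteq> verts G" using K x y by auto
      fix u v assume "u \<in> ?L" "v \<in> ?L" "u \<noteq> v"
      then show "adj G u v"
        using no yw K(2)[of u v] xy adj_commute[of G u v] by blast
    qed
    moreover have "card ?L = Suc (card K)"
      using x y z finK \<open>x \<noteq> y\<close> card_Suc_Diff1[of K z] by (simp add: card_insert_if)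
    ultimately show False using K0(2)[of ?L] \<open>card K = card K0\<close> by simp
  qed
  then obtain w where w: "w \<in> K" "w \<noteq> z" "\<not> adj G x w" by blast
  have "deg G y \<le> deg G z"
  proof -
    let ?L = "insert y (K - {z})"
    have "cl ?L"
      unfolding cl_def
    proof (intro conjI ballI impI)
      show "?L \<subseteq> verts G" using K y by auto
      fix u v assume "u \<in> ?L" "v \<in> ?L" "u \<noteq> v"
      then show "adj G u v" using yw K(2)[of u v] adj_commute[of G u v] by blast
    qed
    moreover have "card ?L = card K" using y z finK card_Suc_Diff1[of K z] by (simp add: card_insert_if)
    ultimately have "sum (deg G) ?L \<le> sum (deg G) K" using top[of ?L] \<open>card K = card K0\<close> by simp
    moreover have "sum (deg G) ?L = deg G y + sum (deg G) (K - {z})" using y finK by simp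
    moreover have "sum (deg G) K = deg G z + sum (deg G) (K - {z})" using sum.remove[OF finK z(1)] .
    ultimately show ?thesis by simp
  qed
  have "\<exists>t\<in>verts G. adj G z t \<and> \<not> adj G y t"
  proof (rule ccontr)
    assume no: "\<not> ?thesis"
    have "{u \<in> verts G. adj G z u} \<subset> {u \<in> verts G. adj G y u}"
      using no x xy xz adj_commute[of G x y] adj_commute[of G x z] by blast
    then have "deg G z < deg G y" using fin unfolding deg_def by (intro psubset_card_mono) auto
    then show False using \<open>deg G y \<le> deg G z\<close> by simp
  qed
  then obtain t where t: "t \<in> verts G" "adj G z t" "\<not> adj G y t" by blast
  have "t \<noteq> z" using irrefl[OF t(2)] by blast
  moreover from this have "t \<notin> K" using yw[of t] t(3) by blast
  moreover have "t \<noteq> y" "t \<noteq> x"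
    using t(2) z(2) xz adj_commute[of G z y] adj_commute[of G z x] by blast+
  ultimately have ne: "t \<noteq> y" "t \<noteq> x" "t \<noteq> z" "t \<notin> K" by blast+
  have zV: "z \<in> verts G" "w \<in> verts G" using z w K by auto
  have diff: "x \<noteq> z" "y \<noteq> z" "x \<noteq> w" "y \<noteq> w" "t \<noteq> w" using x y z w ne by auto
  have xt: "adj G x t"
  proof (rule ccontr)
    assume nxt: "\<not> adj G x t"
    have "distinct [x, y, t, z]" "{x, y, t, z} \<subseteq> verts G" "adj G t z"
      using x y t zV ne diff \<open>x \<noteq> y\<close> adj_commute[of G t z] by auto
    then show False using no2K2[OF _ _ xy _ nxt xz t(3) z(2)] by blast
  qed
  have yw': "adj G y w" and zw: "adj G z w" using yw w K(2) z by auto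
  show False
  proof (cases "adj G t w")
    case True
    have "distinct [w, x, y, t]" "{w, y, x, t} \<subseteq> verts G" using x y t(1) zV ne diff \<open>x \<noteq> y\<close> by auto
    moreover have "adj G w y" "adj G y x" "\<not> adj G w x"
      using yw' xy w(3) adj_commute[of G w y] adj_commute[of G y x] adj_commute[of G w x] by blast+
    ultimately show False using noC4[OF _ _ _ _ xt True _ t(3)] by blast
  next
    case False
    have "induces_C5 G z t x y w"
      unfolding induces_C5_def
      using False w(2,3) zw yw' xy xt x(1) y(1) z(2) t xz ne zV diff \<open>x \<noteq> y\<close>
        adj_commute[of G z x] adj_commute[of G z y] adj_commute[of G t x] adj_commute[of G t y] by auto
    then show False using contra by blast
  qed
qed


subsection \<open>Around an induced five-cycle\<close>

text \<open>
  A vertex with a neighbour on the cycle, but not all of them, is attached to some \<open>a\<close> and not to the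
  next vertex \<open>b\<close>. In \<open>G\<close> or in its complement, where \<open>a, c, e, b, d\<close> is the cycle, it then forms a
  \<open>P\<^sub>5\<close> or a \<open>C\<^sub>4\<close> with a pendant vertex.
\<close>

lemma C5_vertex_attached_next:
  assumes G: "hereditary_unigraph G" and C: "induces_C5 G a b c d e"
    and v: "v \<in> verts G" "v \<notin> {a, b, c, d, e}" and va: "adj G v a"
  shows "adj G v b"
proof (rule ccontr)
  assume vb: "\<not> adj G v b"
  have path: False
    if "hereditary_unigraph H" "induces_C5 H p q r s t" "v \<in> verts H" "v \<notin> {p, q, r, s, t}"
      "adj H v p" "\<not> adj H v q" "\<not> adj H v r" "\<not> adj H v s" for H p q r s t
    by (rule no_P5[OF that(1), of v p q r s]) (use that(2-) in \<open>auto simp: induces_C5_def\<close>)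
  have pendant: False
    if "hereditary_unigraph H" "induces_C5 H p q r s t" "v \<in> verts H" "v \<notin> {p, q, r, s, t}"
      "adj H v p" "\<not> adj H v q" "adj H v r" "\<not> adj H v s" for H p q r s t
    by (rule no_C4_pendant[OF that(1), of r q p v s])
      (use that(2-) adj_commute[of H r q] adj_commute[of H q p] adj_commute[of H p v]
        adj_commute[of H r v] adj_commute[of H r p] adj_commute[of H q v] in
        \<open>auto simp: induces_C5_def\<close>)
  note co = hereditary_unigraph_complement[OF G]
  have Cb: "induces_C5 (complement G) b d a c e" and Cc: "induces_C5 (complement G) c e b d a"
    and Cd: "induces_C5 G d e a b c"
    using C induces_C5_complement induces_C5_rotate by metis+
  have coV: "v \<in> verts (complement G)" using v by simp
  have V: "a \<in> verts G" "b \<in> verts G" "c \<in> verts G" "d \<in> verts G" "e \<in> verts G"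
    using C by (auto simp: induces_C5_def)
  have ne: "v \<noteq> a" "v \<noteq> b" "v \<noteq> c" "v \<noteq> d" "v \<noteq> e" using v by auto
  have vd: "adj G v d"
  proof (rule ccontr)
    assume "\<not> adj G v d"
    then show False using path[OF G C v va vb] pendant[OF G C v va vb] by blast
  qed
  show False
  proof (cases "adj G v c")
    case True
    show False
      by (rule path[OF co Cb coV]) (use v V ne va vb vd True in auto)
  next
    case nc: False
    show False
    proof (cases "adj G v e")
      case True
      show False
        by (rule pendant[OF co Cc coV]) (use v V ne va vb vd nc True in auto)
    next
      case False
      show False
        by (rule pendant[OF G Cd v(1)]) (use v va vb vd nc False in auto)
    qed
  qed
qed

lemma indecomposable_C5:
  assumes G: "hereditary_unigraph G" and ind: "\<not> decomposable G" and C: "induces_C5 G a b c d e"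
  shows "verts G = {a, b, c, d, e}"
proof -
  note s = hereditary_unigraph_simple[OF G]
  let ?C = "{a, b, c, d, e}"
  have uniform: "adj G v y" if v: "v \<in> verts G" "v \<notin> ?C" and x: "x \<in> ?C" "adj G v x" and y: "y \<in> ?C" for v x y
  proof -
    have 1: "induces_C5 G b c d e a" using induces_C5_rotate[OF C] .
    have 2: "induces_C5 G c d e a b" using induces_C5_rotate[OF 1] .
    have 3: "induces_C5 G d e a b c" using induces_C5_rotate[OF 2] .
    have 4: "induces_C5 G e a b c d" using induces_C5_rotate[OF 3] .
    have "adj G v a \<Longrightarrow> adj G v b" by (rule C5_vertex_attached_next[OF G C]) (use v in auto)
    moreover have "adj G v b \<Longrightarrow> adj G v c" by (rule C5_vertex_attached_next[OF G 1]) (use v in auto)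
    moreover have "adj G v c \<Longrightarrow> adj G v d" by (rule C5_vertex_attached_next[OF G 2]) (use v in auto)
    moreover have "adj G v d \<Longrightarrow> adj G v e" by (rule C5_vertex_attached_next[OF G 3]) (use v in auto)
    moreover have "adj G v e \<Longrightarrow> adj G v a" by (rule C5_vertex_attached_next[OF G 4]) (use v in auto)
    ultimately show ?thesis using x y by blast
  qed
  have V: "?C \<subseteq> verts G" and C': "distinct [a, b, c, d, e]" "adj G a b" "adj G b c" "adj G c d"
    "\<not> adj G a c" "\<not> adj G a d" "\<not> adj G b d"
    using C by (simp_all add: induces_C5_def)
  have away: "\<not> adj H u v"
    if H: "hereditary_unigraph H" "induces_C5 H p q r t w" "{u, v} \<subseteq> verts H - {p, q, r, t, w}"
      "\<And>x. x \<in> {p, q, r, t, w} \<Longrightarrow> \<not> adj H u x" "\<And>x. x \<in> {p, q, r, t, w} \<Longrightarrow> \<not> adj H v x"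
    for H p q r t w u v
  proof
    assume uv: "adj H u v"
    then have "u \<noteq> v" using adjD(3)[OF hereditary_unigraph_simple[OF H(1)]] by blast
    then show False
      by (intro no_K2_P4[OF H(1), of u v p q r t])
        (use H(2,3) H(4)[of p] H(4)[of q] H(4)[of r] H(4)[of t] H(5)[of p] H(5)[of q] H(5)[of r] H(5)[of t] uv
          in \<open>auto simp: induces_C5_def\<close>)
  qed
  define V0 where "V0 = {v \<in> verts G - ?C. \<forall>x\<in>?C. \<not> adj G v x}"
  define V1 where "V1 = {v \<in> verts G - ?C. \<forall>x\<in>?C. adj G v x}"
  have "decomposes G V0 V1 ?C"
    unfolding decomposes_def
  proof (intro conjI ballI impI)
    show "verts G = V0 \<union> V1 \<union> ?C"
    proof (rule set_eqI)
      fix v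
      show "v \<in> verts G \<longleftrightarrow> v \<in> V0 \<union> V1 \<union> ?C"
        using uniform[of v] V unfolding V0_def V1_def by blast
    qed
    show "\<not> adj G u v" if "u \<in> V0" "v \<in> V0" for u v
      by (rule away[OF G C]) (use that in \<open>auto simp: V0_def\<close>)
    show "adj G u v" if "u \<in> V1" "v \<in> V1" "u \<noteq> v" for u v
    proof -
      have "\<not> adj (complement G) u v"
        by (rule away[OF hereditary_unigraph_complement[OF G] induces_C5_complement[OF C]])
          (use that in \<open>auto simp: V1_def\<close>)
      then show ?thesis using that by (simp add: V1_def)
    qed
    show "V0 \<inter> V1 = {}" unfolding V0_def V1_def by blast
  qed (auto simp: V0_def V1_def)
  moreover have "?C \<noteq> {}" by simp
  ultimately have "V0 \<union> V1 = {}" using ind decomposable_iff[OF s] by blast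
  then show ?thesis using \<open>decomposes G V0 V1 ?C\<close> by (simp add: decomposes_def)
qed


subsection \<open>Around two independent edges\<close>

lemma induces_2K2_swap:
  "induces_2K2 G a b c d \<Longrightarrow> induces_2K2 G c d a b"
  "induces_2K2 G a b c d \<Longrightarrow> induces_2K2 G b a c d"
  unfolding induces_2K2_def
  using adj_commute[of G a b] adj_commute[of G c a] adj_commute[of G c b]
    adj_commute[of G d a] adj_commute[of G d b] by simp_all blast+

text \<open>
  Apart from the traces \<open>0, 0\<close> and \<open>2, 2\<close> and \<open>1, 0\<close>, a vertex completes \<open>2K\<^sub>2\<close> to \<open>K\<^sub>2 + K\<^sub>3\<close> (trace
  \<open>2, 0\<close>), to a triangle with a tail (\<open>2, 1\<close>) or to \<open>P\<^sub>5\<close> (\<open>1, 1\<close>).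
\<close>

lemma trace_on_2K2:
  assumes G: "hereditary_unigraph G" and E: "induces_2K2 G x y z w"
    and v: "v \<in> verts G" "v \<notin> {x, y, z, w}" and vx: "adj G v x"
  shows "(if adj G v y then adj G v z \<and> adj G v w else \<not> adj G v z \<and> \<not> adj G v w)"
proof (rule ccontr)
  assume no: "\<not> ?thesis"
  have E': "x \<in> verts G" "y \<in> verts G" "z \<in> verts G" "w \<in> verts G" "distinct [x, y, z, w]"
    "adj G x y" "adj G z w" "\<not> adj G x z" "\<not> adj G x w" "\<not> adj G y z" "\<not> adj G y w"
    using E by (simp_all add: induces_2K2_def)
  have sym: "adj G x v" "adj G y x" "adj G w z" "\<not> adj G z x" "\<not> adj G w x" "\<not> adj G z y" "\<not> adj G w y"
    "adj G y v \<longleftrightarrow> adj G v y" "adj G z v \<longleftrightarrow> adj G v z" "adj G w v \<longleftrightarrow> adj G v w"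
    using E'(6-) vx adj_commute[of G] by blast+
  have dist: "v \<noteq> x" "v \<noteq> y" "v \<noteq> z" "v \<noteq> w" "x \<noteq> v" "y \<noteq> v" "z \<noteq> v" "w \<noteq> v" "distinct [w, z, y, x]"
    using v(2) E'(5) by auto
  show False
  proof (cases "adj G v y")
    case True
    consider "\<not> adj G v z" "\<not> adj G v w" | "adj G v z" "\<not> adj G v w" | "\<not> adj G v z" "adj G v w"
      using no True by auto
    then show False
    proof cases
      case 1
      then show False
        by (intro no_K2_K3[OF G, of z w v x y]) (use v(1) True vx E' sym dist in simp_all)
    next
      case 2
      then show False
        by (intro no_triangle_tail[OF G, of x y v z w]) (use v(1) True vx E' sym dist in simp_all)
    next
      case 3
      then show False
        by (intro no_triangle_tail[OF G, of x y v w z]) (use v(1) True vx E' sym dist in simp_all)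
    qed
  next
    case False
    consider "adj G v z" "adj G v w" | "adj G v z" "\<not> adj G v w" | "\<not> adj G v z" "adj G v w"
      using no False by auto
    then show False
    proof cases
      case 1
      then show False
        by (intro no_triangle_tail[OF G, of z w v x y]) (use v(1) False vx E' sym dist in simp_all)
    next
      case 2
      then show False
        by (intro no_P5[OF G, of y x v z w]) (use v(1) False vx E' sym dist in simp_all)
    next
      case 3
      then show False
        by (intro no_P5[OF G, of y x v w z]) (use v(1) False vx E' sym dist in simp_all)
    qed
  qed
qed

text \<open>\<open>S\<close> induces \<open>K\<^bsub>1,r\<^esub> + sK\<^sub>2\<close> with \<open>r, s \<ge> 1\<close>, where \<open>c\<close> is the centre of the star.\<close>

definition star_with_matching :: "'a graph \<Rightarrow> 'a set \<Rightarrow> 'a \<Rightarrow> bool" where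
  "star_with_matching G S c \<longleftrightarrow> S \<subseteq> verts G \<and> c \<in> S \<and>
     (\<forall>x\<in>S. x \<noteq> c \<longrightarrow> (\<exists>!u. u \<in> S \<and> adj G x u)) \<and>
     (\<exists>u\<in>S. adj G c u) \<and> (\<exists>u\<in>S. u \<noteq> c \<and> \<not> adj G c u)"

lemma star_with_matching_leaf:
  assumes "star_with_matching G S c" "l \<in> S" "adj G c l" "l \<noteq> c" "u \<in> S" "adj G l u"
  shows "u = c"
proof -
  have "\<exists>!u. u \<in> S \<and> adj G l u" "c \<in> S" using assms by (auto simp: star_with_matching_def)
  then show ?thesis using assms adj_commute[of G l c] by blast
qed

lemma star_with_matching_partner:
  assumes G: "simple_graph G" and S: "star_with_matching G S c"
    and x: "x \<in> S" "x \<noteq> c" "\<not> adj G c x"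
  obtains m where "m \<in> S" "m \<noteq> c" "m \<noteq> x" "\<not> adj G c m" "adj G x m"
    "\<And>u. u \<in> S \<Longrightarrow> adj G x u \<Longrightarrow> u = m" "\<And>u. u \<in> S \<Longrightarrow> adj G m u \<Longrightarrow> u = x"
proof -
  have unique: "\<exists>!u. u \<in> S \<and> adj G y u" if "y \<in> S" "y \<noteq> c" for y
    using S that by (simp add: star_with_matching_def)
  obtain m where m: "m \<in> S" "adj G x m" "\<And>u. u \<in> S \<Longrightarrow> adj G x u \<Longrightarrow> u = m"
    using unique[OF x(1,2)] by blast
  have mc: "m \<noteq> c" using m(2) x(3) adj_commute[of G x c] by blast
  have mx: "adj G m x" using m(2) adj_commute[of G x m] by blast
  have only: "u = x" if "u \<in> S" "adj G m u" for u
    using unique[OF m(1) mc] that mx x(1) by blast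
  have "c \<in> S" using S by (simp add: star_with_matching_def)
  then have "\<not> adj G c m" using only[of c] x(2) adj_commute[of G c m] by blast
  then show thesis using that[OF m(1) mc _ _ m(2)] m(3) only adjD(3)[OF G m(2)] by blast
qed

lemma star_with_matching_extend:
  assumes S: "star_with_matching G S c" and v: "v \<in> verts G" "v \<notin> S" "adj G v c"
    and only: "\<And>u. u \<in> S \<Longrightarrow> adj G v u \<Longrightarrow> u = c" and irrefl: "\<not> adj G v v"
  shows "star_with_matching G (insert v S) c"
proof -
  have unique: "\<exists>!u. u \<in> insert v S \<and> adj G x u" if x: "x \<in> insert v S" "x \<noteq> c" for x
  proof (cases "x = v")
    case True
    have "c \<in> S" using S by (simp add: star_with_matching_def)
    then show ?thesis using True v(3) only irrefl by blast
  next
    case False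
    then have "\<exists>!u. u \<in> S \<and> adj G x u" using x S by (simp add: star_with_matching_def)
    moreover have "\<not> adj G x v" using only[of x] x False adj_commute[of G x v] by blast
    ultimately show ?thesis by blast
  qed
  have S': "S \<subseteq> verts G" "c \<in> S" "\<exists>u\<in>S. adj G c u" "\<exists>u\<in>S. u \<noteq> c \<and> \<not> adj G c u"
    using S by (simp_all add: star_with_matching_def)
  show ?thesis
    unfolding star_with_matching_def
  proof (intro conjI ballI impI)
    show "\<exists>!u. u \<in> insert v S \<and> adj G x u" if "x \<in> insert v S" "x \<noteq> c" for x
      using unique[OF that] .
  qed (use S' v(1) in blast)+
qed

text \<open>If the star is a single edge, the set induces a matching and any vertex may serve as centre.\<close>

lemma star_with_matching_recenter:
  assumes G: "simple_graph G" and S: "star_with_matching G S c"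
    and single: "\<And>l l'. l \<in> S \<Longrightarrow> l' \<in> S \<Longrightarrow> adj G c l \<Longrightarrow> adj G c l' \<Longrightarrow> l = l'" and t: "t \<in> S"
  shows "star_with_matching G S t"
proof -
  have unique: "\<exists>!u. u \<in> S \<and> adj G y u" if "y \<in> S" for y
  proof (cases "y = c")
    case True
    then show ?thesis using S single unfolding star_with_matching_def by blast
  next
    case False
    then show ?thesis using S that unfolding star_with_matching_def by blast
  qed
  obtain x where x: "x \<in> S" "x \<noteq> c" "\<not> adj G c x" using S unfolding star_with_matching_def by blast
  have c: "c \<in> S" "S \<subseteq> verts G" using S by (auto simp: star_with_matching_def)
  have "\<exists>u\<in>S. u \<noteq> t \<and> \<not> adj G t u"
  proof (cases "t = c \<or> \<not> adj G t c")
    case True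
    then show ?thesis using x c by (cases "t = c") auto
  next
    case False
    then have "\<not> adj G t x" using unique[OF t] x c by blast
    moreover have "x \<noteq> t" using False x(3) adj_commute[of G t c] by blast
    ultimately show ?thesis using x by blast
  qed
  moreover have "\<exists>u\<in>S. adj G t u" using unique[OF t] by blast
  ultimately show ?thesis using unique t c(2) by (simp add: star_with_matching_def)
qed

text \<open>
  A vertex seeing both ends of an edge sees both ends of every edge, passing between the star and
  the matching through the induced \<open>2K\<^sub>2\<close>. One that sees something, but at most one end of each
  edge, extends the set, possibly around another centre, or completes \<open>2P\<^sub>3\<close>, \<open>K\<^sub>2 + P\<^sub>4\<close> or
  \<open>K\<^sub>2 + C\<^sub>4\<close>.
\<close>

lemma maximal_star_with_matching_uniform:
  assumes G: "hereditary_unigraph G" and S: "star_with_matching G S c"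
    and max: "\<And>T t. S \<subset> T \<Longrightarrow> \<not> star_with_matching G T t"
    and v: "v \<in> verts G" "v \<notin> S" and u: "u \<in> S" "adj G v u" and u': "u' \<in> S"
  shows "adj G v u'"
proof -
  note s = hereditary_unigraph_simple[OF G]
  note irrefl = adjD(3)[OF s]
  have SV: "S \<subseteq> verts G" and cS: "c \<in> S" using S by (auto simp: star_with_matching_def)
  obtain l0 where l0: "l0 \<in> S" "adj G c l0" using S by (auto simp: star_with_matching_def)
  obtain x0 where x0: "x0 \<in> S" "x0 \<noteq> c" "\<not> adj G c x0" using S by (auto simp: star_with_matching_def)
  have leaf: "u = c" if "l \<in> S" "adj G c l" "u \<in> S" "adj G l u" for l u
    using star_with_matching_leaf[OF S that(1,2) _ that(3,4)] irrefl[OF that(2)] by blast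
  have not_both: "star_with_matching G S t \<Longrightarrow> adj G v t \<Longrightarrow> \<exists>u\<in>S. adj G v u \<and> u \<noteq> t" for t
  proof (rule ccontr)
    assume t: "star_with_matching G S t" "adj G v t" "\<not> (\<exists>u\<in>S. adj G v u \<and> u \<noteq> t)"
    have "star_with_matching G (insert v S) t"
      by (rule star_with_matching_extend[OF t(1) v t(2)]) (use t(3) irrefl[of v v] in blast)+
    then show False using max[of "insert v S" t] v(2) by blast
  qed
  have star_2K2: "induces_2K2 G c l x m"
    if "l \<in> S" "adj G c l" "x \<in> S" "x \<noteq> c" "\<not> adj G c x" "m \<in> S" "m \<noteq> c" "\<not> adj G c m" "adj G x m" for l x m
  proof -
    have "c \<noteq> l" "x \<noteq> m" using irrefl that by blast+
    moreover have "\<not> adj G l x" "\<not> adj G l m" using leaf[OF that(1,2)] that by blast+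
    moreover have "l \<noteq> x" "l \<noteq> m" using that by blast+
    ultimately show ?thesis using that cS SV unfolding induces_2K2_def by auto
  qed
  show ?thesis
  proof (cases "\<exists>x\<in>S. \<exists>y\<in>S. adj G x y \<and> adj G v x \<and> adj G v y")
    case True
    then obtain x y where xy: "x \<in> S" "y \<in> S" "adj G x y" "adj G v x" "adj G v y" by blast
    have both: "adj G v z \<and> adj G v w" if "induces_2K2 G p q z w" "{p, q, z, w} \<subseteq> S" "adj G v p" "adj G v q" for p q z w
      using trace_on_2K2[OF G that(1) v(1) _ that(3)] that(2,4) v(2) by auto
    have from_star: "adj G v x" if l: "l \<in> S" "adj G c l" "adj G v c" "adj G v l"
      and x: "x \<in> S" "x \<noteq> c" "\<not> adj G c x" for l x
    proof -
      obtain m where "m \<in> S" "m \<noteq> c" "\<not> adj G c m" "adj G x m"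
        using star_with_matching_partner[OF s S x] by metis
      then show ?thesis
        using both[OF star_2K2[OF l(1,2) x]] l x cS by blast
    qed
    have to_star: "adj G v c \<and> adj G v l" if l: "l \<in> S" "adj G c l"
      and x: "x \<in> S" "x \<noteq> c" "\<not> adj G c x" and m: "m \<in> S" "m \<noteq> c" "\<not> adj G c m" "adj G x m" "adj G v x" "adj G v m" for l x m
      using both[OF induces_2K2_swap(1)[OF star_2K2[OF l x m(1-4)]]] l x m cS by blast
    have "\<exists>l\<in>S. adj G c l \<and> adj G v c \<and> adj G v l"
    proof (cases "x = c \<or> y = c")
      case True
      then show ?thesis using xy adj_commute[of G x c] by blast
    next
      case False
      have "\<not> adj G c x" using leaf[of x y] xy False by blast
      moreover have "\<not> adj G c y" using leaf[of y x] xy False adj_commute[of G x y] by blast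
      ultimately show ?thesis using to_star[OF l0, of x y] xy False l0 by blast
    qed
    then obtain l where l: "l \<in> S" "adj G c l" "adj G v c" "adj G v l" by blast
    obtain m0 where m0: "m0 \<in> S" "m0 \<noteq> c" "\<not> adj G c m0" "adj G x0 m0"
      using star_with_matching_partner[OF s S x0] by metis
    have vxm: "adj G v x0" "adj G v m0"
      using from_star[OF l x0] from_star[OF l m0(1-3)] by blast+
    show ?thesis
    proof (cases "u' = c \<or> adj G c u'")
      case True
      then show ?thesis using l(3) to_star[OF u' _ x0 m0 vxm] by blast
    next
      case False
      then show ?thesis using from_star[OF l u'] by blast
    qed
  next
    case False
    then have no_edge: "\<not> adj G v y" if "x \<in> S" "y \<in> S" "adj G x y" "adj G v x" for x y
      using that by blast
    have none: "\<not> adj G v z \<and> \<not> adj G v w"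
      if "induces_2K2 G p q z w" "{p, q, z, w} \<subseteq> S" "adj G v p" for p q z w
    proof -
      have "adj G p q" using that(1) by (simp add: induces_2K2_def)
      then have "\<not> adj G v q" using no_edge[of p q] that(2,3) by blast
      then show ?thesis
        using trace_on_2K2[OF G that(1) v(1) _ that(3)] that(2) v(2) by auto
    qed
    obtain m0 where m0: "m0 \<in> S" "m0 \<noteq> c" "\<not> adj G c m0" "adj G x0 m0"
      using star_with_matching_partner[OF s S x0] by metis
    have two_leaves: "\<exists>l\<in>S. \<exists>l'\<in>S. adj G c l \<and> adj G c l' \<and> l \<noteq> l'"
      if t: "t \<in> S" "adj G v t" "\<And>w. w \<in> S \<Longrightarrow> w \<noteq> t \<Longrightarrow> \<not> adj G v w" for t
    proof (rule ccontr)
      assume "\<not> ?thesis"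
      then have "star_with_matching G S t"
        by (intro star_with_matching_recenter[OF s S _ t(1)]) blast
      then show False using not_both[of t] t by blast
    qed
    have vc: "\<not> adj G v c"
    proof
      assume vc: "adj G v c"
      have "\<not> adj G v w" if w: "w \<in> S" "w \<noteq> c" for w
      proof (cases "adj G c w")
        case True
        then show ?thesis using no_edge[OF cS w(1) True vc] by blast
      next
        case False
        obtain m where m: "m \<in> S" "m \<noteq> c" "\<not> adj G c m" "adj G w m"
          using star_with_matching_partner[OF s S w False] by metis
        then show ?thesis using none[OF star_2K2[OF l0 w False m]] cS l0 w m vc by blast
      qed
      then show False using not_both[OF S vc] by blast
    qed
    have False
    proof (cases "adj G c u")
      case leaf_u: True
      have uc: "induces_2K2 G u c x m"
        if "x \<in> S" "x \<noteq> c" "\<not> adj G c x" "m \<in> S" "m \<noteq> c" "\<not> adj G c m" "adj G x m" for x m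
        using induces_2K2_swap(2)[OF star_2K2[OF u(1) leaf_u that]] .
      have matched: "\<not> adj G v w" if w: "w \<in> S" "w \<noteq> c" "\<not> adj G c w" for w
      proof -
        obtain m where m: "m \<in> S" "m \<noteq> c" "\<not> adj G c m" "adj G w m"
          using star_with_matching_partner[OF s S w] by metis
        then show ?thesis using none[OF uc[OF w m]] cS u w m by blast
      qed
      have "l = u" if l: "l \<in> S" "adj G c l" for l
      proof (rule ccontr)
        assume lu: "l \<noteq> u"
        have q: "induces_2K2 G c l x0 m0" "induces_2K2 G c u x0 m0"
          using star_2K2[OF l x0 m0] star_2K2[OF u(1) leaf_u x0 m0] .
        have nlu: "\<not> adj G u l" using leaf[OF u(1) leaf_u l(1)] irrefl[OF l(2)] by blast
        have nv: "\<not> adj G v x0" "\<not> adj G v m0" using matched x0 m0 by blast+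
        have vS: "v \<noteq> x0" "v \<noteq> m0" "v \<noteq> c" "v \<noteq> u" "v \<noteq> l" using v x0 m0 cS u l by blast+
        have facts: "set [x0, m0, v, u, c, l] \<subseteq> verts G" "distinct [x0, m0, v, u, c, l]"
          using q vS v(1) lu unfolding induces_2K2_def by auto
        have sym: "\<not> adj G x0 v" "\<not> adj G m0 v" "\<not> adj G x0 u" "\<not> adj G m0 u" "\<not> adj G x0 c"
          "\<not> adj G m0 c" "\<not> adj G x0 l" "\<not> adj G m0 l" "adj G u c" "adj G u v" "adj G l v \<longleftrightarrow> adj G v l"
          "adj G l c"
          using q nv u(2) leaf_u l(2) adj_commute[of G] unfolding induces_2K2_def by blast+
        show False
        proof (cases "adj G v l")
          case True
          show False
            by (rule no_K2_C4[OF G, of x0 m0 v u c l])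
              (use facts sym vc nlu m0(4) u(2) l(2) True in simp_all)
        next
          case False
          show False
            by (rule no_K2_P4[OF G, of x0 m0 v u c l])
              (use facts sym vc nlu m0(4) u(2) l(2) False in simp_all)
        qed
      qed
      moreover from this have "\<not> adj G v w" if "w \<in> S" "w \<noteq> u" for w
        using that vc matched[of w] by blast
      ultimately show False using two_leaves[OF u] by metis
    next
      case False
      have "u \<noteq> c" using u(2) vc by blast
      obtain m where m: "m \<in> S" "m \<noteq> c" "m \<noteq> u" "\<not> adj G c m" "adj G u m"
        and only: "\<And>w. w \<in> S \<Longrightarrow> adj G u w \<Longrightarrow> w = m" "\<And>w. w \<in> S \<Longrightarrow> adj G m w \<Longrightarrow> w = u"
        using star_with_matching_partner[OF s S u(1) \<open>u \<noteq> c\<close> False] by metis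
      have um: "induces_2K2 G u m c l" if "l \<in> S" "adj G c l" for l
        using induces_2K2_swap(1)[OF star_2K2[OF that u(1) \<open>u \<noteq> c\<close> False m(1,2,4,5)]] .
      have vm: "\<not> adj G v m" using no_edge[OF u(1) m(1,5) u(2)] .
      have "\<not> adj G v w" if w: "w \<in> S" "w \<noteq> u" for w
      proof (cases "w = c \<or> adj G c w \<or> w = m")
        case True
        then show ?thesis using vc vm none[OF um[of w]] u m cS w by blast
      next
        case wn: False
        then have wc: "w \<noteq> c" "\<not> adj G c w" "w \<noteq> m" by blast+
        obtain m' where m': "m' \<in> S" "m' \<noteq> c" "m' \<noteq> w" "\<not> adj G c m'" "adj G w m'"
          and only': "\<And>y. y \<in> S \<Longrightarrow> adj G m' y \<Longrightarrow> y = w"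
          using star_with_matching_partner[OF s S w(1) wc(1,2)] by metis
        have ne: "m' \<noteq> u" "m' \<noteq> m" using only'[of m] only'[of u] m u(1) wc w adj_commute[of G m u] by blast+
        have "induces_2K2 G u m w m'"
        proof -
          have "\<not> adj G u w" "\<not> adj G m w" "\<not> adj G u m'" "\<not> adj G m m'"
            using only(1)[OF w(1)] only(2)[OF w(1)] only(1)[OF m'(1)] only(2)[OF m'(1)] wc w ne
            by blast+
          then show ?thesis
            using u(1) m(1,3,5) m'(1,3,5) w wc ne SV unfolding induces_2K2_def by auto
        qed
        then show ?thesis using none[of u m w m'] u m(1) w m'(1) by blast
      qed
      then obtain l l' where l: "l \<in> S" "l' \<in> S" "adj G c l" "adj G c l'" "l \<noteq> l'"
        using two_leaves[OF u] by blast
      have nv: "\<not> adj G v l" "\<not> adj G v l'" "\<not> adj G v c"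
        using none[OF um[OF l(1,3)]] none[OF um[OF l(2,4)]] u m cS l by blast+
      have vS: "v \<noteq> u" "v \<noteq> m" "v \<noteq> c" "v \<noteq> l" "v \<noteq> l'" using v u(1) m(1) cS l by blast+
      have nll: "\<not> adj G l l'" using leaf[OF l(1,3,2)] irrefl[OF l(4)] by blast
      note q = um[OF l(1,3)] um[OF l(2,4)]
      have facts: "set [l, c, l', v, u, m] \<subseteq> verts G" "distinct [l, c, l', v, u, m]"
        using q vS v(1) l(5) unfolding induces_2K2_def by auto
      have sym: "adj G l c" "\<not> adj G l v" "\<not> adj G l u" "\<not> adj G l m" "\<not> adj G c v" "\<not> adj G c u"
        "\<not> adj G c m" "\<not> adj G l' v" "\<not> adj G l' u" "\<not> adj G l' m"
        using q nv l adj_commute[of G] unfolding induces_2K2_def by blast+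
      show False
        by (rule no_P3_P3[OF G, of l c l' v u m]) (use facts sym nll vm l m(5) u(2) in simp_all)
    qed
    then show ?thesis ..
  qed
qed


text \<open>
  Around a maximal star with a matching, the vertices that see nothing of it are independent, as two
  adjacent ones would extend the matching; those that see all of it form a clique, as two
  non-adjacent ones would give \<open>K\<^sub>2 + C\<^sub>4\<close> in the complement.
\<close>

lemma indecomposable_star_with_matching:
  assumes G: "hereditary_unigraph G" and ind: "\<not> decomposable G" and E: "induces_2K2 G a b c d"
  shows "\<exists>t. star_with_matching G (verts G) t"
proof -
  note s = hereditary_unigraph_simple[OF G] and co = hereditary_unigraph_complement[OF G]
  note irrefl = adjD(3)[OF s] and fin = simple_graph_finite[OF s]
  have E': "{a, b, c, d} \<subseteq> verts G" "distinct [a, b, c, d]" "adj G a b" "adj G c d"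
    "\<not> adj G a c" "\<not> adj G a d" "\<not> adj G b c" "\<not> adj G b d"
    using E by (simp_all add: induces_2K2_def)
  have sym: "adj G b a" "adj G d c" "\<not> adj G c a" "\<not> adj G d a" "\<not> adj G c b" "\<not> adj G d b"
    using E'(3-) adj_commute[of G] by blast+
  have "star_with_matching G {a, b, c, d} a"
  proof -
    have "\<exists>!u. u \<in> {a, b, c, d} \<and> adj G b u" by (rule ex1I[of _ a]) (use E' sym irrefl in blast)+
    moreover have "\<exists>!u. u \<in> {a, b, c, d} \<and> adj G c u" by (rule ex1I[of _ d]) (use E' sym irrefl in blast)+
    moreover have "\<exists>!u. u \<in> {a, b, c, d} \<and> adj G d u" by (rule ex1I[of _ c]) (use E' sym irrefl in blast)+
    ultimately show ?thesis using E' unfolding star_with_matching_def by auto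
  qed
  moreover have "\<forall>S. (\<exists>t. star_with_matching G S t) \<longrightarrow> card S < Suc (card (verts G))"
    using fin by (auto simp: star_with_matching_def less_Suc_eq_le card_mono)
  ultimately obtain S where ex: "\<exists>t. star_with_matching G S t"
    and top: "\<And>T. \<exists>t. star_with_matching G T t \<Longrightarrow> card T \<le> card S"
    using ex_has_greatest_nat[of "\<lambda>S. \<exists>t. star_with_matching G S t" "{a, b, c, d}" card] by blast
  from ex obtain t where S: "star_with_matching G S t" ..
  have max: "\<not> star_with_matching G T t'" if "S \<subset> T" for T t'
  proof
    assume T: "star_with_matching G T t'"
    then have "finite T" using fin finite_subset unfolding star_with_matching_def by blast
    then have "card S < card T" using that by (rule psubset_card_mono)
    then show False using top[of T] T by fastforce
  qed
  have SV: "S \<subseteq> verts G" and tS: "t \<in> S" using S by (auto simp: star_with_matching_def)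
  obtain l where l: "l \<in> S" "adj G t l" using S by (auto simp: star_with_matching_def)
  obtain x where x: "x \<in> S" "x \<noteq> t" "\<not> adj G t x" using S by (auto simp: star_with_matching_def)
  obtain m where m: "m \<in> S" "m \<noteq> t" "m \<noteq> x" "\<not> adj G t m" "adj G x m"
    using star_with_matching_partner[OF s S x] by metis
  have lx: "\<not> adj G l x" "\<not> adj G l m"
    using star_with_matching_leaf[OF S l _ x(1)] star_with_matching_leaf[OF S l _ m(1)]
      irrefl[OF l(2)] x m by blast+
  define V0 where "V0 = {v \<in> verts G - S. \<forall>u\<in>S. \<not> adj G v u}"
  define V1 where "V1 = {v \<in> verts G - S. \<forall>u\<in>S. adj G v u}"
  have dec: "decomposes G V0 V1 S"
    unfolding decomposes_def
  proof (intro conjI ballI impI)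
    show "verts G = V0 \<union> V1 \<union> S"
    proof (rule set_eqI)
      fix v
      show "v \<in> verts G \<longleftrightarrow> v \<in> V0 \<union> V1 \<union> S"
      proof (cases "v \<in> verts G - S")
        case True
        then show ?thesis
          using maximal_star_with_matching_uniform[OF G S max, of v] unfolding V0_def V1_def by blast
      next
        case False
        then show ?thesis using SV unfolding V0_def V1_def by blast
      qed
    qed
    show "\<not> adj G u v" if uv: "u \<in> V0" "v \<in> V0" for u v
    proof
      assume adj: "adj G u v"
      have u: "u \<in> verts G" "u \<notin> S" "\<And>w. w \<in> S \<Longrightarrow> \<not> adj G u w \<and> \<not> adj G w u"
        using uv(1) adj_commute[of G u] unfolding V0_def by blast+
      have v: "v \<in> verts G" "v \<notin> S" "\<And>w. w \<in> S \<Longrightarrow> \<not> adj G v w \<and> \<not> adj G w v"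
        using uv(2) adj_commute[of G v] unfolding V0_def by blast+
      have vu: "adj G v u" using adj adj_commute[of G u v] by blast
      have "star_with_matching G (insert u (insert v S)) t"
        unfolding star_with_matching_def
      proof (intro conjI ballI impI)
        fix y assume y: "y \<in> insert u (insert v S)" "y \<noteq> t"
        show "\<exists>!w. w \<in> insert u (insert v S) \<and> adj G y w"
        proof (cases "y \<in> S")
          case True
          then have "\<exists>!w. w \<in> S \<and> adj G y w" using S y(2) by (simp add: star_with_matching_def)
          then show ?thesis using u(3)[OF True] v(3)[OF True] by blast
        next
          case False
          then consider "y = u" | "y = v" using y(1) by blast
          then show ?thesis
          proof cases
            case 1
            show ?thesis by (rule ex1I[of _ v]) (use 1 adj u(3) irrefl[of u u] in blast)+
          next
            case 2
            show ?thesis by (rule ex1I[of _ u]) (use 2 vu v(3) irrefl[of v v] in blast)+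
          qed
        qed
      qed (use SV tS l x u(1) v(1) in blast)+
      then show False using max[of "insert u (insert v S)"] u(2) by blast
    qed
    show "adj G u v" if uv: "u \<in> V1" "v \<in> V1" "u \<noteq> v" for u v
    proof (rule ccontr)
      assume nadj: "\<not> adj G u v"
      have u: "u \<in> verts G" "u \<notin> S" "\<And>w. w \<in> S \<Longrightarrow> adj G u w" using uv(1) by (simp_all add: V1_def)
      have v: "v \<in> verts G" "v \<notin> S" "\<And>w. w \<in> S \<Longrightarrow> adj G v w" using uv(2) by (simp_all add: V1_def)
      have in_S: "t \<in> verts G" "l \<in> verts G" "x \<in> verts G" "m \<in> verts G" using tS l x m SV by blast+
      have ne: "u \<noteq> t" "u \<noteq> l" "u \<noteq> x" "u \<noteq> m" "v \<noteq> t" "v \<noteq> l" "v \<noteq> x" "v \<noteq> m"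
        "t \<noteq> l" "t \<noteq> x" "t \<noteq> m" "l \<noteq> x" "l \<noteq> m" "x \<noteq> m"
        using u(2) v(2) tS l x m irrefl[OF l(2)] by blast+
      have xl: "\<not> adj G x l" "adj G l t \<longleftrightarrow> adj G t l" "adj G m t \<longleftrightarrow> adj G t m"
        using lx(1) adj_commute[of G] by blast+
      show False
        by (rule no_K2_C4[OF co, of u v t x l m])
          (use uv(3) nadj u(1) v(1) in_S ne u(3)[OF tS] u(3)[OF l(1)] u(3)[OF x(1)] u(3)[OF m(1)]
            v(3)[OF tS] v(3)[OF l(1)] v(3)[OF x(1)] v(3)[OF m(1)] l(2) lx x m xl in simp_all)
    qed
    show "V0 \<inter> V1 = {}" using tS unfolding V0_def V1_def by blast
  qed (auto simp: V0_def V1_def)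
  have "S \<noteq> {}" using tS by blast
  then have "V0 \<union> V1 = {}" using ind dec decomposable_iff[OF s] by blast
  then have "verts G = S" using dec by (simp add: decomposes_def)
  then show ?thesis using S by blast
qed

theorem indecomposable_nonsplit_structure:
  assumes G: "hereditary_unigraph G" and ind: "\<not> decomposable G" and nonsplit: "\<not> split_graph G"
  shows "\<exists>F \<in> {G, complement G}. F \<simeq> cycle_graph 5 \<or> (\<exists>r\<ge>2. F \<simeq> copies r (complete_graph 2)) \<or>
    (\<exists>r\<ge>2. \<exists>s\<ge>1. F \<simeq> disjoint_union (complete_bipartite 1 r) (copies s (complete_graph 2)))"
proof -
  note s = hereditary_unigraph_simple[OF G]
  have stars: "(\<exists>r\<ge>2. F \<simeq> copies r (complete_graph 2)) \<or>
      (\<exists>r\<ge>2. \<exists>s\<ge>1. F \<simeq> disjoint_union (complete_bipartite 1 r) (copies s (complete_graph 2)))"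
    if F: "hereditary_unigraph F" "\<not> decomposable F" "induces_2K2 F a b c d" for F :: "'a graph" and a b c d
  proof -
    note sF = hereditary_unigraph_simple[OF F(1)]
    obtain t where t: "star_with_matching F (verts F) t"
      using indecomposable_star_with_matching[OF F] by blast
    have tV: "t \<in> verts F" using t by (simp add: star_with_matching_def)
    have matched: "\<exists>!u. adj F v u" if v: "v \<in> verts F" "v \<noteq> t" for v
    proof -
      have "\<exists>!u. u \<in> verts F \<and> adj F v u" using t v by (simp add: star_with_matching_def)
      then show ?thesis using adjD(2)[OF sF] by blast
    qed
    obtain k where k: "F \<simeq> disjoint_union (complete_bipartite 1 (deg F t)) (copies k (complete_graph 2))"
      "card (verts F) = 1 + deg F t + 2 * k"
      using star_and_matching_iso[OF sF tV matched] by blast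
    let ?N = "{u \<in> verts F. adj F t u}"
    obtain l where l: "l \<in> ?N" using t by (auto simp: star_with_matching_def)
    obtain x where x: "x \<in> verts F" "x \<noteq> t" "\<not> adj F t x" using t by (auto simp: star_with_matching_def)
    have fin: "finite ?N" "finite (verts F)" using simple_graph_finite[OF sF] by auto
    have "t \<notin> ?N" using adjD(3)[OF sF] by blast
    then have "card (insert x (insert t ?N)) = deg F t + 2" using x fin by (simp add: deg_def)
    moreover have "card (insert x (insert t ?N)) \<le> card (verts F)"
      using x tV fin by (intro card_mono) auto
    ultimately have "k \<ge> 1" using k(2) by linarith
    have "deg F t > 0" using l fin by (auto simp: deg_def card_gt_0_iff)
    show ?thesis
    proof (cases "deg F t \<ge> 2")
      case True
      then show ?thesis using k(1) \<open>k \<ge> 1\<close> by blast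
    next
      case False
      then have one: "deg F t = 1" using \<open>deg F t > 0\<close> by simp
      then obtain w where w: "?N = {w}" unfolding deg_def by (rule card_1_singletonE)
      have "\<exists>!u. adj F v u" if "v \<in> verts F" for v
      proof (cases "v = t")
        case True
        show ?thesis
          by (rule ex1I[of _ w]) (use w True adjD(2)[OF sF] in blast)+
      next
        case False
        then show ?thesis using matched that by blast
      qed
      from perfect_matching_iso[OF sF this] obtain n
        where n: "F \<simeq> copies n (complete_graph 2)" "card (verts F) = 2 * n" by blast
      then have "n \<ge> 2" using k(2) one \<open>k \<ge> 1\<close> by linarith
      then show ?thesis using n(1) by blast
    qed
  qed
  from nonsplit_obstruction[OF s nonsplit] show ?thesis
  proof (elim disjE exE)
    fix a b c d assume "induces_2K2 G a b c d"
    then show ?thesis using stars[OF G ind] by blast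
  next
    fix a b c d assume "induces_2K2 (complement G) a b c d"
    then show ?thesis
      using stars[OF hereditary_unigraph_complement[OF G] indecomposable_complement[OF s ind]] by blast
  next
    fix a b c d e assume C: "induces_C5 G a b c d e"
    then have "G \<simeq> cycle_graph 5" using induces_C5_iso[OF s C indecomposable_C5[OF G ind C]] by simp
    then show ?thesis by blast
  qed
qed


section \<open>Expanded spiders\<close>

lemma adj_substitute:
  "adj (substitute J v H) x y \<longleftrightarrow> adj J x y \<and> x \<noteq> v \<and> y \<noteq> v \<or> adj H x y \<or>
     x \<in> verts H \<and> y \<in> verts J \<and> adj J v y \<or> y \<in> verts H \<and> x \<in> verts J \<and> adj J v x"
proof -
  have "y \<in> neighbours J v \<longleftrightarrow> y \<in> verts J \<and> adj J v y" for y
    by (simp add: neighbours_def adj_def insert_commute)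
  then show ?thesis
    unfolding substitute_def adj_def by (auto simp: doubleton_eq_iff)
qed

lemma verts_substitute [simp]: "verts (substitute J v H) = (verts J - {v}) \<union> verts H"
  by (simp add: substitute_def)

lemma simple_graphI:
  assumes "finite (verts G)" and "\<And>e. e \<in> edges G \<Longrightarrow> \<exists>x y. e = {x, y} \<and> x \<in> verts G \<and> y \<in> verts G \<and> x \<noteq> y"
  shows "simple_graph G"
  using assms unfolding simple_graph_def by (metis doubleton_in_nsets_2 subsetI)

context
  fixes J H :: "'a graph" and v :: 'a
  assumes J: "simple_graph J" and H: "simple_graph H" and disj: "verts H \<inter> (verts J - {v}) = {}"
begin

lemma adj_substitute_simps:
  "x \<in> verts J - {v} \<Longrightarrow> y \<in> verts J - {v} \<Longrightarrow> adj (substitute J v H) x y \<longleftrightarrow> adj J x y"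
  "x \<in> verts J - {v} \<Longrightarrow> w \<in> verts H \<Longrightarrow> adj (substitute J v H) x w \<longleftrightarrow> adj J x v"
  "w \<in> verts H \<Longrightarrow> x \<in> verts J - {v} \<Longrightarrow> adj (substitute J v H) w x \<longleftrightarrow> adj J v x"
  "w \<in> verts H \<Longrightarrow> w' \<in> verts H \<Longrightarrow> adj (substitute J v H) w w' \<longleftrightarrow> adj H w w'"
proof -
  have notH: "x \<notin> verts H" "\<not> adj H x y" "\<not> adj H y x" if "x \<in> verts J - {v}" for x y
    using that disj adjD[OF H] by blast+
  have notJ: "\<not> (adj J w y \<and> w \<noteq> v)" "\<not> (adj J y w \<and> w \<noteq> v)" "\<not> (w \<in> verts J \<and> adj J v w)"
    if "w \<in> verts H" for w y
    using that disj adjD[OF J] by blast+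
  show "adj (substitute J v H) x y \<longleftrightarrow> adj J x y" if "x \<in> verts J - {v}" "y \<in> verts J - {v}"
    using that notH unfolding adj_substitute by blast
  show "adj (substitute J v H) x w \<longleftrightarrow> adj J x v" if "x \<in> verts J - {v}" "w \<in> verts H"
    using that notH[OF that(1)] notJ[OF that(2)] adj_commute[of J x v] unfolding adj_substitute by blast
  show "adj (substitute J v H) w x \<longleftrightarrow> adj J v x" if "w \<in> verts H" "x \<in> verts J - {v}"
    using that notH[OF that(2)] notJ[OF that(1)] unfolding adj_substitute by blast
  show "adj (substitute J v H) w w' \<longleftrightarrow> adj H w w'" if "w \<in> verts H" "w' \<in> verts H"
    using notJ[OF that(1)] notJ[OF that(2)] unfolding adj_substitute by blast
qed

lemma simple_substitute: "simple_graph (substitute J v H)"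
proof (rule simple_graphI)
  show "finite (verts (substitute J v H))"
    using simple_graph_finite[OF J] simple_graph_finite[OF H] by simp
  fix e assume e: "e \<in> edges (substitute J v H)"
  then have "\<exists>x y. e = {x, y}"
  proof -
    have "(e \<in> edges J \<or> e \<in> edges H) \<or> (\<exists>x y. e = {x, y})"
      using e by (auto simp: substitute_def)
    moreover have "\<exists>x y. e = {x, y}" if "e \<in> edges J \<or> e \<in> edges H"
      using that J H unfolding simple_graph_def by (meson nsets2_E subsetD)
    ultimately show ?thesis by blast
  qed
  then obtain x y where xy: "e = {x, y}" by blast
  then have adj: "adj (substitute J v H) x y" using e by (simp add: adj_def)
  have "x \<in> verts (substitute J v H)" "y \<in> verts (substitute J v H)"
    using adj adjD(1,2)[OF J] adjD(1,2)[OF H] adjD(3)[OF J, of v v] unfolding adj_substitute verts_substitute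
    by blast+
  moreover have "x \<noteq> y"
  proof
    assume "x = y"
    then show False
      using adj disj adjD(3)[OF J, of x x] adjD(3)[OF J, of v v] adjD(3)[OF H, of x x]
      unfolding adj_substitute by blast
  qed
  ultimately show "\<exists>x y. e = {x, y} \<and> x \<in> verts (substitute J v H) \<and> y \<in> verts (substitute J v H) \<and> x \<noteq> y"
    using xy by blast
qed

end

text \<open>
  Substitution undoes the contraction of disjoint modules to one vertex each.
\<close>

lemma expansion_by_modules:
  assumes G: "simple_graph G" and fin: "finite W"
    and M: "\<And>v. v \<in> W \<Longrightarrow> v \<in> M v" "\<And>v. v \<in> W \<Longrightarrow> M v \<subseteq> verts G" "\<And>v. v \<in> W \<Longrightarrow> P (induced G (M v))"
    and module: "\<And>v x z. v \<in> W \<Longrightarrow> x \<in> M v \<Longrightarrow> z \<in> verts G \<Longrightarrow> z \<notin> M v \<Longrightarrow> adj G x z \<longleftrightarrow> adj G v z"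
    and disj: "\<And>v w. v \<in> W \<Longrightarrow> w \<in> W \<Longrightarrow> v \<noteq> w \<Longrightarrow> M v \<inter> M w = {}"
  shows "expansion P W (induced G (verts G - (\<Union>v\<in>W. M v - {v}))) G"
  using fin M module disj
proof (induction W rule: finite_induct)
  case empty
  then show ?case using induced_verts[OF G] expansion.none by simp
next
  case (insert v W)
  let ?U = "\<Union>w\<in>W. M w - {w}"
  let ?J = "induced G (verts G - (\<Union>w\<in>insert v W. M w - {w}))"
  let ?J' = "induced G (verts G - ?U)"
  let ?H = "induced G (M v)"
  have v: "v \<in> M v" "M v \<subseteq> verts G" "P ?H" using insert.prems(1-3) by blast+
  have out: "M v \<inter> ?U = {}"
  proof -
    have "M v \<inter> M w = {}" if "w \<in> W" for w
      using insert.prems(5)[of v w] insert.hyps(2) that by auto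
    then show ?thesis by blast
  qed
  have IH: "expansion P W ?J' G"
  proof (rule insert.IH)
    show "w \<in> M w" "M w \<subseteq> verts G" "P (induced G (M w))" if "w \<in> W" for w
      using insert.prems(1-3)[of w] that by simp_all
    show "adj G x z \<longleftrightarrow> adj G w z" if "w \<in> W" "x \<in> M w" "z \<in> verts G" "z \<notin> M w" for w x z
      using insert.prems(4)[OF _ that(2-4)] that(1) by simp
    show "M w \<inter> M w' = {}" if "w \<in> W" "w' \<in> W" "w \<noteq> w'" for w w'
      using insert.prems(5)[OF _ _ that(3)] that(1,2) by simp
  qed
  have J: "simple_graph ?J" "simple_graph ?H" by (rule simple_induced[OF G], use v in blast)+
  have J': "simple_graph ?J'" by (rule simple_induced[OF G]) blast
  have d: "verts ?H \<inter> (verts ?J - {v}) = {}" by auto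
  have V: "verts ?J - {v} = verts G - ?U - M v" using v(1) by auto
  have "substitute ?J v ?H = ?J'"
  proof (rule graph_eqI[OF simple_substitute[OF J d] J'])
    show eq: "verts (substitute ?J v ?H) = verts ?J'"
      unfolding verts_substitute V using v(2) out by auto
    fix x y assume xy: "x \<in> verts (substitute ?J v ?H)" "y \<in> verts (substitute ?J v ?H)"
    have vJ: "v \<in> verts ?J" using v out by auto
    have mod: "adj G x z \<longleftrightarrow> adj G v z" "adj G z x \<longleftrightarrow> adj G z v"
      if "x \<in> M v" "z \<in> verts ?J - {v}" for x z
      using insert.prems(4)[of v x z] that V adj_commute[of G z x] adj_commute[of G z v] by auto
    note sub = adj_substitute_simps[OF J d]
    have inJ': "x \<in> verts ?J'" "y \<in> verts ?J'" using xy eq by blast+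
    consider "x \<in> verts ?J - {v}" "y \<in> verts ?J - {v}" | "x \<in> verts ?J - {v}" "y \<in> verts ?H"
      | "x \<in> verts ?H" "y \<in> verts ?J - {v}" | "x \<in> verts ?H" "y \<in> verts ?H"
      using xy unfolding verts_substitute by blast
    then show "adj (substitute ?J v ?H) x y \<longleftrightarrow> adj ?J' x y"
    proof cases
      case 1
      have "x \<noteq> v" "y \<noteq> v" "x \<in> verts ?J" "y \<in> verts ?J" using 1 by blast+
      then have "adj ?J x y \<longleftrightarrow> adj G x y" by (simp only: adj_induced verts_induced simp_thms)
      moreover have "adj ?J' x y \<longleftrightarrow> adj G x y" using inJ' by (simp only: adj_induced verts_induced simp_thms)
      ultimately show ?thesis using sub(1)[OF 1] by blast
    next
      case 2
      have "x \<in> verts ?J" using 2(1) by blast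
      have "y \<in> M v" using 2(2) by simp
      have "adj ?J x v \<longleftrightarrow> adj G x v" using vJ \<open>x \<in> verts ?J\<close> by (simp only: adj_induced verts_induced simp_thms)
      moreover have "adj ?J' x y \<longleftrightarrow> adj G x y" using inJ' by (simp only: adj_induced verts_induced simp_thms)
      ultimately show ?thesis using sub(2)[OF 2] mod(2)[OF \<open>y \<in> M v\<close> 2(1)] by blast
    next
      case 3
      have "y \<in> verts ?J" using 3(2) by blast
      have "x \<in> M v" using 3(1) by simp
      have "adj ?J v y \<longleftrightarrow> adj G v y" using vJ \<open>y \<in> verts ?J\<close> by (simp only: adj_induced verts_induced simp_thms)
      moreover have "adj ?J' x y \<longleftrightarrow> adj G x y" using inJ' by (simp only: adj_induced verts_induced simp_thms)
      ultimately show ?thesis using sub(3)[OF 3] mod(1)[OF \<open>x \<in> M v\<close> 3(2)] by blast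
    next
      case 4
      have "x \<in> M v" "y \<in> M v" using 4 by simp_all
      then have "adj ?H x y \<longleftrightarrow> adj G x y" by (simp only: adj_induced simp_thms)
      moreover have "adj ?J' x y \<longleftrightarrow> adj G x y" using inJ' by (simp only: adj_induced verts_induced simp_thms)
      ultimately show ?thesis using sub(4)[OF 4] by blast
    qed
  qed
  moreover have "insert v W - {v} = W" using insert.hyps(2) by simp
  moreover have "v \<in> insert v W" "verts ?H \<noteq> {}" using v by auto
  ultimately show ?case
    using expansion.step[of v "insert v W" ?H P ?J G] J(2) v(3) d IH by simp
qed

text \<open>
  Both orientations of both kinds of spiders are treated at once: \<open>k\<close> says whether the side \<open>Y\<close>
  of the substituted vertices is the clique, and \<open>t\<close> whether the spider is of the first kind.
\<close>

lemma stars_expansion: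
  fixes k t :: bool
  assumes G: "simple_graph G" and V: "verts G = X \<union> Y" "X \<inter> Y = {}"
    and Y: "\<And>y y'. y \<in> Y \<Longrightarrow> y' \<in> Y \<Longrightarrow> y \<noteq> y' \<Longrightarrow> adj G y y' \<longleftrightarrow> k"
    and p: "p ` Y = X" and adj: "\<And>x y. x \<in> X \<Longrightarrow> y \<in> Y \<Longrightarrow> adj G x y \<longleftrightarrow> (p y = x \<longleftrightarrow> t)"
    and P: "\<And>F. simple_graph F \<Longrightarrow>
      (\<And>u v. u \<in> verts F \<Longrightarrow> v \<in> verts F \<Longrightarrow> u \<noteq> v \<Longrightarrow> adj F u v \<longleftrightarrow> k) \<Longrightarrow> P F"
  obtains W where "W \<subseteq> Y" "bij_betw p W X" "expansion P W (induced G (X \<union> W)) G"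
proof -
  define r where "r x = (SOME y. y \<in> Y \<and> p y = x)" for x
  have r: "r x \<in> Y \<and> p (r x) = x" if "x \<in> X" for x
    unfolding r_def by (rule someI_ex) (use that p in blast)
  define W where "W = r ` X"
  define M where "M v = {y \<in> Y. p y = p v}" for v
  have WY: "W \<subseteq> Y" using r by (auto simp: W_def)
  have pr: "r (p v) = v" if "v \<in> W" for v using that r by (auto simp: W_def)
  have "bij_betw p W X"
    by (rule bij_betw_byWitness[of _ r]) (use pr r WY p in \<open>auto simp: W_def\<close>)
  moreover have "expansion P W (induced G (verts G - (\<Union>v\<in>W. M v - {v}))) G"
  proof (rule expansion_by_modules[OF G])
    show "finite W" using finite_subset[of W "verts G"] simple_graph_finite[OF G] WY V(1) by blast
    show "P (induced G (M v))" if "v \<in> W" for v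
    proof (rule P)
      show "simple_graph (induced G (M v))" by (rule simple_induced[OF G]) (use V in \<open>auto simp: M_def\<close>)
      show "adj (induced G (M v)) x y \<longleftrightarrow> k"
        if "x \<in> verts (induced G (M v))" "y \<in> verts (induced G (M v))" "x \<noteq> y" for x y
        using that Y[of x y] by (simp add: M_def)
    qed
    show "adj G x z \<longleftrightarrow> adj G v z" if h: "v \<in> W" "x \<in> M v" "z \<in> verts G" "z \<notin> M v" for v x z
    proof -
      have x: "x \<in> Y" "p x = p v" and v: "v \<in> Y" using h WY by (auto simp: M_def)
      show ?thesis
      proof (cases "z \<in> Y")
        case True
        then have "x \<noteq> z" "v \<noteq> z" using h x by (auto simp: M_def)
        then show ?thesis using Y[OF x(1) True] Y[OF v True] by simp
      next
        case False
        then have "z \<in> X" using h(3) V by blast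
        then show ?thesis
          using adj[of z x] adj[of z v] x v adj_commute[of G z x] adj_commute[of G z v] by simp
      qed
    qed
    show "M v \<inter> M w = {}" if "v \<in> W" "w \<in> W" "v \<noteq> w" for v w
      using that pr[of v] pr[of w] by (auto simp: M_def)
  qed (use WY V in \<open>auto simp: M_def\<close>)
  moreover have "verts G - (\<Union>v\<in>W. M v - {v}) = X \<union> W"
  proof -
    have "\<exists>v\<in>W. y \<in> M v - {v}" if y: "y \<in> Y" "y \<notin> W" for y
    proof -
      have "p y \<in> X" using y p by blast
      then have "r (p y) \<in> W" "p (r (p y)) = p y" using r by (auto simp: W_def)
      then show ?thesis using y by (intro bexI[of _ "r (p y)"]) (auto simp: M_def)
    qed
    then have lost: "y \<in> (\<Union>v\<in>W. M v - {v})" if "y \<in> Y" "y \<notin> W" for y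
      using that by blast
    have kept: "y \<notin> M v - {v}" if "y \<in> W" "v \<in> W" for y v
    proof
      assume "y \<in> M v - {v}"
      then have "p y = p v" "y \<noteq> v" by (auto simp: M_def)
      then show False using pr[OF that(1)] pr[OF that(2)] by metis
    qed
    have MY: "M v \<subseteq> Y" for v by (auto simp: M_def)
    show ?thesis
    proof (rule set_eqI)
      fix y
      show "y \<in> verts G - (\<Union>v\<in>W. M v - {v}) \<longleftrightarrow> y \<in> X \<union> W"
      proof (cases "y \<in> Y")
        case True
        then have "y \<in> verts G" "y \<notin> X" using V by blast+
        then show ?thesis using lost[OF True] kept[of y] by blast
      next
        case False
        then have "y \<notin> W" "y \<notin> (\<Union>v\<in>W. M v - {v})" using WY MY by blast+
        then show ?thesis using False V(1) by blast
      qed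
    qed
  qed
  ultimately show thesis using that[OF WY] by simp
qed

lemma starlike_expanded_spider:
  assumes s: "splitted G A B" and st: "starlike (adj G) A B"
  shows "top_expanded_spider G \<or> bottom_expanded_spider G"
proof -
  have G: "simple_graph G" and V: "verts G = A \<union> B" "A \<inter> B = {}"
    and A: "\<And>u v. u \<in> A \<Longrightarrow> v \<in> A \<Longrightarrow> \<not> adj G u v"
    and B: "\<And>u v. u \<in> B \<Longrightarrow> v \<in> B \<Longrightarrow> u \<noteq> v \<Longrightarrow> adj G u v"
    using s by (auto simp: splitted_iff decomposes_def)
  have split: "splitted (induced G (X \<union> Y)) X Y" if "X \<subseteq> A" "Y \<subseteq> B" for X Y
  proof -
    have sub: "X \<union> Y \<subseteq> verts G" "A \<inter> (X \<union> Y) = X" "B \<inter> (X \<union> Y) = Y" using that V by auto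
    moreover have "decomposes G A B {}" using s by (simp add: splitted_iff)
    ultimately show ?thesis
      using decomposes_induced[OF _ sub(1), of A B "{}"] simple_induced[OF G sub(1)]
      by (simp add: splitted_iff)
  qed
  have nbr: "neighbours (induced G (X \<union> Y)) v = {u \<in> Y. adj G v u}" if "X \<subseteq> A" "Y \<subseteq> B" "v \<in> X" for X Y v
  proof -
    have "neighbours (induced G (X \<union> Y)) v = {u \<in> X \<union> Y. adj G v u}"
      using that(3) adj_commute[of G v] unfolding neighbours_def adj_def[symmetric] by auto
    then show ?thesis using A that by blast
  qed
  have top: "top_expanded_spider G"
    if card: "2 \<le> card A" and p: "p ` B = A"
      and adj: "\<And>a b. a \<in> A \<Longrightarrow> b \<in> B \<Longrightarrow> adj G a b \<longleftrightarrow> (p b = a \<longleftrightarrow> t)" for p t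
  proof -
    obtain W where W: "W \<subseteq> B" "bij_betw p W A" and ex: "expansion complete W (induced G (A \<union> W)) G"
    proof (rule stars_expansion[OF G V _ p adj, of True complete])
      fix F :: "'a graph"
      assume F: "simple_graph F"
        "\<And>u v. u \<in> verts F \<Longrightarrow> v \<in> verts F \<Longrightarrow> u \<noteq> v \<Longrightarrow> adj F u v \<longleftrightarrow> True"
      show "complete F"
        unfolding complete_def
      proof
        show "edges F \<subseteq> [verts F]\<^bsup>2\<^esup>" using F(1) by (simp add: simple_graph_def)
        show "[verts F]\<^bsup>2\<^esup> \<subseteq> edges F"
        proof
          fix e assume "e \<in> [verts F]\<^bsup>2\<^esup>"
          then obtain x y where "e = {x, y}" "x \<in> verts F" "y \<in> verts F" "x \<noteq> y" by (rule nsets2_E)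
          then show "e \<in> edges F" using F(2)[of x y] by (simp add: adj_def)
        qed
      qed
    qed (use B in blast)+
    let ?f = "inv_into W p"
    have f: "bij_betw ?f A W" by (rule bij_betw_inv_into[OF W(2)])
    have fp: "p b = a \<longleftrightarrow> b = ?f a" if "a \<in> A" "b \<in> W" for a b
      using that bij_betw_inv_into_left[OF W(2)] bij_betw_inv_into_right[OF W(2)] by metis
    have "neighbours (induced G (A \<union> W)) v = (if t then {?f v} else W - {?f v})" if "v \<in> A" for v
    proof -
      have "?f v \<in> W" using bij_betwE[OF f] that by blast
      then show ?thesis
        unfolding nbr[OF order_refl W(1) that] using adj[OF that] fp[OF that] W(1) by auto
    qed
    then have "(\<forall>v\<in>A. neighbours (induced G (A \<union> W)) v = {?f v}) \<or>
        (\<forall>v\<in>A. neighbours (induced G (A \<union> W)) v = W - {?f v})" by (cases t) simp_all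
    then have "headless_spider (induced G (A \<union> W)) A W"
      unfolding headless_spider_def
      using split[OF order_refl W(1)] bij_betw_same_card[OF f] card f by blast
    then show ?thesis unfolding top_expanded_spider_def using ex by blast
  qed
  have bottom: "bottom_expanded_spider G"
    if card: "2 \<le> card B" and p: "p ` A = B"
      and adj: "\<And>a b. a \<in> A \<Longrightarrow> b \<in> B \<Longrightarrow> adj G a b \<longleftrightarrow> (p a = b \<longleftrightarrow> t)" for p t
  proof -
    have V': "verts G = B \<union> A" "B \<inter> A = {}" using V by auto
    have adj': "adj G b a \<longleftrightarrow> (p a = b \<longleftrightarrow> t)" if "b \<in> B" "a \<in> A" for a b
      using adj[OF that(2,1)] adj_commute[of G a b] by simp
    obtain W where W: "W \<subseteq> A" "bij_betw p W B" and ex: "expansion edgeless W (induced G (B \<union> W)) G"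
    proof (rule stars_expansion[OF G V' _ p adj', of False edgeless])
      fix F :: "'a graph"
      assume F: "simple_graph F"
        "\<And>u v. u \<in> verts F \<Longrightarrow> v \<in> verts F \<Longrightarrow> u \<noteq> v \<Longrightarrow> adj F u v \<longleftrightarrow> False"
      have "e \<notin> edges F" for e
      proof
        assume e: "e \<in> edges F"
        then have "e \<in> [verts F]\<^bsup>2\<^esup>" using F(1) unfolding simple_graph_def by blast
        then obtain x y where "e = {x, y}" "x \<in> verts F" "y \<in> verts F" "x \<noteq> y" by (rule nsets2_E)
        then show False using F(2)[of x y] e by (simp add: adj_def)
      qed
      then show "edgeless F" unfolding edgeless_def by blast
    qed (use A in blast)+
    have "neighbours (induced G (W \<union> B)) v = (if t then {p v} else B - {p v})" if "v \<in> W" for v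
    proof -
      have "p v \<in> B" "v \<in> A" using W p that by auto
      then show ?thesis
        unfolding nbr[OF W(1) order_refl that] using adj[OF \<open>v \<in> A\<close>] by auto
    qed
    then have "(\<forall>v\<in>W. neighbours (induced G (W \<union> B)) v = {p v}) \<or>
        (\<forall>v\<in>W. neighbours (induced G (W \<union> B)) v = B - {p v})" by (cases t) simp_all
    then have "headless_spider (induced G (W \<union> B)) W B"
      unfolding headless_spider_def
      using split[OF W(1) order_refl] bij_betw_same_card[OF W(2)] card W(2) by auto
    then show ?thesis unfolding bottom_expanded_spider_def using ex by (metis Un_commute)
  qed
  show ?thesis
    using st unfolding starlike_def stars_def
  proof (elim disjE conjE exE)
    fix p assume "2 \<le> card A" "p ` B = A" "\<forall>a\<in>A. \<forall>b\<in>B. adj G a b \<longleftrightarrow> p b = a"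
    then have "top_expanded_spider G" by (intro top[of p True]) simp_all
    then show ?thesis ..
  next
    fix p assume "2 \<le> card A" "p ` B = A" "\<forall>a\<in>A. \<forall>b\<in>B. (\<not> adj G a b) \<longleftrightarrow> p b = a"
    then have "top_expanded_spider G" by (intro top[of p False]) auto
    then show ?thesis ..
  next
    fix p assume "2 \<le> card B" "p ` A = B" "\<forall>b\<in>B. \<forall>a\<in>A. adj G a b \<longleftrightarrow> p a = b"
    then have "bottom_expanded_spider G" by (intro bottom[of p True]) simp_all
    then show ?thesis ..
  next
    fix p assume "2 \<le> card B" "p ` A = B" "\<forall>b\<in>B. \<forall>a\<in>A. (\<not> adj G a b) \<longleftrightarrow> p a = b"
    then have "bottom_expanded_spider G" by (intro bottom[of p False]) auto
    then show ?thesis ..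
  qed
qed


subsection \<open>The splitting of an expanded spider\<close>

definition thin :: "('a \<Rightarrow> 'b \<Rightarrow> bool) \<Rightarrow> 'a set \<Rightarrow> 'b set \<Rightarrow> bool" where
  "thin R X Y \<longleftrightarrow> (\<forall>y\<in>Y. \<forall>x\<in>X. \<forall>x'\<in>X. R x y \<and> R x' y \<longrightarrow> x = x')"

text \<open>
  Between the sides of an expanded spider, or of an induced subgraph of one, adjacency (\<open>t = True\<close>) or
  non-adjacency (\<open>t = False\<close>) is a partial function from one side to the other.
\<close>

definition thin_sides :: "'a graph \<Rightarrow> 'a set \<Rightarrow> 'a set \<Rightarrow> bool" where
  "thin_sides G A B \<longleftrightarrow>
     (\<exists>t. thin (\<lambda>a b. adj G a b \<longleftrightarrow> t) A B \<or> thin (\<lambda>b a. adj G b a \<longleftrightarrow> t) B A)"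

text \<open>
  The two sides of a split graph, where \<open>k\<close> says whether \<open>Y\<close> is the clique, as the invariant of a
  sequence of substitutions for vertices of \<open>Y\<close>.
\<close>

definition thin_pair :: "bool \<Rightarrow> bool \<Rightarrow> 'a set \<Rightarrow> 'a set \<Rightarrow> 'a graph \<Rightarrow> bool" where
  "thin_pair k t X Y G \<longleftrightarrow> simple_graph G \<and> verts G = X \<union> Y \<and> X \<inter> Y = {} \<and>
     (\<forall>x\<in>X. \<forall>x'\<in>X. x \<noteq> x' \<longrightarrow> (adj G x x' \<longleftrightarrow> \<not> k)) \<and> (\<forall>y\<in>Y. \<forall>y'\<in>Y. y \<noteq> y' \<longrightarrow> (adj G y y' \<longleftrightarrow> k)) \<and>
     thin (\<lambda>x y. adj G x y \<longleftrightarrow> t) X Y"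

lemma thin_pair_substitute:
  assumes J: "thin_pair k t X Y J" and v: "v \<in> Y" and H: "simple_graph H"
    and homog: "\<And>u w. u \<in> verts H \<Longrightarrow> w \<in> verts H \<Longrightarrow> u \<noteq> w \<Longrightarrow> adj H u w \<longleftrightarrow> k"
    and disj: "verts H \<inter> (verts J - {v}) = {}"
  shows "thin_pair k t X ((Y - {v}) \<union> verts H) (substitute J v H)"
proof -
  have s: "simple_graph J" and V: "verts J = X \<union> Y" "X \<inter> Y = {}"
    and X: "\<And>x x'. x \<in> X \<Longrightarrow> x' \<in> X \<Longrightarrow> x \<noteq> x' \<Longrightarrow> adj J x x' \<longleftrightarrow> \<not> k"
    and Y: "\<And>y y'. y \<in> Y \<Longrightarrow> y' \<in> Y \<Longrightarrow> y \<noteq> y' \<Longrightarrow> adj J y y' \<longleftrightarrow> k"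
    and thin: "\<And>y x x'. y \<in> Y \<Longrightarrow> x \<in> X \<Longrightarrow> x' \<in> X \<Longrightarrow> (adj J x y \<longleftrightarrow> t) \<Longrightarrow> (adj J x' y \<longleftrightarrow> t) \<Longrightarrow> x = x'"
    using J unfolding thin_pair_def thin_def by blast+
  have old: "x \<in> verts J - {v}" if "x \<in> X \<or> x \<in> Y - {v}" for x using that V v by blast
  note sub = adj_substitute_simps[OF s H disj]
  show ?thesis
    unfolding thin_pair_def thin_def
  proof (intro conjI ballI impI)
    show "simple_graph (substitute J v H)" by (rule simple_substitute[OF s H disj])
    show "verts (substitute J v H) = X \<union> (Y - {v} \<union> verts H)" using V v by auto
    show "X \<inter> (Y - {v} \<union> verts H) = {}" using V v disj by blast
    show "adj (substitute J v H) x x' \<longleftrightarrow> \<not> k" if "x \<in> X" "x' \<in> X" "x \<noteq> x'" for x x'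
      using sub(1)[OF old old] X that by blast
    fix y y' assume y: "y \<in> Y - {v} \<union> verts H" "y' \<in> Y - {v} \<union> verts H" "y \<noteq> y'"
    consider "y \<in> Y - {v}" "y' \<in> Y - {v}" | "y \<in> Y - {v}" "y' \<in> verts H"
      | "y \<in> verts H" "y' \<in> Y - {v}" | "y \<in> verts H" "y' \<in> verts H"
      using y by blast
    then show "adj (substitute J v H) y y' \<longleftrightarrow> k"
    proof cases
      case 1
      then show ?thesis using sub(1)[OF old old, of y y'] Y[of y y'] y(3) by blast
    next
      case 2
      then show ?thesis using sub(2)[OF old, of y y'] Y[of y v] v by blast
    next
      case 3
      then show ?thesis using sub(3)[OF _ old, of y y'] Y[of v y'] v by blast
    next
      case 4
      then show ?thesis using sub(4)[of y y'] homog[of y y'] y(3) by blast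
    qed
  next
    fix y x x' assume y: "y \<in> Y - {v} \<union> verts H" and x: "x \<in> X" "x' \<in> X"
      and adj: "(adj (substitute J v H) x y \<longleftrightarrow> t) \<and> (adj (substitute J v H) x' y \<longleftrightarrow> t)"
    show "x = x'"
    proof (cases "y \<in> Y - {v}")
      case True
      then show ?thesis
        using sub(1)[OF old old, of x y] sub(1)[OF old old, of x' y] adj x thin[of y x x'] by blast
    next
      case False
      then have "y \<in> verts H" using y by blast
      then show ?thesis
        using sub(2)[OF old, of x y] sub(2)[OF old, of x' y] adj x thin[of v x x'] v by blast
    qed
  qed
qed

lemma expansion_thin_pair:
  assumes "expansion P S J G" "thin_pair k t X Y J" "S \<subseteq> Y"
    and P: "\<And>F u w. P F \<Longrightarrow> u \<in> verts F \<Longrightarrow> w \<in> verts F \<Longrightarrow> u \<noteq> w \<Longrightarrow> adj F u w \<longleftrightarrow> k"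
  shows "\<exists>Y'. thin_pair k t X Y' G"
  using assms(1-3)
proof (induction arbitrary: Y rule: expansion.induct)
  case (none S J)
  then show ?case by blast
next
  case (step v S H J G)
  have "thin_pair k t X ((Y - {v}) \<union> verts H) (substitute J v H)"
    by (rule thin_pair_substitute) (use step P in blast)+
  then show ?case by (rule step.IH) (use step.prems in blast)
qed

lemma headless_spider_relation:
  assumes "headless_spider J A B"
  shows "\<exists>f t. bij_betw f A B \<and> (\<forall>a\<in>A. \<forall>b\<in>B. (adj J a b \<longleftrightarrow> t) \<longleftrightarrow> b = f a)"
proof -
  have V: "verts J = A \<union> B" using assms by (auto simp: headless_spider_def splitted_def)
  have nbr: "adj J a b \<longleftrightarrow> b \<in> neighbours J a" if "b \<in> B" for a b
    using that V adj_commute[of J a b] by (simp add: neighbours_def adj_def)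
  obtain f where f: "bij_betw f A B" and
    "(\<forall>v\<in>A. neighbours J v = {f v}) \<or> (\<forall>v\<in>A. neighbours J v = B - {f v})"
    using assms unfolding headless_spider_def by blast
  then show ?thesis
  proof (elim disjE)
    assume "\<forall>v\<in>A. neighbours J v = {f v}"
    then have "\<forall>a\<in>A. \<forall>b\<in>B. (adj J a b \<longleftrightarrow> True) \<longleftrightarrow> b = f a" using nbr by simp
    then show ?thesis using f by blast
  next
    assume "\<forall>v\<in>A. neighbours J v = B - {f v}"
    then have "\<forall>a\<in>A. \<forall>b\<in>B. (adj J a b \<longleftrightarrow> False) \<longleftrightarrow> b = f a" using nbr by simp
    then show ?thesis using f by blast
  qed
qed

lemma thin_pair_splitted:
  assumes "thin_pair k t X Y G"
  shows "if k then splitted G X Y else splitted G Y X"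
proof -
  have G: "simple_graph G" and V: "verts G = X \<union> Y" "X \<inter> Y = {}"
    and X: "\<And>x x'. x \<in> X \<Longrightarrow> x' \<in> X \<Longrightarrow> x \<noteq> x' \<Longrightarrow> adj G x x' \<longleftrightarrow> \<not> k"
    and Y: "\<And>y y'. y \<in> Y \<Longrightarrow> y' \<in> Y \<Longrightarrow> y \<noteq> y' \<Longrightarrow> adj G y y' \<longleftrightarrow> k"
    using assms unfolding thin_pair_def by blast+
  have irrefl: "\<not> adj G u u" for u using adjD(3)[OF G] by blast
  have "\<not> adj G u v" if "k" "u \<in> X" "v \<in> X" for u v using X[OF that(2,3)] irrefl that(1) by metis
  moreover have "\<not> adj G u v" if "\<not> k" "u \<in> Y" "v \<in> Y" for u v
    using Y[OF that(2,3)] irrefl that(1) by metis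
  ultimately show ?thesis
    using G V X Y by (cases k) (auto simp: splitted_iff decomposes_def)
qed

lemma expanded_spider_thin:
  assumes "top_expanded_spider G \<or> bottom_expanded_spider G"
  shows "\<exists>A B. splitted G A B \<and> thin_sides G A B"
  using assms
proof
  assume "top_expanded_spider G"
  then obtain J A B where J: "headless_spider J A B" and ex: "expansion complete B J G"
    unfolding top_expanded_spider_def by blast
  obtain f t where f: "bij_betw f A B" "\<And>a b. a \<in> A \<Longrightarrow> b \<in> B \<Longrightarrow> (adj J a b \<longleftrightarrow> t) \<longleftrightarrow> b = f a"
    using headless_spider_relation[OF J] by blast
  have "thin (\<lambda>a b. adj J a b \<longleftrightarrow> t) A B"
    unfolding thin_def using f(2) bij_betw_imp_inj_on[OF f(1)] by (metis inj_onD)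
  moreover have "splitted J A B" using J by (simp add: headless_spider_def)
  ultimately have "thin_pair True t A B J"
    by (auto simp: thin_pair_def splitted_iff decomposes_def)
  then have "\<exists>B'. thin_pair True t A B' G"
    by (rule expansion_thin_pair[OF ex]) (auto simp: complete_def adj_def)
  then obtain B' where B': "thin_pair True t A B' G" ..
  then have "thin (\<lambda>a b. adj G a b \<longleftrightarrow> t) A B'" by (simp add: thin_pair_def)
  then show ?thesis using thin_pair_splitted[OF B'] unfolding thin_sides_def by auto
next
  assume "bottom_expanded_spider G"
  then obtain J A B where J: "headless_spider J A B" and ex: "expansion edgeless A J G"
    unfolding bottom_expanded_spider_def by blast
  obtain f t where f: "bij_betw f A B" "\<And>a b. a \<in> A \<Longrightarrow> b \<in> B \<Longrightarrow> (adj J a b \<longleftrightarrow> t) \<longleftrightarrow> b = f a"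
    using headless_spider_relation[OF J] by blast
  have "thin (\<lambda>b a. adj J b a \<longleftrightarrow> t) B A"
    unfolding thin_def using f(2) adj_commute[of J] by metis
  moreover have "splitted J A B" using J by (simp add: headless_spider_def)
  ultimately have "thin_pair False t B A J"
    by (auto simp: thin_pair_def splitted_iff decomposes_def)
  then have "\<exists>A'. thin_pair False t B A' G"
    by (rule expansion_thin_pair[OF ex]) (auto simp: edgeless_def adj_def)
  then obtain A' where A': "thin_pair False t B A' G" ..
  then have "thin (\<lambda>b a. adj G b a \<longleftrightarrow> t) B A'" by (simp add: thin_pair_def)
  then show ?thesis using thin_pair_splitted[OF A'] unfolding thin_sides_def by auto
qed

text \<open>
  The vertices on which two splittings disagree, at most one from each side, would be a second
  factor of a composition.
\<close>

lemma indecomposable_splitting_unique: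
  assumes s: "splitted G A B" "splitted G A' B'" and ind: "\<not> decomposable G" and card: "1 < card (verts G)"
  shows "A = A' \<and> B = B'"
proof (rule ccontr)
  assume ne: "\<not> (A = A' \<and> B = B')"
  have G: "simple_graph G" using s(1) by (simp add: splitted_iff)
  have V: "verts G = A \<union> B" "A \<inter> B = {}" "verts G = A' \<union> B'" "A' \<inter> B' = {}"
    and ind1: "\<And>u v. u \<in> A \<Longrightarrow> v \<in> A \<Longrightarrow> \<not> adj G u v" "\<And>u v. u \<in> A' \<Longrightarrow> v \<in> A' \<Longrightarrow> \<not> adj G u v"
    and cl: "\<And>u v. u \<in> B \<Longrightarrow> v \<in> B \<Longrightarrow> u \<noteq> v \<Longrightarrow> adj G u v" "\<And>u v. u \<in> B' \<Longrightarrow> v \<in> B' \<Longrightarrow> u \<noteq> v \<Longrightarrow> adj G u v"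
    using s by (simp_all add: splitted_iff decomposes_def)
  note dec = decomposable_iff[OF G]
  let ?Q = "(A \<inter> B') \<union> (B \<inter> A')"
  have "decomposes G (A \<inter> A') (B \<inter> B') ?Q"
    unfolding decomposes_def
  proof (intro conjI ballI impI)
    show "verts G = A \<inter> A' \<union> B \<inter> B' \<union> ?Q" using V by blast
    show "adj G u v" if "u \<in> B \<inter> B'" "v \<in> ?Q" for u v
    proof -
      have "u \<noteq> v" using that V by blast
      then show ?thesis using that cl[of u v] by blast
    qed
    show "\<not> adj G u v" if "u \<in> A \<inter> A'" "v \<in> ?Q" for u v using that ind1[of u v] by blast
    show "\<not> adj G u v" if "u \<in> A \<inter> A'" "v \<in> A \<inter> A'" for u v using that ind1[of u v] by blast
    show "adj G u v" if "u \<in> B \<inter> B'" "v \<in> B \<inter> B'" "u \<noteq> v" for u v using that cl[of u v] by blast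
  qed (use V in blast)+
  moreover have "?Q \<noteq> {}" using ne V by blast
  ultimately have empty: "A \<inter> A' = {}" "B \<inter> B' = {}" using ind dec by blast+
  have "\<exists>x y. x \<in> verts G \<and> y \<in> verts G \<and> x \<noteq> y"
  proof (rule ccontr)
    assume no: "\<not> ?thesis"
    obtain x where "x \<in> verts G" using card by fastforce
    then have "verts G = {x}" using no by blast
    then show False using card by simp
  qed
  then obtain x y where xy: "x \<in> verts G" "y \<in> verts G" "x \<noteq> y" by blast
  \<comment> \<open>Now all of the graph is a single pair, which is decomposable whether or not it is an edge.\<close>
  have one: "u = v" if "u \<in> A" "v \<in> A" for u v
    using that ind1(1)[of u v] cl(2)[of u v] V empty by blast
  have one': "u = v" if "u \<in> B" "v \<in> B" for u v
    using that cl(1)[of u v] ind1(2)[of u v] V empty by blast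
  have Vxy: "verts G = {x, y}" using xy V(1) one one' by blast
  have nxx: "\<not> adj G x x" using adjD(3)[OF G] by blast
  show False
  proof (cases "adj G x y")
    case True
    have "decomposes G {} {x} {y}" unfolding decomposes_def using True Vxy xy(3) by auto
    then show False using ind dec by blast
  next
    case False
    have "decomposes G {x} {} {y}" unfolding decomposes_def using False Vxy xy(3) nxx by auto
    then show False using ind dec by blast
  qed
qed

lemma component_thin_sides:
  assumes s: "splitted G A B" and ind: "\<not> decomposable G"
    and spider: "1 < card (verts G) \<Longrightarrow> top_expanded_spider G \<or> bottom_expanded_spider G"
  shows "thin_sides G A B"
proof (cases "1 < card (verts G)")
  case True
  then obtain A' B' where "splitted G A' B'" "thin_sides G A' B'"
    using expanded_spider_thin[OF spider] by blast
  then show ?thesis using indecomposable_splitting_unique[OF s _ ind True] by blast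
next
  case False
  have "finite (verts G)" "A \<subseteq> verts G" using s by (auto simp: splitted_def simple_graph_finite)
  then have "x = x'" if "x \<in> A" "x' \<in> A" for x x'
    using that False card_le_Suc0_iff_eq[of "verts G"] by auto
  then have "thin (\<lambda>a b. adj G a b \<longleftrightarrow> True) A B" unfolding thin_def by blast
  then show ?thesis unfolding thin_sides_def by blast
qed


section \<open>Compositions with spiders are unigraphs\<close>

definition links :: "'a graph \<Rightarrow> 'a \<Rightarrow> 'a set \<Rightarrow> nat" where
  "links G x Y = card {y \<in> Y. adj G x y}"

lemma links_none:
  assumes "\<And>y. y \<in> Y \<Longrightarrow> \<not> adj G x y"
  shows "links G x Y = 0"
proof -
  have "{y \<in> Y. adj G x y} = {}" using assms by blast
  then show ?thesis by (simp only: links_def card.empty)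
qed

lemma links_all:
  assumes "\<And>y. y \<in> Y \<Longrightarrow> adj G x y \<longleftrightarrow> y \<in> Z" "Z \<subseteq> Y"
  shows "links G x Y = card Z"
proof -
  have "{y \<in> Y. adj G x y} = Z" using assms by blast
  then show ?thesis by (simp only: links_def)
qed

lemma links_mono:
  "finite Y \<Longrightarrow> (\<And>y. y \<in> Y \<Longrightarrow> adj H x y \<Longrightarrow> adj G x y) \<Longrightarrow> links H x Y \<le> links G x Y"
  unfolding links_def by (intro card_mono) auto

lemma links_eq_imp:
  assumes "finite Y" "links H x Y = links G x Y" "\<And>y. y \<in> Y \<Longrightarrow> adj H x y \<Longrightarrow> adj G x y"
    and "y \<in> Y" "adj G x y"
  shows "adj H x y"
proof -
  have "{y \<in> Y. adj H x y} = {y \<in> Y. adj G x y}"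
    using assms(1-3) unfolding links_def by (intro card_subset_eq) auto
  then show ?thesis using assms(4,5) by blast
qed

lemma sum_links_swap:
  assumes "finite X" "finite Y"
  shows "(\<Sum>x\<in>X. links G x Y) = (\<Sum>y\<in>Y. links G y X)"
  unfolding links_def
  by (rule sum_multicount_gen[OF assms]) (simp add: adj_commute)

lemma deg_partition:
  assumes "finite (verts G)" "verts G = A \<union> B \<union> Q" "A \<inter> B = {}" "A \<inter> Q = {}" "B \<inter> Q = {}"
  shows "deg G x = links G x A + links G x B + links G x Q"
proof -
  have fin: "finite A" "finite B" "finite Q" using assms by auto
  have "{u \<in> verts G. adj G x u} = {u \<in> A. adj G x u} \<union> {u \<in> B. adj G x u} \<union> {u \<in> Q. adj G x u}"
    using assms(2) by auto
  moreover have "card ({u \<in> A. adj G x u} \<union> {u \<in> B. adj G x u} \<union> {u \<in> Q. adj G x u}) =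
      links G x A + links G x B + links G x Q"
    unfolding links_def using fin assms(3-5)
    by (subst card_Un_disjoint, simp, simp, blast, subst card_Un_disjoint) auto
  ultimately show ?thesis by (simp add: deg_def)
qed

text \<open>
  In a composition the degree sum over \<open>B\<close> exceeds that over \<open>A\<close> by as much as it can for a
  graph on the same vertices, and the bound is attained only by compositions.
\<close>

lemma decomposition_determined_by_degrees:
  assumes G: "simple_graph G" and dec: "decomposes G A B Q" and H: "simple_graph H"
    and V: "verts H = verts G" and deg: "\<And>v. v \<in> verts G \<Longrightarrow> deg H v = deg G v"
  shows "decomposes H A B Q"
proof -
  have part: "verts G = A \<union> B \<union> Q" "A \<inter> B = {}" "A \<inter> Q = {}" "B \<inter> Q = {}"
    and A: "\<And>u v. u \<in> A \<Longrightarrow> v \<in> A \<Longrightarrow> \<not> adj G u v" and B: "\<And>u v. u \<in> B \<Longrightarrow> v \<in> B \<Longrightarrow> u \<noteq> v \<Longrightarrow> adj G u v"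
    and AQ: "\<And>u v. u \<in> A \<Longrightarrow> v \<in> Q \<Longrightarrow> \<not> adj G u v" and BQ: "\<And>u v. u \<in> B \<Longrightarrow> v \<in> Q \<Longrightarrow> adj G u v"
    using dec by (simp_all add: decomposes_def)
  have finV: "finite (verts G)" using simple_graph_finite[OF G] .
  then have fin: "finite A" "finite B" "finite Q" using part(1) by auto
  define E where "E F X Y = (\<Sum>x\<in>X. links F x Y)" for F :: "'a graph" and X Y
  have split: "(\<Sum>x\<in>X. deg F x) = E F X A + E F X B + E F X Q" if "verts F = verts G" for F X
    using deg_partition[of F A B Q] that part finV by (simp add: E_def sum.distrib)
  have same: "(\<Sum>x\<in>X. deg H x) = (\<Sum>x\<in>X. deg G x)" if "X \<subseteq> verts G" for X
    using that deg by (intro sum.cong) auto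
  have AB: "E F A B = E F B A" for F unfolding E_def by (rule sum_links_swap[OF fin(1,2)])
  have zero: "E G A A = 0" "E G A Q = 0"
  proof -
    have "links G a A = 0" "links G a Q = 0" if "a \<in> A" for a
      by (rule links_none; use that A AQ in blast)+
    then show "E G A A = 0" "E G A Q = 0" by (simp_all add: E_def)
  qed
  have rowB: "links H b B \<le> links G b B" if "b \<in> B" for b
    by (rule links_mono[OF fin(2)]) (use that B adjD(3)[OF H] in blast)
  have rowQ: "links H b Q \<le> links G b Q" if "b \<in> B" for b
    by (rule links_mono[OF fin(3)]) (use that BQ in blast)
  have le: "E H B B \<le> E G B B" "E H B Q \<le> E G B Q"
    unfolding E_def using rowB rowQ by (auto intro: sum_mono)
  have sumA: "E H A A + E H A B + E H A Q = E G A B"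
    using same[of A] split[OF V, of A] split[of G A] zero part(1) by auto
  have sumB: "E H B A + E H B B + E H B Q = E G B A + E G B B + E G B Q"
    using same[of B] split[OF V, of B] split[of G B] part(1) by auto
  have eq: "E H A A = 0" "E H A Q = 0" "E H B B = E G B B" "E H B Q = E G B Q"
    using le sumA sumB AB[of H] AB[of G] by linarith+
  have nolink: "\<not> adj H u v" if "E H X Y = 0" "finite X" "finite Y" "u \<in> X" "v \<in> Y" for X Y u v
  proof -
    have "links H u Y = 0" using that(1,2,4) by (simp add: E_def)
    then show ?thesis using that(3,5) by (auto simp: links_def)
  qed
  have rows: "links H b B = links G b B" "links H b Q = links G b Q" if "b \<in> B" for b
    using sum_mono_inv[of "\<lambda>b. links H b B" B "\<lambda>b. links G b B", OF eq(3)[unfolded E_def] rowB that fin(2)]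
      sum_mono_inv[of "\<lambda>b. links H b Q" B "\<lambda>b. links G b Q", OF eq(4)[unfolded E_def] rowQ that fin(2)] by simp_all
  show ?thesis
    unfolding decomposes_def
  proof (intro conjI ballI impI)
    show "\<not> adj H u v" if "u \<in> A" "v \<in> A" for u v by (rule nolink[OF eq(1) fin(1,1) that])
    show "\<not> adj H u v" if "u \<in> A" "v \<in> Q" for u v by (rule nolink[OF eq(2) fin(1,3) that])
    show "adj H u v" if "u \<in> B" "v \<in> B" "u \<noteq> v" for u v
      by (rule links_eq_imp[OF fin(2) rows(1)[OF that(1)] _ that(2) B[OF that]])
        (use B[OF that(1)] adjD(3)[OF H] in blast)
    show "adj H u v" if "u \<in> B" "v \<in> Q" for u v
      by (rule links_eq_imp[OF fin(3) rows(2)[OF that(1)] _ that(2) BQ[OF that]])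
        (use BQ[OF that(1)] in blast)
  qed (use part V in simp_all)
qed

text \<open>
  A partial function is determined up to a permutation of its arguments by how often it takes
  each value.
\<close>

lemma thin_determined_by_degrees:
  assumes fin: "finite X" "finite Y" and thin: "thin R X Y"
    and degY: "\<And>y. y \<in> Y \<Longrightarrow> card {x \<in> X. R' x y} = card {x \<in> X. R x y}"
    and degX: "\<And>x. x \<in> X \<Longrightarrow> card {y \<in> Y. R' x y} = card {y \<in> Y. R x y}"
  obtains h where "bij_betw h Y Y" "\<And>x y. x \<in> X \<Longrightarrow> y \<in> Y \<Longrightarrow> R' x y \<longleftrightarrow> R x (h y)"
proof -
  define q where "q S y = {x \<in> X. S x y}" for S :: "'a \<Rightarrow> 'b \<Rightarrow> bool" and y
  have finq: "finite (q S y)" for S y using fin(1) by (simp add: q_def)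
  have card: "card (q R' y) = card (q R y)" if "y \<in> Y" for y using degY[OF that] by (simp add: q_def)
  have le1: "card (q R y) \<le> 1" if "y \<in> Y" for y
    using thin that card_le_Suc0_iff_eq[OF finq[of R y]] unfolding thin_def by (auto simp: q_def)
  have count: "card {y \<in> Y. q R' y = Z} = card {y \<in> Y. q R y = Z}" for Z
  proof (cases "Z = {}")
    case True
    have "q R' y = {} \<longleftrightarrow> q R y = {}" if "y \<in> Y" for y
      using card[OF that] finq by (metis card_0_eq)
    then show ?thesis using True by (metis (mono_tags, lifting) Collect_cong)
  next
    case False
    show ?thesis
    proof (cases "\<exists>x\<in>X. Z = {x}")
      case True
      then obtain x where x: "x \<in> X" "Z = {x}" by blast
      have single: "q S y = {x} \<longleftrightarrow> S x y" if "card (q S y) \<le> 1" for S y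
      proof
        assume "q S y = {x}"
        then show "S x y" by (auto simp: q_def)
      next
        assume "S x y"
        then have "x \<in> q S y" using x(1) by (simp add: q_def)
        then show "q S y = {x}" using that card_le_Suc0_iff_eq[OF finq[of S y]] by auto
      qed
      have "q R' y = Z \<longleftrightarrow> R' x y" "q R y = Z \<longleftrightarrow> R x y" if "y \<in> Y" for y
        unfolding x(2) using single[of R' y] single[of R y] le1[OF that] card[OF that] by simp_all
      then have "{y \<in> Y. q R' y = Z} = {y \<in> Y. R' x y}" "{y \<in> Y. q R y = Z} = {y \<in> Y. R x y}"
        by blast+
      then show ?thesis using degX[OF x(1)] by simp
    next
      case no: False
      have "q S y \<noteq> Z" if "card (q S y) \<le> 1" for S y
      proof
        assume Z: "q S y = Z"
        then have "card Z = 1" using that False finq[of S y] by (metis One_nat_def card_0_eq le_Suc_eq le_zero_eq)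
        then obtain x where "Z = {x}" by (rule card_1_singletonE)
        then show False using no Z by (auto simp: q_def)
      qed
      then have "{y \<in> Y. q R' y = Z} = {}" "{y \<in> Y. q R y = Z} = {}" using le1 card by auto
      then show ?thesis by (simp only:)
    qed
  qed
  have "image_mset (q R') (mset_set Y) = image_mset (q R) (mset_set Y)"
    by (rule multiset_eqI) (use count fin(2) in \<open>simp add: count_image_mset_eq_card_vimage\<close>)
  then obtain h where h: "bij_betw h Y Y" "\<And>y. y \<in> Y \<Longrightarrow> q R (h y) = q R' y"
    using matching_values_bij[OF fin(2,2), of "q R'" "q R"] by blast
  have "R' x y \<longleftrightarrow> R x (h y)" if "x \<in> X" "y \<in> Y" for x y
  proof -
    have "x \<in> q R (h y) \<longleftrightarrow> x \<in> q R' y" using h(2)[OF that(2)] by simp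
    then show ?thesis using that(1) by (simp add: q_def)
  qed
  then show thesis using that h(1) by blast
qed

text \<open>This transfers equal degrees to the complementary relation.\<close>

lemma links_complementary:
  assumes "finite Y" "links H x Y = links G x Y"
  shows "card {y \<in> Y. adj H x y \<longleftrightarrow> t} = card {y \<in> Y. adj G x y \<longleftrightarrow> t}"
proof (cases t)
  case False
  have "{y \<in> Y. adj F x y \<longleftrightarrow> t} = Y - {y \<in> Y. adj F x y}" for F using False by auto
  moreover have "card (Y - {y \<in> Y. adj F x y}) = card Y - links F x Y" for F
    unfolding links_def using assms(1) by (subst card_Diff_subset) auto
  ultimately show ?thesis using assms(2) by simp
qed (use assms in \<open>simp add: links_def\<close>)

text \<open>
  The isomorphism permutes one of the sides \<open>A\<close> and \<open>B\<close>, fixes the other one, and is any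
  isomorphism between the graphs induced by \<open>Q\<close>. It respects the remaining adjacencies because it
  preserves \<open>A\<close>, \<open>B\<close> and \<open>Q\<close>.
\<close>

lemma unigraph_composition:
  assumes G: "simple_graph G" and dec: "decomposes G A B Q" and thin: "thin_sides G A B"
    and Q: "unigraph (induced G Q)"
  shows "unigraph G"
  unfolding unigraph_iff_same_degrees
proof (intro conjI allI impI; (elim conjE)?)
  show "simple_graph G" by (rule G)
  fix H :: "'a graph"
  assume H: "simple_graph H" and V: "verts H = verts G" and deg: "\<forall>v\<in>verts G. deg H v = deg G v"
  have decH: "decomposes H A B Q" using decomposition_determined_by_degrees[OF G dec H V] deg by blast
  have part: "verts G = A \<union> B \<union> Q" "A \<inter> B = {}" "A \<inter> Q = {}" "B \<inter> Q = {}"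
    using dec by (simp_all add: decomposes_def)
  have finV: "finite (verts G)" using simple_graph_finite[OF G] .
  then have fin: "finite A" "finite B" "finite Q" using part(1) by auto
  have degF: "deg F x = links F x A + links F x B + links F x Q" if "verts F = verts G" for F x
    using deg_partition[of F A B Q] that part finV by simp
  have sameA: "links H a B = links G a B" if "a \<in> A" for a
  proof -
    have "links F a A = 0" "links F a Q = 0" if "decomposes F A B Q" for F
      by (rule links_none; erule decomposesD(1,3)[OF that \<open>a \<in> A\<close>])+
    then show ?thesis using degF[OF V, of a] degF[OF refl, of a] deg that part(1) dec decH by simp
  qed
  have sameB: "links H b A = links G b A" if b: "b \<in> B" for b
  proof -
    have "links F b B = card (B - {b})" "links F b Q = card Q" if F: "decomposes F A B Q" "simple_graph F" for F
    proof -
      have "adj F b y \<longleftrightarrow> y \<in> B - {b}" if "y \<in> B" for y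
        using that decomposesD(2)[OF F(1) b that] adjD(3)[OF F(2), of b y] by blast
      then show "links F b B = card (B - {b})" by (rule links_all) auto
      show "links F b Q = card Q"
        by (rule links_all) (use decomposesD(4)[OF F(1) b] in auto)
    qed
    then show ?thesis using degF[OF V, of b] degF[OF refl, of b] deg b part(1) dec decH G H by simp
  qed
  have sameQ: "links H c Q = links G c Q" if c: "c \<in> Q" for c
  proof -
    have "links F c A = 0" "links F c B = card B" if F: "decomposes F A B Q" for F
    proof -
      show "links F c A = 0" by (rule links_none) (rule decomposesD(5)[OF F c])
      show "links F c B = card B"
        by (rule links_all) (use decomposesD(6)[OF F c] in auto)
    qed
    then show ?thesis using degF[OF V, of c] degF[OF refl, of c] deg c part(1) dec decH by simp
  qed
  have subQ: "Q \<subseteq> verts G" "Q \<subseteq> verts H" using part(1) V by auto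
  have "deg (induced H Q) c = deg (induced G Q) c" if "c \<in> Q" for c
    using sameQ[OF that] that by (simp add: deg_induced links_def)
  then have "induced H Q \<simeq> induced G Q"
    using Q simple_induced[OF H subQ(2)] unfolding unigraph_iff_same_degrees by simp
  then obtain g where g: "bij_betw g Q Q"
    and adjg': "\<forall>x\<in>Q. \<forall>y\<in>Q. adj (induced H Q) x y \<longleftrightarrow> adj (induced G Q) (g x) (g y)"
    unfolding graph_iso_adj verts_induced by blast
  have gQ: "g x \<in> Q" if "x \<in> Q" for x using bij_betwE[OF g] that by blast
  have adjg: "adj H x y \<longleftrightarrow> adj G (g x) (g y)" if "x \<in> Q" "y \<in> Q" for x y
    using adjg'[THEN bspec, OF that(1), THEN bspec, OF that(2)] that gQ by simp
  have "\<exists>hA hB. bij_betw hA A A \<and> bij_betw hB B B \<and> (\<forall>a\<in>A. \<forall>b\<in>B. adj H a b \<longleftrightarrow> adj G (hA a) (hB b))"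
  proof -
    obtain t where "thin (\<lambda>a b. adj G a b \<longleftrightarrow> t) A B \<or> thin (\<lambda>b a. adj G b a \<longleftrightarrow> t) B A"
      using thin unfolding thin_sides_def by blast
    then show ?thesis
    proof
      assume th: "thin (\<lambda>a b. adj G a b \<longleftrightarrow> t) A B"
      obtain h where h: "bij_betw h B B"
        and adj: "\<And>a b. a \<in> A \<Longrightarrow> b \<in> B \<Longrightarrow> (adj H a b \<longleftrightarrow> t) \<longleftrightarrow> (adj G a (h b) \<longleftrightarrow> t)"
      proof (rule thin_determined_by_degrees[OF fin(1,2) th, of "\<lambda>a b. adj H a b \<longleftrightarrow> t"])
        show "card {a \<in> A. adj H a b \<longleftrightarrow> t} = card {a \<in> A. adj G a b \<longleftrightarrow> t}" if "b \<in> B" for b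
          using links_complementary[OF fin(1) sameB[OF that], of t] by (simp add: adj_commute)
        show "card {b \<in> B. adj H a b \<longleftrightarrow> t} = card {b \<in> B. adj G a b \<longleftrightarrow> t}" if "a \<in> A" for a
          using links_complementary[OF fin(2) sameA[OF that], of t] .
      qed blast
      have "\<forall>a\<in>A. \<forall>b\<in>B. adj H a b \<longleftrightarrow> adj G (id a) (h b)" using adj by auto
      then show ?thesis using h bij_betw_id[of A] by blast
    next
      assume th: "thin (\<lambda>b a. adj G b a \<longleftrightarrow> t) B A"
      obtain h where h: "bij_betw h A A"
        and adj: "\<And>b a. b \<in> B \<Longrightarrow> a \<in> A \<Longrightarrow> (adj H b a \<longleftrightarrow> t) \<longleftrightarrow> (adj G b (h a) \<longleftrightarrow> t)"
      proof (rule thin_determined_by_degrees[OF fin(2,1) th, of "\<lambda>b a. adj H b a \<longleftrightarrow> t"])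
        show "card {b \<in> B. adj H b a \<longleftrightarrow> t} = card {b \<in> B. adj G b a \<longleftrightarrow> t}" if "a \<in> A" for a
          using links_complementary[OF fin(2) sameA[OF that], of t] by (simp add: adj_commute)
        show "card {a \<in> A. adj H b a \<longleftrightarrow> t} = card {a \<in> A. adj G b a \<longleftrightarrow> t}" if "b \<in> B" for b
          using links_complementary[OF fin(1) sameB[OF that], of t] .
      qed blast
      have "adj H a b \<longleftrightarrow> adj G (h a) (id b)" if "a \<in> A" "b \<in> B" for a b
        using adj[OF that(2,1)] adj_commute[of H a b] adj_commute[of G "h a" b] by auto
      then show ?thesis using h bij_betw_id[of B] by blast
    qed
  qed
  then obtain hA hB where hA: "bij_betw hA A A" and hB: "bij_betw hB B B"
    and adjAB: "\<And>a b. a \<in> A \<Longrightarrow> b \<in> B \<Longrightarrow> adj H a b \<longleftrightarrow> adj G (hA a) (hB b)" by blast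
  define f where "f x = (if x \<in> A then hA x else if x \<in> B then hB x else g x)" for x
  have fA: "f x = hA x" "f x \<in> A" if "x \<in> A" for x using that bij_betwE[OF hA] by (simp_all add: f_def)
  have fB: "f x = hB x" "f x \<in> B" if "x \<in> B" for x
  proof -
    have "x \<notin> A" using that part(2) by blast
    then show "f x = hB x" "f x \<in> B" using that bij_betwE[OF hB] by (simp_all add: f_def)
  qed
  have fQ: "f x = g x" "f x \<in> Q" if "x \<in> Q" for x
  proof -
    have "x \<notin> A" "x \<notin> B" using that part(3,4) by blast+
    then show "f x = g x" "f x \<in> Q" using that gQ by (simp_all add: f_def)
  qed
  have bij: "bij_betw f (verts H) (verts G)"
  proof -
    have "bij_betw f A A" by (rule bij_betw_cong[THEN iffD1, OF _ hA]) (simp add: fA)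
    moreover have "bij_betw f B B" by (rule bij_betw_cong[THEN iffD1, OF _ hB]) (simp add: fB)
    ultimately have "bij_betw f (A \<union> B) (A \<union> B)" using part(2) by (rule bij_betw_combine)
    moreover have "bij_betw f Q Q" by (rule bij_betw_cong[THEN iffD1, OF _ g]) (simp add: fQ)
    moreover have "(A \<union> B) \<inter> Q = {}" using part(3,4) by blast
    ultimately have "bij_betw f (A \<union> B \<union> Q) (A \<union> B \<union> Q)" by (rule bij_betw_combine)
    then show ?thesis using part(1) V by simp
  qed
  have inj: "f x \<noteq> f y" if "x \<in> verts G" "y \<in> verts G" "x \<noteq> y" for x y
    using bij that V by (metis bij_betw_inv_into_left)
  have F: "\<not> adj F u v" if "decomposes F A B Q" "u \<in> A" "v \<in> A \<or> v \<in> Q" for F u v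
    using that(3) decomposesD(1,3)[OF that(1,2)] by blast
  have F': "adj F u v" if "decomposes F A B Q" "u \<in> B" "v \<in> B \<and> u \<noteq> v \<or> v \<in> Q" for F u v
    using that(3) decomposesD(2,4)[OF that(1,2)] by blast
  have one_way: "adj H x y \<longleftrightarrow> adj G (f x) (f y)"
    if xy: "x \<in> verts G" "y \<in> verts G" "x \<in> A \<or> x \<in> B \<and> y \<notin> A \<or> x \<in> Q \<and> y \<in> Q" for x y
  proof (cases "x = y")
    case True
    then show ?thesis using adjD(3)[OF H] adjD(3)[OF G] by blast
  next
    case False
    consider "x \<in> A" "y \<in> A \<or> y \<in> Q" | "x \<in> A" "y \<in> B" | "x \<in> B" "y \<in> B \<or> y \<in> Q" | "x \<in> Q" "y \<in> Q"
      using xy part(1) by blast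
    then show ?thesis
    proof cases
      case 1
      then show ?thesis using F[OF decH 1] F[OF dec, of "f x" "f y"] fA(2) fQ(2) by blast
    next
      case 2
      then show ?thesis using adjAB[OF 2] fA(1)[OF 2(1)] fB(1)[OF 2(2)] by simp
    next
      case 3
      then have "adj H x y" using F'[OF decH, of x y] False by blast
      moreover have "adj G (f x) (f y)"
        using 3 F'[OF dec, of "f x" "f y"] fB(2) fQ(2) inj[OF xy(1,2) False] by blast
      ultimately show ?thesis by blast
    next
      case 4
      then show ?thesis using adjg[OF 4] fQ(1) by simp
    qed
  qed
  have "adj H x y \<longleftrightarrow> adj G (f x) (f y)" if xy: "x \<in> verts G" "y \<in> verts G" for x y
  proof (cases "x \<in> A \<or> x \<in> B \<and> y \<notin> A \<or> x \<in> Q \<and> y \<in> Q")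
    case True
    then show ?thesis by (rule one_way[OF xy])
  next
    case False
    then have "y \<in> A \<or> y \<in> B \<and> x \<notin> A \<or> y \<in> Q \<and> x \<in> Q" using xy part(1) by blast
    then show ?thesis
      using one_way[OF xy(2,1)] adj_commute[of H x y] adj_commute[of G "f x" "f y"] by blast
  qed
  then show "H \<simeq> G" unfolding graph_iso_adj V using bij V by auto
qed

lemma thin_sides_mono:
  assumes "thin_sides G A B" "A' \<subseteq> A" "B' \<subseteq> B"
    and adj: "\<And>a b. a \<in> A' \<Longrightarrow> b \<in> B' \<Longrightarrow> adj H a b \<longleftrightarrow> adj G a b"
  shows "thin_sides H A' B'"
proof -
  obtain t where t: "thin (\<lambda>a b. adj G a b \<longleftrightarrow> t) A B \<or> thin (\<lambda>b a. adj G b a \<longleftrightarrow> t) B A"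
    using assms(1) unfolding thin_sides_def by blast
  have mono: "thin R' X' Y'"
    if "thin R X Y" "X' \<subseteq> X" "Y' \<subseteq> Y" "\<And>x y. x \<in> X' \<Longrightarrow> y \<in> Y' \<Longrightarrow> R' x y \<Longrightarrow> R x y"
    for R R' :: "'a \<Rightarrow> 'a \<Rightarrow> bool" and X Y X' Y'
    using that unfolding thin_def by blast
  have adj': "adj H b a \<longleftrightarrow> adj G b a" if "a \<in> A'" "b \<in> B'" for a b
    using adj[OF that] adj_commute[of H a b] adj_commute[of G a b] by simp
  have "thin (\<lambda>a b. adj H a b \<longleftrightarrow> t) A' B' \<or> thin (\<lambda>b a. adj H b a \<longleftrightarrow> t) B' A'"
    using t
  proof
    assume "thin (\<lambda>a b. adj G a b \<longleftrightarrow> t) A B"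
    from mono[OF this assms(2,3), of "\<lambda>a b. adj H a b \<longleftrightarrow> t"] adj show ?thesis by blast
  next
    assume "thin (\<lambda>b a. adj G b a \<longleftrightarrow> t) B A"
    from mono[OF this assms(3,2), of "\<lambda>b a. adj H b a \<longleftrightarrow> t"] adj' show ?thesis by blast
  qed
  then show ?thesis unfolding thin_sides_def by blast
qed

lemma hereditary_unigraph_composition:
  assumes G: "simple_graph G" and dec: "decomposes G A B Q" and thin: "thin_sides G A B"
    and Q: "hereditary_unigraph (induced G Q)"
  shows "hereditary_unigraph G"
  unfolding hereditary_unigraph_def
proof (intro conjI allI impI)
  show "simple_graph G" by (rule G)
  fix S assume S: "S \<subseteq> verts G"
  have "unigraph (induced (induced G Q) (Q \<inter> S))" using Q by (simp add: hereditary_unigraph_def)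
  then have u: "unigraph (induced (induced G S) (Q \<inter> S))" by (simp add: induced_induced)
  have "thin_sides (induced G S) (A \<inter> S) (B \<inter> S)"
    by (rule thin_sides_mono[OF thin]) auto
  then show "unigraph (induced G S)"
    using unigraph_composition[OF simple_induced[OF G S] decomposes_induced[OF dec S]] u by blast
qed

lemma unigraph_no_vertices:
  assumes "simple_graph G" "verts G = {}"
  shows "unigraph G"
  using assms unfolding unigraph_iff_same_degrees graph_iso_adj by (auto simp: bij_betw_def)

lemma hereditary_unigraph_thin_splitting:
  assumes s: "splitted G A B" and thin: "thin_sides G A B"
  shows "hereditary_unigraph G"
proof (rule hereditary_unigraph_composition[OF _ _ thin])
  show G: "simple_graph G" "decomposes G A B {}" using s by (simp_all add: splitted_iff)
  have "unigraph (induced G {})" by (rule unigraph_no_vertices) (use G simple_induced in auto)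
  then show "hereditary_unigraph (induced G {})"
    using simple_induced[OF G(1), of "{}"] by (simp add: hereditary_unigraph_def induced_induced)
qed


section \<open>The exceptional graphs are hereditary unigraphs\<close>

lemma deg_eq_1_iff:
  assumes "simple_graph G"
  shows "deg G v = 1 \<longleftrightarrow> (\<exists>!u. adj G v u)"
proof
  assume "deg G v = 1"
  then obtain u where u: "{u \<in> verts G. adj G v u} = {u}"
    unfolding deg_def by (rule card_1_singletonE)
  show "\<exists>!u. adj G v u"
    by (rule ex1I[of _ u]) (use u adjD(2)[OF assms] in blast)+
next
  assume "\<exists>!u. adj G v u"
  then obtain u where u: "adj G v u" "\<And>w. adj G v w \<Longrightarrow> w = u" by blast
  then have "{u \<in> verts G. adj G v u} = {u}" using adjD(2)[OF assms u(1)] by blast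
  then show "deg G v = 1" by (simp add: deg_def)
qed

text \<open>
  The induced subgraphs of a star with a matching, where \<open>c\<close> is the centre of the star unless that
  has been removed.
\<close>

definition nearly_matched :: "'a graph \<Rightarrow> 'a \<Rightarrow> bool" where
  "nearly_matched G c \<longleftrightarrow> (\<forall>v\<in>verts G. v \<noteq> c \<longrightarrow>
     (\<forall>x\<in>verts G. \<forall>y\<in>verts G. adj G v x \<and> adj G v y \<longrightarrow> x = y))"

text \<open>
  Isolated vertices split off as a first factor \<open>(I, {})\<close>. For the others the degrees say which
  vertex is the centre, how large the star is, and hence how many edges the matching has.
\<close>

lemma unigraph_nearly_matched:
  assumes G: "simple_graph G" and near: "nearly_matched G c"
  shows "unigraph G"
proof -
  define I where "I = {v \<in> verts G. \<forall>u\<in>verts G. \<not> adj G v u}"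
  define Q where "Q = verts G - I"
  have dec: "decomposes G I {} Q"
    unfolding decomposes_def I_def Q_def by auto
  have thin: "thin_sides G I {}" unfolding thin_sides_def thin_def by blast
  have QV: "Q \<subseteq> verts G" by (auto simp: Q_def)
  let ?K = "induced G Q"
  have K: "simple_graph ?K" by (rule simple_induced[OF G QV])
  have "unigraph ?K"
  proof (cases "Q = {}")
    case True
    then show ?thesis using unigraph_no_vertices[OF K] by simp
  next
    case False
    then obtain c0 where c0: "c0 \<in> Q" "\<And>v. v \<in> Q \<Longrightarrow> v \<noteq> c0 \<Longrightarrow> v \<noteq> c" by (metis equals0I)
    have matched: "\<exists>!u. adj ?K v u" if v: "v \<in> Q" "v \<noteq> c0" for v
    proof -
      obtain u where u: "u \<in> verts G" "adj G v u" using v(1) by (auto simp: Q_def I_def)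
      have vV: "v \<in> verts G" using v QV by blast
      have "u \<in> Q" using u vV adj_commute[of G u v] by (auto simp: Q_def I_def)
      then have "adj ?K v u" using u v by simp
      moreover have "w = u" if "adj ?K v w" for w
      proof -
        have "w \<in> verts G" "adj G v w" using that QV by auto
        then show ?thesis using near vV c0(2)[OF v] u unfolding nearly_matched_def by blast
      qed
      ultimately show ?thesis by (rule ex1I[of _ u])
    qed
    have c0K: "c0 \<in> verts ?K" using c0(1) by simp
    obtain s where s: "?K \<simeq> disjoint_union (complete_bipartite 1 (deg ?K c0)) (copies s (complete_graph 2))"
      "card (verts ?K) = 1 + deg ?K c0 + 2 * s"
      using star_and_matching_iso[OF K c0K] matched by auto
    have "H \<simeq> ?K" if H: "simple_graph H" "verts H = verts ?K" "\<forall>v\<in>verts ?K. deg H v = deg ?K v" for H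
    proof -
      have "\<exists>!u. adj H v u" if "v \<in> verts H" "v \<noteq> c0" for v
      proof -
        have "v \<in> Q" using that H(2) by simp
        then have "deg ?K v = 1" using matched[of v] that(2) deg_eq_1_iff[OF K, of v] by blast
        then have "deg H v = 1" using H(3) \<open>v \<in> Q\<close> by simp
        then show ?thesis using deg_eq_1_iff[OF H(1), of v] by blast
      qed
      from star_and_matching_iso[OF H(1) _ this] obtain s'
        where s': "H \<simeq> disjoint_union (complete_bipartite 1 (deg H c0)) (copies s' (complete_graph 2))"
          "card (verts H) = 1 + deg H c0 + 2 * s'"
        using c0K H(2) by auto
      have d: "deg H c0 = deg ?K c0" using H(3) c0K by blast
      have "card (verts H) = card (verts ?K)" using H(2) by simp
      then have "s' = s" using s(2) s'(2) d by linarith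
      then show ?thesis using s'(1) graph_iso_sym[OF s(1)] graph_iso_trans unfolding d by blast
    qed
    then show ?thesis unfolding unigraph_iff_same_degrees using K by blast
  qed
  then show ?thesis by (rule unigraph_composition[OF G dec thin])
qed

lemma hereditary_unigraph_nearly_matched:
  assumes G: "simple_graph G" and near: "nearly_matched G c"
  shows "hereditary_unigraph G"
  unfolding hereditary_unigraph_def
proof (intro conjI allI impI G)
  fix S assume S: "S \<subseteq> verts G"
  have "nearly_matched (induced G S) c"
    using near S unfolding nearly_matched_def verts_induced adj_induced by blast
  then show "unigraph (induced G S)"
    by (rule unigraph_nearly_matched[OF simple_induced[OF G S]])
qed

lemma nearly_matched_iso:
  assumes "F \<simeq> H" "nearly_matched H c"
  shows "\<exists>c'. nearly_matched F c'"
proof -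
  obtain f where f: "bij_betw f (verts F) (verts H)"
    and adj: "\<forall>u\<in>verts F. \<forall>v\<in>verts F. adj F u v \<longleftrightarrow> adj H (f u) (f v)"
    using assms(1) unfolding graph_iso_adj by blast
  have "nearly_matched F (inv_into (verts F) f c)"
    unfolding nearly_matched_def
  proof (intro ballI impI, elim conjE)
    fix v x y assume v: "v \<in> verts F" "v \<noteq> inv_into (verts F) f c" and x: "x \<in> verts F" and y: "y \<in> verts F"
      and vx: "adj F v x" and vy: "adj F v y"
    have "f v \<noteq> c" using bij_betw_inv_into_left[OF f v(1)] v(2) by auto
    moreover have "f v \<in> verts H" "f x \<in> verts H" "f y \<in> verts H" using bij_betwE[OF f] v x y by blast+
    moreover have "adj H (f v) (f x)" "adj H (f v) (f y)" using adj v x y vx vy by blast+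
    ultimately have "f x = f y" using assms(2) unfolding nearly_matched_def by blast
    then show "x = y" using bij_betw_imp_inj_on[OF f] x y by (meson inj_onD)
  qed
  then show ?thesis by blast
qed

lemma nearly_matched_copies_K2: "nearly_matched (copies r (complete_graph 2)) c"
  unfolding nearly_matched_def
proof (intro ballI impI; elim conjE)
  fix v x y assume "adj (copies r (complete_graph 2)) v x" "adj (copies r (complete_graph 2)) v y"
  then show "x = y" by (cases v; cases x; cases y) (auto simp: adj_copies_K2)
qed

lemma nearly_matched_star_and_copies_K2:
  "nearly_matched (disjoint_union (complete_bipartite 1 r) (copies s (complete_graph 2))) (Inl (Inl 0))"
  unfolding nearly_matched_def
proof (intro ballI impI; elim conjE)
  let ?H = "disjoint_union (complete_bipartite 1 r) (copies s (complete_graph 2))"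
  fix v x y assume v: "v \<in> verts ?H" "v \<noteq> Inl (Inl 0)" and adj: "adj ?H v x" "adj ?H v y"
  show "x = y"
  proof (cases v)
    case (Inl w)
    then obtain j where w: "w = Inr j"
      using v by (cases w) (auto simp: verts_disjoint_union verts_complete_bipartite)
    have "z = Inl (Inl 0)" if "adj ?H v z" for z
    proof (cases z)
      case z: (Inl u)
      then show ?thesis
        using that Inl w by (cases u) (simp_all add: adj_disjoint_union adj_complete_bipartite)
    qed (use that Inl in \<open>simp add: adj_disjoint_union\<close>)
    then show ?thesis using adj by metis
  next
    case v': (Inr p)
    obtain q q' where q: "x = Inr q" "y = Inr q'"
      using adj v' by (cases x; cases y) (auto simp: adj_disjoint_union)
    then show ?thesis
      using adj v' by (cases p; cases q; cases q') (auto simp: adj_disjoint_union adj_copies_K2)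
  qed
qed

lemma two_regular_five_vertices:
  assumes G: "simple_graph G" and five: "card (verts G) = 5"
    and deg: "\<And>v. v \<in> verts G \<Longrightarrow> deg G v = 2"
  shows "\<exists>a b c d e. induces_C5 G a b c d e \<and> verts G = {a, b, c, d, e}"
proof -
  define N where "N v = {u \<in> verts G. adj G v u}" for v
  have card: "card (N v) = 2" if "v \<in> verts G" for v using deg[OF that] by (simp add: N_def deg_def)
  have sym: "u \<in> N v \<longleftrightarrow> v \<in> N u" if "u \<in> verts G" "v \<in> verts G" for u v
    using that adj_commute[of G u v] by (simp add: N_def)
  have irrefl: "v \<notin> N v" for v using adjD(3)[OF G, of v v] by (auto simp: N_def)
  have NV: "N v \<subseteq> verts G" for v by (auto simp: N_def)
  have other: "\<exists>w. w \<noteq> u \<and> N v = {u, w}" if h: "v \<in> verts G" "u \<in> N v" for u v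
  proof -
    obtain p q where "N v = {p, q}" "p \<noteq> q" using card[OF h(1)] by (auto simp: card_2_iff)
    then show ?thesis using h(2) by (cases "u = p") auto
  qed
  have not_one: "\<not> N v \<subseteq> {u}" if "v \<in> verts G" for u v
    using card[OF that] card_mono[of "{u}" "N v"] by auto
  obtain v where v: "v \<in> verts G" using five by fastforce
  obtain x y where xy: "N v = {x, y}" "x \<noteq> y" using card[OF v] by (auto simp: card_2_iff)
  have xV: "x \<in> verts G" "y \<in> verts G" and vne: "x \<noteq> v" "y \<noteq> v" using xy NV[of v] irrefl[of v] by auto
  have vx: "v \<in> N x" "v \<in> N y" using sym[OF v] xV xy by auto
  obtain x' where x': "x' \<noteq> v" "N x = {v, x'}" using other[OF xV(1) vx(1)] by blast
  obtain y' where y': "y' \<noteq> v" "N y = {v, y'}" using other[OF xV(2) vx(2)] by blast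
  have x'V: "x' \<in> verts G" "y' \<in> verts G" using NV[of x] NV[of y] x' y' by auto
  have rest: "card (verts G - {v, x, y}) = 2"
    using five v xV vne xy(2) by (subst card_Diff_subset) auto
  then obtain p q where pq: "verts G - {v, x, y} = {p, q}" "p \<noteq> q" by (auto simp: card_2_iff)
  have V: "verts G = {v, x, y, p, q}" using pq(1) v xV by auto
  have pqne: "p \<noteq> v" "p \<noteq> x" "p \<noteq> y" "q \<noteq> v" "q \<noteq> x" "q \<noteq> y" using pq(1) by auto
  have pqV: "p \<in> verts G" "q \<in> verts G" using V by auto
  \<comment> \<open>A vertex at distance more than one from \<open>v\<close>, \<open>x\<close> and \<open>y\<close> has too few neighbours left.\<close>
  have seen: "w \<in> N x \<or> w \<in> N y" if w: "w = p \<or> w = q" for w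
  proof (rule ccontr)
    assume no: "\<not> ?thesis"
    have wV: "w \<in> verts G" and wne: "w \<noteq> x" "w \<noteq> y" using w pqV pqne by auto
    have "x \<notin> N w" "y \<notin> N w" using no sym[OF wV xV(1)] sym[OF wV xV(2)] by auto
    moreover have "v \<notin> N w" using sym[OF wV v] xy(1) wne by auto
    moreover have "w \<notin> N w" by (rule irrefl)
    ultimately have "N w \<subseteq> {if w = p then q else p}" using NV[of w] V w by auto
    then show False using not_one[OF wV] by blast
  qed
  have ends: "x' = p \<and> y' = q \<or> x' = q \<and> y' = p"
    using seen[of p] seen[of q] x' y' pqne pq(2) by auto
  have sub: "x' \<noteq> x" "x' \<noteq> y" "y' \<noteq> x" "y' \<noteq> y" "x' \<noteq> y'" and V': "verts G = {v, x, x', y', y}"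
    using ends pqne pq(2) V by auto
  have nx: "y \<notin> N x'" "v \<notin> N x'" "x \<notin> N y'" "v \<notin> N y'"
    using sym[OF xV(2) x'V(1)] sym[OF v x'V(1)] sym[OF xV(1) x'V(2)] sym[OF v x'V(2)] y'(2) x'(2) xy(1)
      sub x'(1) y'(1) by auto
  have "N x' \<subseteq> {x, y'}" using NV[of x'] V' nx irrefl[of x'] by auto
  then have "y' \<in> N x'" using not_one[OF x'V(1), of x] by blast
  moreover have "x \<notin> N y" using y'(2) vne(1) sub by auto
  moreover have "x' \<in> N x" "y' \<in> N y" "x \<in> N v" "y \<in> N v" using x' y' xy by auto
  moreover have "x' \<notin> N v" "y' \<notin> N v" "y' \<notin> N x" "y \<notin> N x"
    using xy(1) x'(2) sub y'(1) vne by auto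
  ultimately have "adj G v x" "adj G x x'" "adj G x' y'" "adj G y' y" "adj G v y"
    "\<not> adj G v x'" "\<not> adj G v y'" "\<not> adj G x y'" "\<not> adj G x y" "\<not> adj G x' y"
    using xV x'V nx adj_commute[of G y' y] by (simp_all add: N_def)
  then have "induces_C5 G v x x' y' y"
    unfolding induces_C5_def using V' xy(2) vne x'(1) y'(1) sub by auto
  then show ?thesis using V' by blast
qed

text \<open>The inner vertices of the path form the clique of a splitting.\<close>

lemma hereditary_unigraph_P4:
  assumes G: "simple_graph G" and C: "induces_C5 G a b c d e"
  shows "hereditary_unigraph (induced G {a, b, c, d})"
proof (rule hereditary_unigraph_thin_splitting)
  let ?H = "induced G {a, b, c, d}"
  have C': "{a, b, c, d} \<subseteq> verts G" "distinct [a, b, c, d]" "adj G a b" "adj G b c" "adj G c d"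
    "\<not> adj G a c" "\<not> adj G a d" "\<not> adj G b d"
    using C by (simp_all add: induces_C5_def)
  have sym: "adj G c b" "\<not> adj G d a" "\<not> adj G d b"
    using C' adj_commute[of G c b] adj_commute[of G d a] adj_commute[of G d b] by blast+
  have irrefl: "\<not> adj G u u" for u using adjD(3)[OF G, of u u] by blast
  have "decomposes ?H {a, d} {b, c} {}"
    unfolding decomposes_def using C'(2-) sym irrefl by auto
  then show "splitted ?H {a, d} {b, c}" using simple_induced[OF G C'(1)] by (simp add: splitted_iff)
  have "thin (\<lambda>x y. adj ?H x y \<longleftrightarrow> True) {a, d} {b, c}"
    unfolding thin_def using C' sym by auto
  then show "thin_sides ?H {a, d} {b, c}" unfolding thin_sides_def by blast
qed

lemma hereditary_unigraph_C5:
  assumes G: "simple_graph G" and iso: "G \<simeq> cycle_graph 5"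
  shows "hereditary_unigraph G"
proof -
  obtain g where g: "bij_betw g {..<5} (verts G)"
    and adjg: "\<forall>i\<in>{..<5}. \<forall>j\<in>{..<5}. adj (cycle_graph 5) i j \<longleftrightarrow> adj G (g i) (g j)"
    using graph_iso_sym[OF iso] unfolding graph_iso_adj verts_cycle_graph by blast
  have adj: "adj G (g i) (g j) \<longleftrightarrow> j = (i + 1) mod 5 \<or> i = (j + 1) mod 5" if "i < 5" "j < 5" for i j
    using adjg that by (simp add: adj_cycle_graph)
  have five: "{..<5::nat} = {0, 1, 2, 3, 4}" by auto
  have inj: "g i \<noteq> g j" if "i < 5" "j < 5" "i \<noteq> j" for i j
    using bij_betw_imp_inj_on[OF g] that by (metis inj_onD lessThan_iff)
  have V: "verts G = {g 0, g 1, g 2, g 3, g 4}"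
    using bij_betw_imp_surj_on[OF g] unfolding five by simp
  have C: "induces_C5 G (g 0) (g 1) (g 2) (g 3) (g 4)"
    unfolding induces_C5_def V by (simp add: adj inj)
  have card: "card (verts G) = 5" using bij_betw_same_card[OF g] by simp
  have deg: "deg G v = 2" if "v \<in> verts G" for v
  proof -
    have "v \<in> g ` {..<5}" using that bij_betw_imp_surj_on[OF g] by simp
    then obtain i where i: "i < 5" "v = g i" by auto
    have "{u \<in> verts G. adj G v u} = g ` {j \<in> {..<5}. j = (i + 1) mod 5 \<or> i = (j + 1) mod 5}"
    proof -
      have "{u \<in> verts G. adj G v u} = g ` {j \<in> {..<5}. adj G v (g j)}"
        unfolding bij_betw_imp_surj_on[OF g, symmetric] by blast
      moreover have "{j \<in> {..<5}. adj G v (g j)} = {j \<in> {..<5}. j = (i + 1) mod 5 \<or> i = (j + 1) mod 5}"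
        using adj[OF i(1)] i(2) by auto
      ultimately show ?thesis by (simp only:)
    qed
    moreover have "{j \<in> {..<5}. j = (i + 1) mod 5 \<or> i = (j + 1) mod 5} = {(i + 1) mod 5, (i + 4) mod 5}"
    proof -
      have "i = 0 \<or> i = 1 \<or> i = 2 \<or> i = 3 \<or> i = 4" using i(1) by auto
      then show ?thesis unfolding five by auto
    qed
    moreover have "g ((i + 1) mod 5) \<noteq> g ((i + 4) mod 5)"
    proof (rule inj)
      have "i = 0 \<or> i = 1 \<or> i = 2 \<or> i = 3 \<or> i = 4" using i(1) by auto
      then show "(i + 1) mod 5 \<noteq> (i + 4) mod 5" by auto
    qed simp_all
    ultimately show ?thesis by (simp add: deg_def)
  qed
  have "unigraph G"
    unfolding unigraph_iff_same_degrees
  proof (intro conjI allI impI G; elim conjE)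
    fix H :: "'a graph"
    assume H: "simple_graph H" "verts H = verts G" "\<forall>v\<in>verts G. deg H v = deg G v"
    obtain a b c d e where "induces_C5 H a b c d e" "verts H = {a, b, c, d, e}"
      using two_regular_five_vertices[OF H(1)] H card deg by auto
    then have "H \<simeq> cycle_graph 5" using induces_C5_iso[OF H(1)] by blast
    then show "H \<simeq> G" using graph_iso_trans graph_iso_sym[OF iso] by blast
  qed
  moreover have "unigraph (induced G S)" if S: "S \<subseteq> verts G" "S \<noteq> verts G" for S
  proof -
    have inside: "unigraph (induced G S)" if "induces_C5 G a b c d e" "S \<subseteq> {a, b, c, d}" for a b c d e
    proof -
      have "unigraph (induced (induced G {a, b, c, d}) S)"
        using hereditary_unigraph_P4[OF G that(1)] that(2) by (simp add: hereditary_unigraph_def)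
      then show ?thesis by (simp add: induced_induced[OF that(2)])
    qed
    have C1: "induces_C5 G (g 1) (g 2) (g 3) (g 4) (g 0)" using induces_C5_rotate[OF C] .
    have C2: "induces_C5 G (g 2) (g 3) (g 4) (g 0) (g 1)" using induces_C5_rotate[OF C1] .
    have C3: "induces_C5 G (g 3) (g 4) (g 0) (g 1) (g 2)" using induces_C5_rotate[OF C2] .
    have C4: "induces_C5 G (g 4) (g 0) (g 1) (g 2) (g 3)" using induces_C5_rotate[OF C3] .
    have SV: "S \<subseteq> {g 0, g 1, g 2, g 3, g 4}" using S(1) V by simp
    obtain v where "v \<in> verts G" "v \<notin> S" using S by blast
    then consider "g 0 \<notin> S" | "g 1 \<notin> S" | "g 2 \<notin> S" | "g 3 \<notin> S" | "g 4 \<notin> S" unfolding V by blast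
    then show ?thesis
    proof cases
      case 1 show ?thesis by (rule inside[OF C1]) (use 1 SV in auto)
    next
      case 2 show ?thesis by (rule inside[OF C2]) (use 2 SV in auto)
    next
      case 3 show ?thesis by (rule inside[OF C3]) (use 3 SV in auto)
    next
      case 4 show ?thesis by (rule inside[OF C4]) (use 4 SV in auto)
    next
      case 5 show ?thesis by (rule inside[OF C]) (use 5 SV in auto)
    qed
  qed
  ultimately show ?thesis
    using induced_verts[OF G] G unfolding hereditary_unigraph_def by metis
qed


section \<open>The characterisation\<close>

lemma foldr_compose_simple:
  assumes "\<forall>(H, A, B) \<in> set Cs. splitted H A B" "simple_graph G0"
    and "sorted_wrt disjnt (map (\<lambda>(H, A, B). verts H) Cs @ [verts G0])"
  shows "simple_graph (foldr compose Cs G0) \<and>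
    verts (foldr compose Cs G0) = \<Union> (set (map (\<lambda>(H, A, B). verts H) Cs @ [verts G0]))"
  using assms
proof (induction Cs)
  case Nil
  then show ?case by simp
next
  case (Cons C Cs)
  obtain T A B where C: "C = (T, A, B)" by (cases C) auto
  have IH: "simple_graph (foldr compose Cs G0)"
    "verts (foldr compose Cs G0) = \<Union> (set (map (\<lambda>(H, A, B). verts H) Cs @ [verts G0]))"
    using Cons by auto
  have "splitted T A B" using Cons.prems(1) C by auto
  moreover have "verts T \<inter> verts (foldr compose Cs G0) = {}"
  proof -
    have "\<forall>W \<in> set (map (\<lambda>(H, A, B). verts H) Cs @ [verts G0]). disjnt (verts T) W"
      using Cons.prems(3) C by (simp add: case_prod_unfold)
    then show ?thesis unfolding IH(2) disjnt_def by blast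
  qed
  ultimately show ?case using simple_compose[OF _ IH(1)] IH(2) C by auto
qed

lemma foldr_compose_Cons:
  assumes "\<forall>(H, A, B) \<in> set ((T, A, B) # Cs). splitted H A B" "simple_graph G0"
    and "sorted_wrt disjnt (map (\<lambda>(H, A, B). verts H) ((T, A, B) # Cs) @ [verts G0])"
  shows "splitted T A B" "simple_graph (foldr compose Cs G0)"
    "verts T \<inter> verts (foldr compose Cs G0) = {}"
proof -
  show "splitted T A B" using assms(1) by auto
  have K: "simple_graph (foldr compose Cs G0) \<and>
      verts (foldr compose Cs G0) = \<Union> (set (map (\<lambda>(H, A, B). verts H) Cs @ [verts G0]))"
    by (rule foldr_compose_simple) (use assms in auto)
  then show "simple_graph (foldr compose Cs G0)" by blast
  show "verts T \<inter> verts (foldr compose Cs G0) = {}"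
  proof -
    have "\<forall>W \<in> set (map (\<lambda>(H, A, B). verts H) Cs @ [verts G0]). disjnt (verts T) W"
      using assms(3) by simp
    then show ?thesis unfolding conjunct2[OF K] disjnt_def by blast
  qed
qed

lemma components_hereditary_unigraph:
  assumes "\<forall>(H, A, B) \<in> set Cs. splitted H A B" "simple_graph G0"
    and "sorted_wrt disjnt (map (\<lambda>(H, A, B). verts H) Cs @ [verts G0])"
    and "hereditary_unigraph (foldr compose Cs G0)"
  shows "\<forall>H \<in> canonical_components Cs G0. hereditary_unigraph H"
  using assms
proof (induction Cs)
  case Nil
  then show ?case by (simp add: canonical_components_def)
next
  case (Cons C Cs)
  obtain T A B where C: "C = (T, A, B)" by (cases C) auto
  let ?K = "foldr compose Cs G0"
  note K = foldr_compose_Cons[OF Cons.prems(1-3)[unfolded C]]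
  have hu: "hereditary_unigraph (compose (T, A, B) ?K)" using Cons.prems(4) C by simp
  have "hereditary_unigraph T" "hereditary_unigraph ?K"
    using hereditary_unigraph_induced[OF hu, of "verts T"] hereditary_unigraph_induced[OF hu, of "verts ?K"]
      induced_compose_left[OF K] induced_compose_right[OF K] by simp_all
  moreover have "\<forall>H \<in> canonical_components Cs G0. hereditary_unigraph H"
    by (rule Cons.IH) (use Cons.prems \<open>hereditary_unigraph ?K\<close> in auto)
  ultimately show ?case using C by (auto simp: canonical_components_def)
qed

lemma hereditary_unigraph_foldr_compose:
  assumes "\<forall>(H, A, B) \<in> set Cs. splitted H A B" "simple_graph G0"
    and "sorted_wrt disjnt (map (\<lambda>(H, A, B). verts H) Cs @ [verts G0])"
    and "\<forall>(H, A, B) \<in> set Cs. thin_sides H A B" "hereditary_unigraph G0"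
  shows "hereditary_unigraph (foldr compose Cs G0)"
  using assms
proof (induction Cs)
  case Nil
  then show ?case by simp
next
  case (Cons C Cs)
  obtain T A B where C: "C = (T, A, B)" by (cases C) auto
  let ?K = "foldr compose Cs G0"
  let ?G = "compose (T, A, B) ?K"
  note K = foldr_compose_Cons[OF Cons.prems(1-3)[unfolded C]]
  have hK: "hereditary_unigraph ?K" by (rule Cons.IH) (use Cons.prems in auto)
  have thin: "thin_sides T A B" using Cons.prems(4) C by auto
  have AB: "A \<subseteq> verts T" "B \<subseteq> verts T" using K(1) by (auto simp: splitted_def)
  have "thin_sides ?G A B"
  proof (rule thin_sides_mono[OF thin order_refl order_refl])
    fix a b assume "a \<in> A" "b \<in> B"
    then have "adj ?G a b \<longleftrightarrow> adj (induced ?G (verts T)) a b" using AB by auto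
    then show "adj ?G a b \<longleftrightarrow> adj T a b" unfolding induced_compose_left[OF K] .
  qed
  then have "hereditary_unigraph ?G"
    using hereditary_unigraph_composition[OF simple_compose[OF K] decomposes_compose[OF K]]
      hK induced_compose_right[OF K] by simp
  then show ?case using C by simp
qed

theorem theorem4p5:
  fixes G G0 :: "'a graph"
    and Cs :: "('a graph \<times> 'a set \<times> 'a set) list"
  assumes "simple_graph G"
    and "canonical_decomposition G Cs G0"
  shows "hereditary_unigraph G \<longleftrightarrow>
    (\<forall>H \<in> canonical_components Cs G0.
       split_graph H \<and> card (verts H) > 1 \<longrightarrow>
         top_expanded_spider H \<or> bottom_expanded_spider H) \<and>
    (\<exists>F \<in> {G0, complement G0}.
       split_graph F \<or>
       F \<simeq> cycle_graph 5 \<or>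
       (\<exists>r\<ge>2. F \<simeq> copies r (complete_graph 2)) \<or>
       (\<exists>r\<ge>2. \<exists>s\<ge>1. F \<simeq> disjoint_union (complete_bipartite 1 r)
                                     (copies s (complete_graph 2))))"
    (is "_ \<longleftrightarrow> ?spiders \<and> (\<exists>F \<in> _. split_graph F \<or> ?exceptional F)")
proof -
  have Cs: "\<forall>(H, A, B) \<in> set Cs. splitted H A B \<and> \<not> decomposable H"
    and G0: "simple_graph G0" "\<not> decomposable G0"
    and disj: "sorted_wrt disjnt (map (\<lambda>(H, A, B). verts H) Cs @ [verts G0])"
    and G: "G = foldr compose Cs G0"
    using assms(2) unfolding canonical_decomposition_def by auto
  have split: "\<forall>(H, A, B) \<in> set Cs. splitted H A B" using Cs by auto
  have ind: "\<not> decomposable H" if "H \<in> canonical_components Cs G0" for H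
    using that Cs G0(2) by (auto simp: canonical_components_def)
  have spider: "top_expanded_spider H \<or> bottom_expanded_spider H"
    if H: "hereditary_unigraph H" "\<not> decomposable H" "split_graph H" "1 < card (verts H)" for H :: "'a graph"
  proof -
    obtain A B where AB: "splitted H A B" using H(3) unfolding split_graph_def by blast
    show ?thesis
      by (rule starlike_expanded_spider[OF AB indecomposable_split_starlike[OF H(1,2) AB H(4)]])
  qed
  have exceptional: "hereditary_unigraph F" if F: "simple_graph F" "?exceptional F" for F
  proof (cases "F \<simeq> cycle_graph 5")
    case True
    then show ?thesis by (rule hereditary_unigraph_C5[OF F(1)])
  next
    case False
    then have "\<exists>c. nearly_matched F c"
      using F(2) nearly_matched_iso[OF _ nearly_matched_copies_K2]
        nearly_matched_iso[OF _ nearly_matched_star_and_copies_K2] by blast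
    then show ?thesis using hereditary_unigraph_nearly_matched[OF F(1)] by blast
  qed
  show ?thesis
  proof
    assume "hereditary_unigraph G"
    then have hu: "hereditary_unigraph H" if "H \<in> canonical_components Cs G0" for H
      using components_hereditary_unigraph[OF split G0(1) disj] that unfolding G by blast
    have "G0 \<in> canonical_components Cs G0" by (simp add: canonical_components_def)
    then have "\<exists>F \<in> {G0, complement G0}. split_graph F \<or> ?exceptional F"
      using indecomposable_nonsplit_structure[OF hu G0(2)] by blast
    moreover have ?spiders using spider hu ind by blast
    ultimately show "?spiders \<and> (\<exists>F \<in> {G0, complement G0}. split_graph F \<or> ?exceptional F)" by blast
  next
    assume rhs: "?spiders \<and> (\<exists>F \<in> {G0, complement G0}. split_graph F \<or> ?exceptional F)"
    then have spiders: ?spiders by blast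
    have thin: "thin_sides H A B" if H: "H \<in> canonical_components Cs G0" "splitted H A B" for H A B
    proof (rule component_thin_sides[OF H(2) ind[OF H(1)]])
      have "split_graph H" using H(2) unfolding split_graph_def by blast
      then show "top_expanded_spider H \<or> bottom_expanded_spider H" if "1 < card (verts H)"
        using spiders H(1) that by blast
    qed
    have "hereditary_unigraph G0"
    proof (cases "split_graph G0")
      case True
      then obtain A B where AB: "splitted G0 A B" unfolding split_graph_def by blast
      show ?thesis
        by (rule hereditary_unigraph_thin_splitting[OF AB thin[OF _ AB]])
          (simp add: canonical_components_def)
    next
      case False
      then have "\<not> split_graph (complement G0)"
        using split_graph_complement[OF simple_complement[OF G0(1)]] complement_complement[OF G0(1)]
        by metis
      then obtain F where F: "F = G0 \<or> F = complement G0" "?exceptional F" using rhs False by blast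
      then have "hereditary_unigraph F" using exceptional simple_complement[OF G0(1)] G0(1) by blast
      then show ?thesis
        using F(1) hereditary_unigraph_complement[of "complement G0"] complement_complement[OF G0(1)]
        by auto
    qed
    moreover have "\<forall>(H, A, B) \<in> set Cs. thin_sides H A B"
    proof (clarify)
      fix H A B assume "(H, A, B) \<in> set Cs"
      then show "thin_sides H A B"
        using thin[of H A B] split by (force simp: canonical_components_def)
    qed
    ultimately show "hereditary_unigraph G"
      unfolding G using hereditary_unigraph_foldr_compose[OF split G0(1) disj] by blast
  qed
qed

end
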